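(* Let $\eta>0$ and $p>0$, and let $\bm{f}=(f_j)_{j\in J}$ be a right-hand side with a splitting $(f_{i;j})_{i,\,j\in J_i}$ satisfying $\sum_{i:\,j\in J_i} f_{i;j}=f_j$ for all $j\in J$. Let $u\in\mathcal{P}(\mathcal{T})$ be the discrete mono-domain solution. Then the discrete optimized Schwarz method with auxiliary variables (as defined in the context) converges: for every choice of initial auxiliary values $g^0_{i,i';j}\in\mathbb{R}$ (for all $i\ne i'$ and $j\in J_i\cap J_{i'}$ with $\mathcal{E}_{i,i';j}\neq\emptyset$), the subdomain iterates $u_i^n\in\mathcal{P}(\mathcal{T}_i)$ satisfy $u_i^n\to u_{|\Omega_i}$ as $n\to\infty$ for every $i\in\{1,\dots,I\}$.
   Context: Setting. $\Omega\subset\mathbb{R}^2$ is a bounded polygonal domain with a conforming polygonal mesh $\mathcal{T}$, and $(\Omega_i)_{1\le i\le I}$ is a non-overlapping decomposition of $\Omega$ into polygonal subdomains such that each cell of $\mathcal{T}$ is contained in exactly one subdomain; $\mathcal{T}_i$ is the restriction of $\mathcal{T}$ to $\Omega_i$. More than two subdomains may meet at a vertex (cross-point). Finite elements. $\mathcal{P}(\mathcal{T})\subset H_0^1(\Omega)$ is a nodal finite element space with exactly one degree of freedom at each vertex $\bm{x}_j$ of $\mathcal{T}$ not on $\partial\Omega$; $J$ is the set of indices of these vertices. $\phi_j\in\mathcal{P}(\mathcal{T})$, $j\in J$, are the nodal (hat) basis functions, $\phi_j(\bm{x}_{j'})=\delta_{jj'}$, with $\phi_j$ supported in the cells having $\bm{x}_j$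 as a vertex. Moreover, if $v\in\mathcal{P}(\mathcal{T})$ vanishes at both endpoints of a mesh edge, it vanishes on that edge. (Examples: $P_1$ on triangles, $Q_1$ on Cartesian meshes.) Put $\mathcal{P}(\mathcal{T}_i)=\{v_{|\Omega_i}: v\in\mathcal{P}(\mathcal{T})\}$, $J_i=\{j\in J:\bm{x}_j\in\overline{\Omega}_i\}$, $\phi_{i;j}=(\phi_j)_{|\Omega_i}$; functions $u_i\in\mathcal{P}(\mathcal{T}_i)$ are written $u_i=\sum_{j\in J_i}u_{i;j}\phi_{i;j}$. Mono-domain solution. The unique $u\in\mathcal{P}(\mathcal{T})$ with $\eta\int_\Omega u\,\phi_j+\int_\Omega\nabla u\cdot\nabla\phi_j=f_j$ for all $j\in J$ (discretization of $(\eta-\Delta)u=f$ with homogeneous Dirichlet condition). Edge sets and matrices. For $j\in J_i$ let $\mathcal{E}_{i;j}$ be the set of $j''$ such that $[\bm{x}_j\bm{x}_{j''}]$ is a boundary edge of $\mathcal{T}_i$ (i.e. a mesh edge contained in $\partial\Omega_i$), where $\bm{x}_{j''}$ may be any mesh vertex, possibly on $\partial\Omega$; for $i\neq i'$ let $\mathcal{E}_{i,i';j}$ be the set of $j''$ such that $[\bm{x}_j\bm{x}_{j''}]$ is a boundary edge of both $\mathcal{T}_i$ and $\mathcal{T}_{i'}$. Define, for $j,j'\in J_i$, $$A_{i;j,j'}=\eta\int_{\Omega_i}\phi_{i;j}\phi_{i;j'}+\int_{\Omega_i}\nabla\phi_{i;j}\cdot\nabla\phi_{i;j'},\qquad B^{\rm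 lump}_{i;j,j'}=\delta_{jj'}\,\frac p2\sum_{j''\in\mathcal{E}_{i;j}}|\bm{x}_j-\bm{x}_{j''}|.$$ Discrete optimized Schwarz method with auxiliary variables. Given auxiliary values $g^n_{i,i';j}$ (Robin data at $\bm{x}_j$ sent from subdomain $i'$ to subdomain $i$, defined whenever $\mathcal{E}_{i,i';j}\ne\emptyset$): 1. set $g^{n+1}_{i;j}=\sum_{i':\,\mathcal{E}_{i,i';j}\neq\emptyset}g^n_{i,i';j}$ for $j\in J_i$ (zero if the sum is empty); 2. compute $\bm{u}_i^{n+1}=(u_{i;j}^{n+1})_{j\in J_i}$ solving $(\mathbf{A}_i+\mathbf{B}_i^{\rm lump})\bm{u}_i^{n+1}=\bm{f}_i+\bm{g}_i^{n+1}$, where $\bm{f}_i=(f_{i;j})_{j\in J_i}$; 3. set $g^{n+1}_{i',i;j}=-g^n_{i,i';j}+p\,u^{n+1}_{i;j}\sum_{j''\in\mathcal{E}_{i,i';j}}|\bm{x}_j-\bm{x}_{j''}|$. *)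

theory Defs
  imports "HOL-Analysis.Analysis"
begin

section \<open>Sobolev spaces on open subsets of the plane\<close>

primrec Ck :: "nat \<Rightarrow> (real^2 \<Rightarrow> real) \<Rightarrow> bool" where
  "Ck 0 f \<longleftrightarrow> continuous_on UNIV f"
| "Ck (Suc k) f \<longleftrightarrow>
     f differentiable_on UNIV \<and> (\<forall>b\<in>Basis. Ck k (\<lambda>x. frechet_derivative f (at x) b))"

definition test_function :: "(real^2) set \<Rightarrow> (real^2 \<Rightarrow> real) \<Rightarrow> bool" where
  "test_function S \<psi> \<longleftrightarrow>
     (\<forall>k. Ck k \<psi>) \<and> compact (closure {x. \<psi> x \<noteq> 0}) \<and> closure {x. \<psi> x \<noteq> 0} \<subseteq> S"

definition square_integrable :: "(real^2) set \<Rightarrow> (real^2 \<Rightarrow> 'b::euclidean_space) \<Rightarrow> bool" where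
  "square_integrable S f \<longleftrightarrow>
     f \<in> borel_measurable (lebesgue_on S) \<and> integrable (lebesgue_on S) (\<lambda>x. (norm (f x))\<^sup>2)"

definition is_weak_gradient ::
    "(real^2) set \<Rightarrow> (real^2 \<Rightarrow> real) \<Rightarrow> (real^2 \<Rightarrow> real^2) \<Rightarrow> bool" where
  "is_weak_gradient S f G \<longleftrightarrow>
     (\<forall>\<psi>. test_function S \<psi> \<longrightarrow> (\<forall>b\<in>Basis.
        (\<integral>x. f x * frechet_derivative \<psi> (at x) b \<partial>lebesgue_on S)
          = - (\<integral>x. (G x \<bullet> b) * \<psi> x \<partial>lebesgue_on S)))"

definition H1 :: "(real^2) set \<Rightarrow> (real^2 \<Rightarrow> real) set" where
  "H1 S = {f. square_integrable S f \<and> (\<exists>G. square_integrable S G \<and> is_weak_gradient S f G)}"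

text \<open>
  For \<open>f \<in> H1 S\<close> this is a representative of the gradient, which is determined only up to a
  null subset of \<open>S\<close>; it depends only on the values of \<open>f\<close> on \<open>S\<close>, so
  \<open>wgrad S f\<close> is the gradient of the restriction of \<open>f\<close> to \<open>S\<close>.
\<close>
definition wgrad :: "(real^2) set \<Rightarrow> (real^2 \<Rightarrow> real) \<Rightarrow> real^2 \<Rightarrow> real^2" where
  "wgrad S f = (SOME G. square_integrable S G \<and> is_weak_gradient S f G)"

definition H1_norm :: "(real^2) set \<Rightarrow> (real^2 \<Rightarrow> real) \<Rightarrow> real" where
  "H1_norm S f =
     sqrt ((\<integral>x. (f x)\<^sup>2 \<partial>lebesgue_on S) + (\<integral>x. (norm (wgrad S f x))\<^sup>2 \<partial>lebesgue_on S))"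

definition H10 :: "(real^2) set \<Rightarrow> (real^2 \<Rightarrow> real) set" where
  "H10 S = {f \<in> H1 S. \<exists>\<psi>. (\<forall>n. test_function S (\<psi> n)) \<and>
                          (\<lambda>n. H1_norm S (\<lambda>x. f x - \<psi> n x)) \<longlonglongrightarrow> 0}"

definition bilinear_form ::
    "real \<Rightarrow> (real^2) set \<Rightarrow> (real^2 \<Rightarrow> real) \<Rightarrow> (real^2 \<Rightarrow> real) \<Rightarrow> real" where
  "bilinear_form \<eta> S v w =
     \<eta> * (\<integral>x. v x * w x \<partial>lebesgue_on S) + (\<integral>x. wgrad S v x \<bullet> wgrad S w x \<partial>lebesgue_on S)"


section \<open>Polygonal domains, meshes and decompositions\<close>

text \<open>
  The condition \<open>interior (closure S) = S\<close> excludes slits (and punctures): a domain does not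
  lie on both sides of a boundary segment. Holes and non-convexity are allowed.
\<close>
definition polygonal_domain :: "(real^2) set \<Rightarrow> bool" where
  "polygonal_domain S \<longleftrightarrow>
     open S \<and> connected S \<and> S \<noteq> {} \<and> interior (closure S) = S \<and>
     (\<exists>F. finite F \<and> frontier S = (\<Union>(a, b)\<in>F. closed_segment a b))"

text \<open>
  A cell is given by the cyclic list of its vertices and is the open region enclosed by the
  corresponding simple closed polygon; flat angles at vertices are allowed. An edge is encoded
  as the set of its two endpoints, so that the segment is its convex hull.
\<close>
definition poly_edges :: "(real^2) list \<Rightarrow> (real^2) set set" where
  "poly_edges vs = {{vs ! k, vs ! (Suc k mod length vs)} | k. k < length vs}"

definition simple_polygon :: "(real^2) list \<Rightarrow> bool" where
  "simple_polygon vs \<longleftrightarrow> 3 \<le> length vs \<and> distinct vs \<and>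
     (\<forall>e\<in>poly_edges vs. \<forall>e'\<in>poly_edges vs. e \<noteq> e' \<longrightarrow> convex hull e \<inter> convex hull e' \<subseteq> e \<inter> e')"

definition cell :: "(real^2) list \<Rightarrow> (real^2) set" where
  "cell vs = inside (\<Union>e\<in>poly_edges vs. convex hull e)"

definition mesh_vertices :: "(real^2) list set \<Rightarrow> (real^2) set" where
  "mesh_vertices T = (\<Union>vs\<in>T. set vs)"

definition mesh_edges :: "(real^2) list set \<Rightarrow> (real^2) set set" where
  "mesh_edges T = (\<Union>vs\<in>T. poly_edges vs)"

text \<open>
  Conformity: two closed cells meet only in common vertices and common edges. For non-convex
  cells there may be several of these.
\<close>
definition conforming_mesh :: "(real^2) set \<Rightarrow> (real^2) list set \<Rightarrow> bool" where
  "conforming_mesh \<Omega> T \<longleftrightarrow>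
     finite T \<and>
     (\<forall>vs\<in>T. simple_polygon vs \<and> cell vs \<subseteq> \<Omega>) \<and>
     closure \<Omega> = (\<Union>vs\<in>T. closure (cell vs)) \<and>
     (\<forall>vs\<in>T. \<forall>ws\<in>T. vs \<noteq> ws \<longrightarrow>
        cell vs \<inter> cell ws = {} \<and>
        closure (cell vs) \<inter> closure (cell ws)
          \<subseteq> (set vs \<inter> set ws) \<union> (\<Union>e\<in>poly_edges vs \<inter> poly_edges ws. convex hull e))"

definition nonoverlapping_decomposition ::
    "(real^2) set \<Rightarrow> (real^2) list set \<Rightarrow> nat \<Rightarrow> (nat \<Rightarrow> (real^2) set) \<Rightarrow> bool" where
  "nonoverlapping_decomposition \<Omega> T I \<Omega>s \<longleftrightarrow>
     (\<forall>i\<in>{1..I}. polygonal_domain (\<Omega>s i) \<and> \<Omega>s i \<subseteq> \<Omega>) \<and>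
     (\<forall>i\<in>{1..I}. \<forall>i'\<in>{1..I}. i \<noteq> i' \<longrightarrow> \<Omega>s i \<inter> \<Omega>s i' = {}) \<and>
     closure \<Omega> = (\<Union>i\<in>{1..I}. closure (\<Omega>s i)) \<and>
     (\<forall>vs\<in>T. \<exists>!i. i \<in> {1..I} \<and> cell vs \<subseteq> \<Omega>s i)"


section \<open>Nodal finite elements\<close>

text \<open>The vertices themselves serve as their indices.\<close>
definition nodes :: "(real^2) set \<Rightarrow> (real^2) list set \<Rightarrow> (real^2) set" where
  "nodes \<Omega> T = {x \<in> mesh_vertices T. x \<notin> frontier \<Omega>}"

definition local_nodes ::
    "(real^2) set \<Rightarrow> (real^2) list set \<Rightarrow> (real^2) set \<Rightarrow> (real^2) set" where
  "local_nodes \<Omega> T S = {x \<in> nodes \<Omega> T. x \<in> closure S}"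

definition hat ::
    "(real^2) set \<Rightarrow> (real^2) list set \<Rightarrow> (real^2 \<Rightarrow> real) set \<Rightarrow> real^2 \<Rightarrow> real^2 \<Rightarrow> real" where
  "hat \<Omega> T P x = (THE v. v \<in> P \<and> (\<forall>y\<in>nodes \<Omega> T. v y = (if y = x then 1 else 0)))"

text \<open>
  Finite element functions are continuous, so that nodal values make sense, and are identified
  with their extension by zero outside \<open>\<Omega>\<close>.
\<close>
definition nodal_fe_space ::
    "(real^2) set \<Rightarrow> (real^2) list set \<Rightarrow> (real^2 \<Rightarrow> real) set \<Rightarrow> bool" where
  "nodal_fe_space \<Omega> T P \<longleftrightarrow>
     (\<lambda>x. 0) \<in> P \<and>
     (\<forall>v\<in>P. \<forall>w\<in>P. (\<lambda>x. v x + w x) \<in> P) \<and>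
     (\<forall>c. \<forall>v\<in>P. (\<lambda>x. c * v x) \<in> P) \<and>
     P \<subseteq> H10 \<Omega> \<and>
     (\<forall>v\<in>P. continuous_on UNIV v \<and> (\<forall>x. x \<notin> \<Omega> \<longrightarrow> v x = 0)) \<and>
     (\<forall>c. \<exists>!v. v \<in> P \<and> (\<forall>x\<in>nodes \<Omega> T. v x = c x)) \<and>
     (\<forall>x\<in>nodes \<Omega> T. \<forall>z. hat \<Omega> T P x z \<noteq> 0 \<longrightarrow> (\<exists>vs\<in>T. x \<in> set vs \<and> z \<in> closure (cell vs))) \<and>
     (\<forall>v\<in>P. \<forall>a b. {a, b} \<in> mesh_edges T \<and> v a = 0 \<and> v b = 0 \<longrightarrow>
                  (\<forall>z\<in>closed_segment a b. v z = 0))"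

definition mono_domain_solution ::
    "real \<Rightarrow> (real^2) set \<Rightarrow> (real^2) list set \<Rightarrow> (real^2 \<Rightarrow> real) set \<Rightarrow> (real^2 \<Rightarrow> real)
      \<Rightarrow> (real^2 \<Rightarrow> real) \<Rightarrow> bool" where
  "mono_domain_solution \<eta> \<Omega> T P f u \<longleftrightarrow>
     u \<in> P \<and> (\<forall>x\<in>nodes \<Omega> T. bilinear_form \<eta> \<Omega> u (hat \<Omega> T P x) = f x)"


section \<open>The discrete optimized Schwarz method with auxiliary variables\<close>

definition boundary_nbrs :: "(real^2) list set \<Rightarrow> (real^2) set \<Rightarrow> real^2 \<Rightarrow> (real^2) set" where
  "boundary_nbrs T S x = {y. {x, y} \<in> mesh_edges T \<and> closed_segment x y \<subseteq> frontier S}"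

definition shared_nbrs ::
    "(real^2) list set \<Rightarrow> (real^2) set \<Rightarrow> (real^2) set \<Rightarrow> real^2 \<Rightarrow> (real^2) set" where
  "shared_nbrs T S S' x = boundary_nbrs T S x \<inter> boundary_nbrs T S' x"

definition A_matrix ::
    "real \<Rightarrow> (real^2) set \<Rightarrow> (real^2) list set \<Rightarrow> (real^2 \<Rightarrow> real) set \<Rightarrow> (real^2) set
      \<Rightarrow> real^2 \<Rightarrow> real^2 \<Rightarrow> real" where
  "A_matrix \<eta> \<Omega> T P S x y = bilinear_form \<eta> S (hat \<Omega> T P x) (hat \<Omega> T P y)"

definition B_lump :: "real \<Rightarrow> (real^2) list set \<Rightarrow> (real^2) set \<Rightarrow> real^2 \<Rightarrow> real^2 \<Rightarrow> real" where
  "B_lump p T S x y = (if x = y then p / 2 * (\<Sum>z\<in>boundary_nbrs T S x. dist x z) else 0)"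

text \<open>The solution of the linear system on \<open>S\<close>, extended by zero to indices that are not nodes
  of \<open>S\<close>.\<close>
definition local_solve ::
    "real \<Rightarrow> real \<Rightarrow> (real^2) set \<Rightarrow> (real^2) list set \<Rightarrow> (real^2 \<Rightarrow> real) set \<Rightarrow> (real^2) set
      \<Rightarrow> (real^2 \<Rightarrow> real) \<Rightarrow> real^2 \<Rightarrow> real" where
  "local_solve \<eta> p \<Omega> T P S r =
     (THE w. (\<forall>x\<in>local_nodes \<Omega> T S.
                (\<Sum>y\<in>local_nodes \<Omega> T S. (A_matrix \<eta> \<Omega> T P S x y + B_lump p T S x y) * w y) = r x) \<and>
             (\<forall>x. x \<notin> local_nodes \<Omega> T S \<longrightarrow> w x = 0))"

text \<open>
  In the following, \<open>g i i' x\<close> is the Robin datum at \<open>x\<close> sent from subdomain \<open>i'\<close> to subdomain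
  \<open>i\<close>; it is only ever used when \<open>i \<noteq> i'\<close> and the two subdomains share an edge at \<open>x\<close>.
\<close>
definition gather ::
    "(real^2) list set \<Rightarrow> nat \<Rightarrow> (nat \<Rightarrow> (real^2) set) \<Rightarrow> (nat \<Rightarrow> nat \<Rightarrow> real^2 \<Rightarrow> real)
      \<Rightarrow> nat \<Rightarrow> real^2 \<Rightarrow> real" where
  "gather T I \<Omega>s g i x =
     (\<Sum>i' | i' \<in> {1..I} \<and> i' \<noteq> i \<and> shared_nbrs T (\<Omega>s i) (\<Omega>s i') x \<noteq> {}. g i i' x)"

definition schwarz_solve ::
    "real \<Rightarrow> real \<Rightarrow> (real^2) set \<Rightarrow> (real^2) list set \<Rightarrow> (real^2 \<Rightarrow> real) set
      \<Rightarrow> nat \<Rightarrow> (nat \<Rightarrow> (real^2) set) \<Rightarrow> (nat \<Rightarrow> real^2 \<Rightarrow> real)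
      \<Rightarrow> (nat \<Rightarrow> nat \<Rightarrow> real^2 \<Rightarrow> real) \<Rightarrow> nat \<Rightarrow> real^2 \<Rightarrow> real" where
  "schwarz_solve \<eta> p \<Omega> T P I \<Omega>s fs g i =
     local_solve \<eta> p \<Omega> T P (\<Omega>s i) (\<lambda>x. fs i x + gather T I \<Omega>s g i x)"

primrec schwarz_aux ::
    "real \<Rightarrow> real \<Rightarrow> (real^2) set \<Rightarrow> (real^2) list set \<Rightarrow> (real^2 \<Rightarrow> real) set
      \<Rightarrow> nat \<Rightarrow> (nat \<Rightarrow> (real^2) set) \<Rightarrow> (nat \<Rightarrow> real^2 \<Rightarrow> real)
      \<Rightarrow> (nat \<Rightarrow> nat \<Rightarrow> real^2 \<Rightarrow> real) \<Rightarrow> nat \<Rightarrow> (nat \<Rightarrow> nat \<Rightarrow> real^2 \<Rightarrow> real)" where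
  "schwarz_aux \<eta> p \<Omega> T P I \<Omega>s fs g0 0 = g0"
| "schwarz_aux \<eta> p \<Omega> T P I \<Omega>s fs g0 (Suc n) =
     (let g = schwarz_aux \<eta> p \<Omega> T P I \<Omega>s fs g0 n in
      (\<lambda>i' i x. - g i i' x
         + p * schwarz_solve \<eta> p \<Omega> T P I \<Omega>s fs g i x
             * (\<Sum>y\<in>shared_nbrs T (\<Omega>s i) (\<Omega>s i') x. dist x y)))"

text \<open>The coefficient vector of the iterate with number \<open>n + 1\<close>; there is no iterate with
  number \<open>0\<close>, since the method starts from auxiliary values.\<close>
definition schwarz_coeff ::
    "real \<Rightarrow> real \<Rightarrow> (real^2) set \<Rightarrow> (real^2) list set \<Rightarrow> (real^2 \<Rightarrow> real) set
      \<Rightarrow> nat \<Rightarrow> (nat \<Rightarrow> (real^2) set) \<Rightarrow> (nat \<Rightarrow> real^2 \<Rightarrow> real)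
      \<Rightarrow> (nat \<Rightarrow> nat \<Rightarrow> real^2 \<Rightarrow> real) \<Rightarrow> nat \<Rightarrow> nat \<Rightarrow> real^2 \<Rightarrow> real" where
  "schwarz_coeff \<eta> p \<Omega> T P I \<Omega>s fs g0 n i =
     schwarz_solve \<eta> p \<Omega> T P I \<Omega>s fs (schwarz_aux \<eta> p \<Omega> T P I \<Omega>s fs g0 n) i"

definition schwarz_iterate ::
    "real \<Rightarrow> real \<Rightarrow> (real^2) set \<Rightarrow> (real^2) list set \<Rightarrow> (real^2 \<Rightarrow> real) set
      \<Rightarrow> nat \<Rightarrow> (nat \<Rightarrow> (real^2) set) \<Rightarrow> (nat \<Rightarrow> real^2 \<Rightarrow> real)
      \<Rightarrow> (nat \<Rightarrow> nat \<Rightarrow> real^2 \<Rightarrow> real) \<Rightarrow> nat \<Rightarrow> nat \<Rightarrow> real^2 \<Rightarrow> real" where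
  "schwarz_iterate \<eta> p \<Omega> T P I \<Omega>s fs g0 n i z =
     (\<Sum>x\<in>local_nodes \<Omega> T (\<Omega>s i). schwarz_coeff \<eta> p \<Omega> T P I \<Omega>s fs g0 n i x * hat \<Omega> T P x z)"

end

theory Submission
  imports Defs
begin

text \<open>
  The local matrices are positive definite, and the lumped weight of a boundary edge of a subdomain
  at an interior node is shared with exactly one other subdomain. Hence, for the errors \<open>d\<close> of
  the auxiliary variables and \<open>w\<close> of the subdomain solutions, the energy \<open>\<Sum> d\<^sup>2 / s\<close>, with \<open>s\<close> the
  length of the shared edges at a node, drops in each step by \<open>2 p\<close> times the energy of \<open>w\<close>, and
  \<open>w\<close> tends to zero. The errors are taken relative to a fixed point whose subdomain solutions are
  the restrictions of the mono-domain solution \<open>u\<close>. At each node such a fixed point amounts to a flow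
  that balances the residuals of \<open>u\<close> on the graph of the subdomains sharing an edge there. The
  residuals sum to zero, and the graph is connected because a punctured disc is connected, so the
  flow exists also at cross-points.
\<close>

section \<open>Positive definite systems, flows and the decay of the Robin errors\<close>

text \<open>Only the subdomain solutions converge, not the auxiliary variables. An antisymmetric
  circulation in \<open>d\<close> around a cross-point has zero net sum in every subdomain, so it
  yields \<open>w = 0\<close> and is reproduced by the update; the fixed point is then not unique
  and \<open>d\<close> need not vanish. Lumping makes the energy argument possible: since
  \<open>B_lump\<close> is diagonal, the update and the energy identity involve only the copies of
  one node at a time. Two ingredients need long preparation. First, the residuals of
  \<open>u\<close> sum to zero only if the form on \<open>\<Omega>\<close> splits into the forms on
  the subdomains. As \<open>wgrad\<close> is an arbitrary choice, this needs uniqueness of weak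
  gradients, hence the fundamental lemma of the calculus of variations, hence test functions in the
  sense of \<open>Ck\<close>. Second, \<open>cell\<close> is the \<open>inside\<close> of a polygon,
  so that already the adherence of an edge to its cell rests on the Jordan curve theorem. The
  sharing of boundary edges is proved only at interior nodes: near such a node an edge runs inside
  \<open>\<Omega>\<close>, even if it ends on the boundary.\<close>

definition quad :: "'a set \<Rightarrow> ('a \<Rightarrow> 'a \<Rightarrow> real) \<Rightarrow> ('a \<Rightarrow> real) \<Rightarrow> real" where
  "quad N M w = (\<Sum>x\<in>N. w x * (\<Sum>y\<in>N. M x y * w y))"

definition pos_def_on :: "'a set \<Rightarrow> ('a \<Rightarrow> 'a \<Rightarrow> real) \<Rightarrow> bool" where
  "pos_def_on N M \<longleftrightarrow> (\<forall>w. (\<exists>x\<in>N. w x \<noteq> 0) \<longrightarrow> quad N M w > 0)"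

lemma quad_nonneg:
  assumes "pos_def_on N M"
  shows "quad N M w \<ge> 0"
proof (cases "\<exists>x\<in>N. w x \<noteq> 0")
  case True
  then show ?thesis using assms by (auto simp: pos_def_on_def intro: less_imp_le)
next
  case False
  then show ?thesis by (simp add: quad_def)
qed

lemma sum_kronecker:
  fixes g :: "'a \<Rightarrow> real"
  assumes "finite N" "x \<in> N"
  shows "(\<Sum>y\<in>N. (if y = x then 1 else 0) * g y) = g x"
    and "(\<Sum>y\<in>N. g y * (if y = x then 1 else 0)) = g x"
  using assms by (simp_all add: if_distrib if_distribR cong: if_cong)

text \<open>Gaussian elimination of one index \<open>a\<close>: the pivot is the form at a unit
  vector, hence positive, and the Schur complement \<open>M'\<close> is again positive definite
  because its form at \<open>w\<close> is that of \<open>M\<close> at an extension of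
  \<open>w\<close>.\<close>

lemma pos_def_on_solvable:
  assumes "finite N" "pos_def_on N M"
  shows "\<exists>w. \<forall>x\<in>N. (\<Sum>y\<in>N. M x y * w y) = r x"
  using assms
proof (induction N arbitrary: M r rule: finite_induct)
  case empty
  then show ?case by simp
next
  case (insert a N)
  have "quad (insert a N) M (\<lambda>x. if x = a then 1 else 0) > 0"
    using insert.prems unfolding pos_def_on_def by auto
  moreover have "quad (insert a N) M (\<lambda>x. if x = a then 1 else 0) = M a a"
    using insert.hyps by (simp only: quad_def sum_kronecker finite_insert insertI1)
  ultimately have pos: "M a a > 0" by simp
  define M' where "M' x y = M x y - M x a * M a y / M a a" for x y
  have sum': "(\<Sum>y\<in>N. M' x y * w y) = (\<Sum>y\<in>N. M x y * w y) - M x a / M a a * (\<Sum>y\<in>N. M a y * w y)" for x w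
    by (simp add: M'_def left_diff_distrib sum_subtractf sum_distrib_left mult.assoc)
  have "pos_def_on N M'"
    unfolding pos_def_on_def
  proof (intro allI impI)
    fix w :: "'a \<Rightarrow> real"
    assume nz: "\<exists>x\<in>N. w x \<noteq> 0"
    \<comment> \<open>The value at \<open>a\<close> for which row \<open>a\<close> of
      \<open>M\<close> vanishes on the extension; put into the other rows it produces exactly
      \<open>M'\<close>.\<close>
    define c where "c = - (\<Sum>y\<in>N. M a y * w y) / M a a"
    define v where "v = w(a := c)"
    have vN: "(\<Sum>y\<in>N. M x y * v y) = (\<Sum>y\<in>N. M x y * w y)" for x
      using insert.hyps by (intro sum.cong) (auto simp: v_def)
    have row: "(\<Sum>y\<in>insert a N. M x y * v y) = M x a * c + (\<Sum>y\<in>N. M x y * w y)" for x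
      using insert.hyps vN by (simp add: v_def)
    have rowa: "(\<Sum>y\<in>insert a N. M a y * v y) = 0"
      unfolding row using pos by (simp add: c_def)
    have "quad (insert a N) M v = (\<Sum>x\<in>N. v x * (\<Sum>y\<in>insert a N. M x y * v y))"
      unfolding quad_def using insert.hyps rowa by simp
    also have "\<dots> = quad N M' w"
      unfolding quad_def row sum' using insert.hyps
      by (intro sum.cong) (auto simp: v_def c_def)
    finally have eq: "quad (insert a N) M v = quad N M' w" .
    have "\<exists>x\<in>insert a N. v x \<noteq> 0" using nz insert.hyps by (auto simp: v_def)
    then show "quad N M' w > 0"
      using insert.prems eq unfolding pos_def_on_def by metis
  qed
  then obtain w where w: "\<And>x. x \<in> N \<Longrightarrow> (\<Sum>y\<in>N. M' x y * w y) = r x - M x a * r a / M a a"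
    using insert.IH[of M' "\<lambda>x. r x - M x a * r a / M a a"] by blast
  \<comment> \<open>Back substitution: row \<open>a\<close> solved for the eliminated
    unknown.\<close>
  define c where "c = (r a - (\<Sum>y\<in>N. M a y * w y)) / M a a"
  have "(\<Sum>y\<in>insert a N. M x y * (w(a := c)) y) = r x" if "x \<in> insert a N" for x
  proof -
    have "(\<Sum>y\<in>N. M x y * (w(a := c)) y) = (\<Sum>y\<in>N. M x y * w y)"
      using insert.hyps by (intro sum.cong) auto
    then have row: "(\<Sum>y\<in>insert a N. M x y * (w(a := c)) y) = M x a * c + (\<Sum>y\<in>N. M x y * w y)"
      using insert.hyps by simp
    show ?thesis
    proof (cases "x = a")
      case True
      then show ?thesis using pos unfolding row by (simp add: c_def)
    next
      case False
      then have "x \<in> N" using that by simp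
      from w[OF this] show ?thesis
        unfolding row unfolding sum' c_def using pos by (simp add: field_simps)
    qed
  qed
  then show ?case by blast
qed

lemma pos_def_on_unique:
  assumes "pos_def_on N M"
    and "\<forall>x\<in>N. (\<Sum>y\<in>N. M x y * v y) = r x" "\<forall>x\<in>N. (\<Sum>y\<in>N. M x y * w y) = r x"
    and "x \<in> N"
  shows "v x = w x"
proof (rule ccontr)
  assume "v x \<noteq> w x"
  then have "quad N M (\<lambda>x. v x - w x) > 0"
    using assms(1,4) unfolding pos_def_on_def by (metis eq_iff_diff_eq_0)
  moreover have "(\<Sum>y\<in>N. M x y * (v y - w y)) = 0" if "x \<in> N" for x
    using assms(2,3) that by (simp add: right_diff_distrib sum_subtractf)
  then have "quad N M (\<lambda>x. v x - w x) = 0" by (simp add: quad_def)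
  ultimately show False by simp
qed

text \<open>Cauchy-Schwarz for the inner product given by \<open>M\<close>: evaluation at
  \<open>x\<close> is represented by the column \<open>v\<close> of the inverse, so the square of
  \<open>w n x\<close> is at most \<open>v x\<close> times the energy of \<open>w n\<close>.\<close>

lemma quad_tendsto_0_imp:
  assumes fin: "finite N" and pd: "pos_def_on N M" and sym: "\<And>x y. x \<in> N \<Longrightarrow> y \<in> N \<Longrightarrow> M x y = M y x"
    and lim: "(\<lambda>n. quad N M (w n)) \<longlonglongrightarrow> 0" and x: "x \<in> N"
  shows "(\<lambda>n. w n x) \<longlonglongrightarrow> 0"
proof -
  obtain v where v: "\<And>z. z \<in> N \<Longrightarrow> (\<Sum>y\<in>N. M z y * v y) = (if z = x then 1 else 0)"
    using pos_def_on_solvable[OF fin pd, of "\<lambda>z. if z = x then 1 else 0"] by blast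
  have Mv: "(\<Sum>z\<in>N. g z * (\<Sum>y\<in>N. M z y * v y)) = g x" for g
  proof -
    have "(\<Sum>z\<in>N. g z * (\<Sum>y\<in>N. M z y * v y)) = (\<Sum>z\<in>N. g z * (if z = x then 1 else 0))"
      using v by (intro sum.cong) auto
    then show ?thesis using sum_kronecker[OF fin x] by simp
  qed
  have vM: "(\<Sum>z\<in>N. v z * (\<Sum>y\<in>N. M z y * g y)) = g x" for g
  proof -
    have "(\<Sum>z\<in>N. v z * (\<Sum>y\<in>N. M z y * g y)) = (\<Sum>y\<in>N. \<Sum>z\<in>N. v z * (M z y * g y))"
      unfolding sum_distrib_left by (rule sum.swap)
    also have "\<dots> = (\<Sum>y\<in>N. g y * (\<Sum>z\<in>N. M y z * v z))"
      unfolding sum_distrib_left using sym by (intro sum.cong refl) (simp add: mult_ac)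
    finally show ?thesis using Mv by simp
  qed
  define a where "a = quad N M v"
  have av: "a = v x" unfolding a_def quad_def by (rule Mv)
  have apos: "a > 0"
  proof -
    have "\<exists>y\<in>N. v y \<noteq> 0"
      by (rule ccontr) (use v[OF x] in simp)
    then show ?thesis using pd unfolding a_def pos_def_on_def by blast
  qed
  have bound: "(w n x)\<^sup>2 \<le> a * quad N M (w n)" for n
  proof -
    let ?w = "w n"
    have exp: "quad N M (\<lambda>z. ?w z + t * v z) = quad N M ?w + 2 * t * ?w x + t\<^sup>2 * a" for t
    proof -
      have "quad N M (\<lambda>z. ?w z + t * v z)
        = (\<Sum>z\<in>N. ?w z * (\<Sum>y\<in>N. M z y * ?w y)) + t * (\<Sum>z\<in>N. ?w z * (\<Sum>y\<in>N. M z y * v y))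
          + t * (\<Sum>z\<in>N. v z * (\<Sum>y\<in>N. M z y * ?w y)) + t\<^sup>2 * (\<Sum>z\<in>N. v z * (\<Sum>y\<in>N. M z y * v y))"
        unfolding quad_def
        by (simp add: distrib_left distrib_right sum.distrib sum_distrib_left power2_eq_square mult_ac)
      then show ?thesis unfolding vM Mv by (simp add: quad_def av)
    qed
    \<comment> \<open>The factor \<open>- w n x / a\<close> minimises the quadratic polynomial in
      \<open>t\<close> above; nonnegativity of this minimum is the bound.\<close>
    have "0 \<le> quad N M (\<lambda>z. ?w z + (- ?w x / a) * v z)" by (rule quad_nonneg[OF pd])
    then have "0 \<le> a * (quad N M ?w + 2 * (- ?w x / a) * ?w x + (- ?w x / a)\<^sup>2 * a)"
      unfolding exp using apos by (intro mult_nonneg_nonneg) auto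
    also have "\<dots> = a * quad N M ?w - (?w x)\<^sup>2"
      using apos by (simp add: field_simps power2_eq_square)
    finally show ?thesis by simp
  qed
  have "(\<lambda>n. a * quad N M (w n)) \<longlonglongrightarrow> 0"
    using tendsto_mult_left[OF lim, of a] by simp
  from tendsto_sandwich[OF _ _ tendsto_const this, of "\<lambda>n. (w n x)\<^sup>2"]
  have "(\<lambda>n. (w n x)\<^sup>2) \<longlonglongrightarrow> 0"
    using bound by simp
  then show ?thesis by simp
qed

section \<open>Flows with prescribed net supply on a finite graph\<close>

text \<open>A unit flow along a walk, built edge by edge. The entry \<open>h i j\<close> is what
  \<open>i\<close> receives from \<open>j\<close>, so for different ends the row sum is 1 at
  \<open>b\<close> and -1 at \<open>a\<close>.\<close>

lemma rtrancl_flow: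
  fixes E :: "('i \<times> 'i) set"
  assumes "(a, b) \<in> E\<^sup>*" "finite K" "E \<subseteq> K \<times> K" "sym E" "irrefl E"
  shows "\<exists>h::'i \<Rightarrow> 'i \<Rightarrow> real. (\<forall>i j. h j i = - h i j) \<and> (\<forall>i j. (i, j) \<notin> E \<longrightarrow> h i j = 0) \<and>
    (\<forall>i. (\<Sum>j\<in>K. h i j) = (if i = b then 1 else 0) - (if i = a then 1 else 0))"
  using assms(1)
proof (induction rule: rtrancl_induct)
  case base
  show ?case by (rule exI[of _ "\<lambda>_ _. 0"]) simp
next
  case (step b c)
  then obtain h :: "'i \<Rightarrow> 'i \<Rightarrow> real" where h: "\<And>i j. h j i = - h i j" "\<And>i j. (i, j) \<notin> E \<Longrightarrow> h i j = 0"
    "\<And>i. (\<Sum>j\<in>K. h i j) = (if i = b then 1 else 0) - (if i = a then 1 else 0)"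
    by blast
  have bc: "(b, c) \<in> E" "(c, b) \<in> E" "b \<noteq> c" "b \<in> K" "c \<in> K"
    using step(2) assms(3) symD[OF assms(4) step(2)] irreflD[OF assms(5), of b] by auto
  \<comment> \<open>One unit sent across the last edge, which moves the surplus from
    \<open>b\<close> to \<open>c\<close>. Both orientations carry a value, so symmetry of
    \<open>E\<close> keeps the support inside \<open>E\<close>.\<close>
  define k :: "'i \<Rightarrow> 'i \<Rightarrow> real" where "k i j = (if i = c then 1 else 0) * (if j = b then 1 else 0)
    - (if i = b then 1 else 0) * (if j = c then 1 else 0)" for i j
  have k: "(\<Sum>j\<in>K. k i j) = (if i = c then 1 else 0) - (if i = b then 1 else 0)" for i
    unfolding k_def sum_subtractf sum_kronecker(2)[OF assms(2) bc(4)] sum_kronecker(2)[OF assms(2) bc(5)] ..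
  define g where "g i j = h i j + k i j" for i j
  have "(\<forall>i j. g j i = - g i j) \<and> (\<forall>i j. (i, j) \<notin> E \<longrightarrow> g i j = 0) \<and>
    (\<forall>i. (\<Sum>j\<in>K. g i j) = (if i = c then 1 else 0) - (if i = a then 1 else 0))"
    unfolding g_def
  proof (intro conjI allI impI)
    show "h j i + k j i = - (h i j + k i j)" for i j
    proof -
      have "k j i = - k i j" by (simp add: k_def)
      then show ?thesis using h(1)[of i j] by linarith
    qed
    show "h i j + k i j = 0" if "(i, j) \<notin> E" for i j
      proof -
      have "k i j = 0" using that bc unfolding k_def by auto
      then show ?thesis using h(2)[OF that] by linarith
    qed
    show "(\<Sum>j\<in>K. h i j + k i j) = (if i = c then 1 else 0) - (if i = a then 1 else 0)" for i
      unfolding sum.distrib h(3) k by simp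
  qed
  then show ?case by blast
qed

text \<open>Superposition of unit flows from a fixed \<open>a\<close> to all \<open>b\<close>,
  weighted by \<open>r b\<close>; the total drawn from \<open>a\<close> is the sum of
  \<open>r\<close>, which vanishes.\<close>

lemma zero_sum_flow:
  fixes E :: "('i \<times> 'i) set" and r :: "'i \<Rightarrow> real"
  assumes fin: "finite K" and E: "E \<subseteq> K \<times> K" "sym E" "irrefl E"
    and V: "V \<subseteq> K" and conn: "\<And>i j. i \<in> V \<Longrightarrow> j \<in> V \<Longrightarrow> (i, j) \<in> E\<^sup>*"
    and r: "(\<Sum>i\<in>V. r i) = 0"
  shows "\<exists>h. (\<forall>i j. h j i = - h i j) \<and> (\<forall>i j. (i, j) \<notin> E \<longrightarrow> h i j = 0) \<and> (\<forall>i\<in>V. (\<Sum>j\<in>K. h i j) = r i)"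
proof (cases "V = {}")
  case True
  then show ?thesis by (intro exI[of _ "\<lambda>_ _. 0"]) simp
next
  case False
  then obtain a where a: "a \<in> V" by blast
  have finV: "finite V" using V fin finite_subset by blast
  define Q where "Q = (\<lambda>b (h::'i \<Rightarrow> 'i \<Rightarrow> real). (\<forall>i j. h j i = - h i j) \<and> (\<forall>i j. (i, j) \<notin> E \<longrightarrow> h i j = 0) \<and>
    (\<forall>i. (\<Sum>j\<in>K. h i j) = (if i = b then 1 else 0) - (if i = a then 1 else 0)))"
  have "\<forall>b\<in>V. \<exists>h. Q b h"
    unfolding Q_def using rtrancl_flow[OF conn[OF a] fin E] by blast
  then obtain H where H: "\<And>b. b \<in> V \<Longrightarrow> Q b (H b)" by (auto simp: bchoice_iff)
  have H2: "H b i j = 0" if "b \<in> V" "(i, j) \<notin> E" for b i j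
    using H[OF that(1)] that(2) unfolding Q_def by blast
  have H3: "(\<Sum>j\<in>K. H b i j) = (if i = b then 1 else 0) - (if i = a then 1 else 0)" if "b \<in> V" for b i
    using H[OF that] unfolding Q_def by blast
  define h where "h = (\<lambda>i j. \<Sum>b\<in>V. r b * H b i j)"
  have "h j i = - h i j" for i j
    unfolding h_def sum_negf[symmetric] mult_minus_right[symmetric]
  proof (intro sum.cong refl)
    fix b assume "b \<in> V"
    then show "r b * H b j i = r b * - H b i j" using H[of b] unfolding Q_def by metis
  qed
  moreover have "h i j = 0" if "(i, j) \<notin> E" for i j
    unfolding h_def using H2 that by (intro sum.neutral) auto
  moreover have "(\<Sum>j\<in>K. h i j) = r i" if i: "i \<in> V" for i
  proof -
    have "(\<Sum>j\<in>K. h i j) = (\<Sum>b\<in>V. r b * (\<Sum>j\<in>K. H b i j))"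
      unfolding h_def sum_distrib_left by (rule sum.swap)
    also have "\<dots> = (\<Sum>b\<in>V. r b * ((if i = b then 1 else 0) - (if i = a then 1 else 0)))"
      using H3 by (intro sum.cong) auto
    also have "\<dots> = (\<Sum>b\<in>V. r b * (if b = i then 1 else 0)) - (\<Sum>b\<in>V. r b) * (if i = a then 1 else 0)"
      by (simp add: right_diff_distrib sum_subtractf sum_distrib_right eq_commute[of i])
    also have "\<dots> = r i" unfolding sum_kronecker(2)[OF finV i] r by simp
    finally show ?thesis .
  qed
  ultimately show ?thesis by (intro exI[of _ h] conjI allI ballI impI)
qed

text \<open>Squaring the update and dividing by \<open>s\<close> gives
  \<open>d\<^sup>2 / s - 2 * p * w * (d - p / 2 * s * w)\<close>. Summed over the neighbours
  \<open>j\<close>, the bracket is row \<open>x\<close> of \<open>A i\<close> applied to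
  \<open>w\<close>, by the local system: the factor 1/2 in the lumped weight is the one that
  completes this square.\<close>

lemma robin_error_tendsto_0:
  fixes d :: "nat \<Rightarrow> 'i \<Rightarrow> 'i \<Rightarrow> 'a \<Rightarrow> real" and w :: "nat \<Rightarrow> 'i \<Rightarrow> 'a \<Rightarrow> real"
  assumes K: "finite K" and fin: "\<And>i. i \<in> K \<Longrightarrow> finite (N i)" and p: "p > 0"
    and pd: "\<And>i. i \<in> K \<Longrightarrow> pos_def_on (N i) (A i)"
    and symA: "\<And>i x y. i \<in> K \<Longrightarrow> x \<in> N i \<Longrightarrow> y \<in> N i \<Longrightarrow> A i x y = A i y x"
    and E: "\<And>x. E x \<subseteq> K \<times> K" "\<And>x. sym (E x)"
    and EN: "\<And>x i j. (i, j) \<in> E x \<Longrightarrow> x \<in> N i"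
    and s: "\<And>x i j. (i, j) \<in> E x \<Longrightarrow> s i j x > 0" "\<And>x i j. s i j x = s j i x"
    and solve: "\<And>n i x. i \<in> K \<Longrightarrow> x \<in> N i \<Longrightarrow>
       (\<Sum>y\<in>N i. A i x y * w n i y) + p / 2 * (\<Sum>j\<in>{j. (i, j) \<in> E x}. s i j x) * w n i x
         = (\<Sum>j\<in>{j. (i, j) \<in> E x}. d n i j x)"
    and step: "\<And>n i j x. (i, j) \<in> E x \<Longrightarrow> d (Suc n) j i x = - d n i j x + p * w n i x * s i j x"
    and i: "i \<in> K" and x: "x \<in> N i"
  shows "(\<lambda>n. w n i x) \<longlonglongrightarrow> 0"
proof -
  define V where "V = (\<Union>i\<in>K. N i)"
  have finV: "finite V" using K fin by (auto simp: V_def)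
  define en where "en n = (\<Sum>x\<in>V. \<Sum>(i,j)\<in>E x. (d n i j x)\<^sup>2 / s i j x)" for n
  define q where "q n i = quad (N i) (A i) (w n i)" for n i
  have sumE: "(\<Sum>(i,j)\<in>E x. g i j) = (\<Sum>i\<in>K. \<Sum>j\<in>{j. (i, j) \<in> E x}. g i j)" for x and g :: "'i \<Rightarrow> 'i \<Rightarrow> real"
  proof -
    have "E x = (SIGMA i:K. {j. (i, j) \<in> E x})" using E(1)[of x] by auto
    then have "(\<Sum>(i,j)\<in>E x. g i j) = (\<Sum>(i,j)\<in>(SIGMA i:K. {j. (i, j) \<in> E x}). g i j)" by simp
    also have "\<dots> = (\<Sum>i\<in>K. \<Sum>j\<in>{j. (i, j) \<in> E x}. g i j)"
      using K E(1) by (intro sum.Sigma[symmetric]) (auto intro: finite_subset[OF _ K])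
    finally show ?thesis .
  qed
  have swapE: "(\<Sum>(i,j)\<in>E x. g i j) = (\<Sum>(i,j)\<in>E x. g j i)" for x and g :: "'i \<Rightarrow> 'i \<Rightarrow> real"
    by (rule sum.reindex_bij_witness[of _ "\<lambda>(i,j). (j,i)" "\<lambda>(i,j). (j,i)"])
       (auto dest: symD[OF E(2)])
  have decr: "en (Suc n) = en n - 2 * p * (\<Sum>i\<in>K. q n i)" for n
  proof -
    have pt: "(\<Sum>(i,j)\<in>E x. (d (Suc n) i j x)\<^sup>2 / s i j x) = (\<Sum>(i,j)\<in>E x. (d n i j x)\<^sup>2 / s i j x)
      - 2 * p * (\<Sum>i\<in>K. w n i x * ((\<Sum>j\<in>{j. (i, j) \<in> E x}. d n i j x) - p / 2 * (\<Sum>j\<in>{j. (i, j) \<in> E x}. s i j x) * w n i x))" for x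
    proof -
      \<comment> \<open>The update computes the datum for \<open>(j, i)\<close> from the one for
        \<open>(i, j)\<close>, so the orientations are exchanged before the terms are
        compared.\<close>
      have "(\<Sum>(i,j)\<in>E x. (d (Suc n) i j x)\<^sup>2 / s i j x) = (\<Sum>(i,j)\<in>E x. (d (Suc n) j i x)\<^sup>2 / s i j x)"
        by (subst swapE) (simp add: s(2))
      also have "\<dots> = (\<Sum>(i,j)\<in>E x. (d n i j x)\<^sup>2 / s i j x - 2 * p * (w n i x * (d n i j x - p / 2 * s i j x * w n i x)))"
      proof (intro sum.cong refl, clarsimp)
        fix i j assume ij: "(i, j) \<in> E x"
        show "(d (Suc n) j i x)\<^sup>2 / s i j x = (d n i j x)\<^sup>2 / s i j x - 2 * p * (w n i x * (d n i j x - p * s i j x * w n i x / 2))"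
          unfolding step[OF ij] using s(1)[OF ij] by (simp add: field_simps power2_eq_square)
      qed
      also have "\<dots> = (\<Sum>(i,j)\<in>E x. (d n i j x)\<^sup>2 / s i j x) - 2 * p * (\<Sum>(i,j)\<in>E x. w n i x * (d n i j x - p / 2 * s i j x * w n i x))"
        by (simp add: case_prod_unfold sum_subtractf sum_distrib_left)
      also have "(\<Sum>(i,j)\<in>E x. w n i x * (d n i j x - p / 2 * s i j x * w n i x)) =
         (\<Sum>i\<in>K. w n i x * ((\<Sum>j\<in>{j. (i, j) \<in> E x}. d n i j x) - p / 2 * (\<Sum>j\<in>{j. (i, j) \<in> E x}. s i j x) * w n i x))"
        unfolding sumE by (simp add: sum_distrib_left sum_distrib_right sum_subtractf right_diff_distrib)
      finally show ?thesis .
    qed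
    have "en (Suc n) = en n - 2 * p * (\<Sum>x\<in>V. \<Sum>i\<in>K. w n i x * ((\<Sum>j\<in>{j. (i, j) \<in> E x}. d n i j x) - p / 2 * (\<Sum>j\<in>{j. (i, j) \<in> E x}. s i j x) * w n i x))"
      unfolding en_def pt by (simp add: sum_subtractf sum_distrib_left)
    also have "(\<Sum>x\<in>V. \<Sum>i\<in>K. w n i x * ((\<Sum>j\<in>{j. (i, j) \<in> E x}. d n i j x) - p / 2 * (\<Sum>j\<in>{j. (i, j) \<in> E x}. s i j x) * w n i x))
       = (\<Sum>i\<in>K. q n i)"
    proof (subst sum.swap, intro sum.cong refl)
      fix i assume i: "i \<in> K"
      have "(\<Sum>x\<in>V. w n i x * ((\<Sum>j\<in>{j. (i, j) \<in> E x}. d n i j x) - p / 2 * (\<Sum>j\<in>{j. (i, j) \<in> E x}. s i j x) * w n i x))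
        = (\<Sum>x\<in>N i. w n i x * ((\<Sum>j\<in>{j. (i, j) \<in> E x}. d n i j x) - p / 2 * (\<Sum>j\<in>{j. (i, j) \<in> E x}. s i j x) * w n i x))"
      proof (intro sum.mono_neutral_right finV ballI)
        show "N i \<subseteq> V" using i by (auto simp: V_def)
        \<comment> \<open>At a node foreign to \<open>i\<close> no pair \<open>(i, j)\<close> is
          coupled, and both inner sums are empty.\<close>
        fix x assume "x \<in> V - N i"
        then have "{j. (i, j) \<in> E x} = {}" using EN by auto
        then show "w n i x * ((\<Sum>j\<in>{j. (i, j) \<in> E x}. d n i j x) - p / 2 * (\<Sum>j\<in>{j. (i, j) \<in> E x}. s i j x) * w n i x) = 0"
          by (simp only: sum.empty) simp
      qed
      also have "\<dots> = q n i"
        unfolding q_def quad_def by (intro sum.cong refl) (simp flip: solve[OF i])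
      finally show "(\<Sum>x\<in>V. w n i x * ((\<Sum>j\<in>{j. (i, j) \<in> E x}. d n i j x) - p / 2 * (\<Sum>j\<in>{j. (i, j) \<in> E x}. s i j x) * w n i x)) = q n i" .
    qed
    finally show ?thesis .
  qed
  have qnn: "q n i \<ge> 0" if "i \<in> K" for n i unfolding q_def by (rule quad_nonneg[OF pd[OF that]])
  have ennn: "en n \<ge> 0" for n
    unfolding en_def by (intro sum_nonneg) (auto intro!: divide_nonneg_nonneg less_imp_le[OF s(1)])
  have "decseq en"
  proof (rule decseq_SucI)
    fix n
    have "0 \<le> 2 * p * (\<Sum>i\<in>K. q n i)"
      using p by (intro mult_nonneg_nonneg sum_nonneg qnn) auto
    then show "en (Suc n) \<le> en n" using decr[of n] by linarith
  qed
  then obtain L where L: "en \<longlonglongrightarrow> L"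
    using decseq_convergent[of en 0] ennn by metis
  \<comment> \<open>The energy converges, so its decrements tend to zero; by \<open>decr\<close>
    they are \<open>2 * p\<close> times the total energy of \<open>w\<close>.\<close>
  have "(\<lambda>n. (en n - en (Suc n)) / (2 * p)) \<longlonglongrightarrow> (L - L) / (2 * p)"
    by (intro tendsto_divide tendsto_diff L LIMSEQ_Suc[OF L] tendsto_const) (use p in simp)
  then have lim: "(\<lambda>n. \<Sum>i\<in>K. q n i) \<longlonglongrightarrow> 0" using p by (simp add: decr)
  have "(\<lambda>n. q n i) \<longlonglongrightarrow> 0"
  proof (rule tendsto_sandwich[OF _ _ tendsto_const lim])
    show "\<forall>\<^sub>F n in sequentially. q n i \<le> (\<Sum>i\<in>K. q n i)"
      using K i qnn by (intro always_eventually allI member_le_sum) auto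
  qed (use qnn i in auto)
  then have "(\<lambda>n. quad (N i) (A i) (w n i)) \<longlonglongrightarrow> 0" by (simp add: q_def)
  from quad_tendsto_0_imp[OF fin[OF i] pd[OF i] symA[OF i] this x]
  show ?thesis by blast
qed

section \<open>Smooth cut-off functions\<close>

text \<open>Smoothness is witnessed by the whole sequence of derivatives, which for
  \<open>exp_step\<close> has an explicit recursive form.\<close>

definition smooth_real :: "(real \<Rightarrow> real) \<Rightarrow> bool" where
  "smooth_real g \<longleftrightarrow> (\<exists>D. D 0 = g \<and> (\<forall>n t. (D n has_real_derivative D (Suc n) t) (at t)))"

lemma smooth_real_const: "smooth_real (\<lambda>t. c)"
  unfolding smooth_real_def
  by (rule exI[of _ "\<lambda>n t. if n = 0 then c else 0"]) auto

lemma smooth_real_deriv: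
  assumes "smooth_real g"
  obtains g' where "smooth_real g'" "\<And>t. (g has_real_derivative g' t) (at t)"
proof -
  obtain D where D: "D 0 = g" "\<And>n t. (D n has_real_derivative D (Suc n) t) (at t)"
    using assms by (auto simp: smooth_real_def)
  have "smooth_real (D 1)"
    unfolding smooth_real_def using D(2) by (intro exI[of _ "\<lambda>n. D (Suc n)"]) auto
  then show thesis using that D(2)[of 0] D(1) by auto
qed

text \<open>A class closed under partial derivatives, by the chain and product rules, so that
  \<open>Ck k\<close> follows for every \<open>k\<close> by induction. Sums and products of
  one-dimensional profiles suffice for the cut-offs.\<close>

inductive smooth_ridge :: "('a::euclidean_space \<Rightarrow> real) \<Rightarrow> bool" where
  ridge: "smooth_real g \<Longrightarrow> smooth_ridge (\<lambda>x. g (c \<bullet> x + d))"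
| add: "smooth_ridge f \<Longrightarrow> smooth_ridge g \<Longrightarrow> smooth_ridge (\<lambda>x. f x + g x)"
| mult: "smooth_ridge f \<Longrightarrow> smooth_ridge g \<Longrightarrow> smooth_ridge (\<lambda>x. f x * g x)"

lemma smooth_ridge_const: "smooth_ridge (\<lambda>x. c)"
  by (rule smooth_ridge.ridge[OF smooth_real_const])

lemma smooth_ridge_prod:
  "finite A \<Longrightarrow> (\<And>a. a \<in> A \<Longrightarrow> smooth_ridge (f a)) \<Longrightarrow> smooth_ridge (\<lambda>x. \<Prod>a\<in>A. f a x)"
  by (induction A rule: finite_induct) (auto intro: smooth_ridge_const smooth_ridge.mult)

lemma smooth_ridge_one_minus: "smooth_ridge f \<Longrightarrow> smooth_ridge (\<lambda>x. 1 - f x)"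
  using smooth_ridge.add[OF smooth_ridge_const[of 1] smooth_ridge.mult[OF smooth_ridge_const[of "-1"]], of f] by simp

lemma smooth_ridge_derivative:
  assumes "smooth_ridge f"
  shows "\<exists>f'. (\<forall>x. (f has_derivative f' x) (at x)) \<and> (\<forall>b. smooth_ridge (\<lambda>x. f' x b))"
  using assms
proof induction
  case (ridge g c d)
  obtain g' where g': "smooth_real g'" "\<And>t. (g has_real_derivative g' t) (at t)"
    using smooth_real_deriv[OF ridge] by metis
  have "((\<lambda>x. g (c \<bullet> x + d)) has_derivative (\<lambda>b. g' (c \<bullet> x + d) * (c \<bullet> b))) (at x)" for x
  proof -
    have "((\<lambda>x. c \<bullet> x + d) has_derivative (\<lambda>b. c \<bullet> b)) (at x)"
      by (auto intro!: derivative_eq_intros)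
    moreover have "(g has_derivative (*) (g' (c \<bullet> x + d))) (at (c \<bullet> x + d))"
      using g'(2)[of "c \<bullet> x + d"] by (simp add: has_field_derivative_def)
    ultimately show ?thesis using has_derivative_compose by blast
  qed
  moreover have "smooth_ridge (\<lambda>x. g' (c \<bullet> x + d) * (c \<bullet> b))" for b
    by (intro smooth_ridge.mult smooth_ridge.ridge g' smooth_ridge_const)
  ultimately show ?case by (intro exI[of _ "\<lambda>x b. g' (c \<bullet> x + d) * (c \<bullet> b)"]) auto
next
  case (add f g)
  then obtain f' g' where "\<And>x. (f has_derivative f' x) (at x)" "\<And>b. smooth_ridge (\<lambda>x. f' x b)"
    "\<And>x. (g has_derivative g' x) (at x)" "\<And>b. smooth_ridge (\<lambda>x. g' x b)" by blast
  then show ?case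
    by (intro exI[of _ "\<lambda>x b. f' x b + g' x b"])
       (auto intro: has_derivative_add smooth_ridge.add)
next
  case (mult f g)
  then obtain f' g' where fg: "\<And>x. (f has_derivative f' x) (at x)" "\<And>b. smooth_ridge (\<lambda>x. f' x b)"
    "\<And>x. (g has_derivative g' x) (at x)" "\<And>b. smooth_ridge (\<lambda>x. g' x b)" by blast
  have "((\<lambda>x. f x * g x) has_derivative (\<lambda>b. f x * g' x b + f' x b * g x)) (at x)" for x
    by (rule has_derivative_mult[OF fg(1,3)])
  moreover have "smooth_ridge (\<lambda>x. f x * g' x b + f' x b * g x)" for b
    using mult fg by (intro smooth_ridge.intros)
  ultimately show ?case
    by (intro exI[of _ "\<lambda>x b. f x * g' x b + f' x b * g x"]) auto
qed

lemma smooth_ridge_continuous: "smooth_ridge f \<Longrightarrow> continuous_on UNIV f"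
  using smooth_ridge_derivative by (metis continuous_at_imp_continuous_on has_derivative_continuous)

lemma smooth_ridge_Ck: "smooth_ridge f \<Longrightarrow> Ck k f"
proof (induction k arbitrary: f)
  case 0
  then show ?case by (simp add: smooth_ridge_continuous)
next
  case (Suc k)
  obtain f' where f': "\<And>x. (f has_derivative f' x) (at x)" "\<And>b. smooth_ridge (\<lambda>x. f' x b)"
    using smooth_ridge_derivative[OF Suc.prems] by blast
  have "frechet_derivative f (at x) = f' x" for x
    using frechet_derivative_at[OF f'(1)] by simp
  moreover have "f differentiable_on UNIV"
    using f'(1) by (auto simp: differentiable_on_def differentiable_def)
  ultimately show ?case using Suc.IH f'(2) by simp
qed

section \<open>The flat function exp(-1/t) and its derivatives\<close>

text \<open>With \<open>s = 1 / t\<close>, differentiation in \<open>t\<close> is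
  \<open>- s\<^sup>2\<close> times differentiation in \<open>s\<close>. It sends the polynomial
  \<open>q\<close> to \<open>s\<^sup>2 * (q - pderiv q)\<close>, so the family is closed under
  derivatives; \<open>q = 1\<close> is the classical flat function.\<close>

definition exp_step :: "real poly \<Rightarrow> real \<Rightarrow> real" where
  "exp_step q t = (if t \<le> 0 then 0 else poly q (1 / t) * exp (- 1 / t))"

lemma poly_times_exp_tendsto_0: "((\<lambda>x. poly q x * exp (- x)) \<longlongrightarrow> (0::real)) at_top"
proof -
  have "((\<lambda>x. coeff q i * (x ^ i / exp x)) \<longlongrightarrow> coeff q i * (0::real)) at_top" for i
    by (intro tendsto_intros tendsto_power_div_exp_0)
  then have "((\<lambda>x. \<Sum>i\<le>degree q. coeff q i * (x ^ i / exp x)) \<longlongrightarrow> (\<Sum>i\<le>degree q. 0)) at_top"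
    by (intro tendsto_sum) simp
  then show ?thesis by (simp add: poly_altdef sum_divide_distrib exp_minus inverse_eq_divide)
qed

lemma exp_step_derivative:
  "(exp_step q has_real_derivative exp_step ([:0, 0, 1:] * (q - pderiv q)) t) (at t)"
proof -
  consider "t < 0" | "t = 0" | "t > 0" by linarith
  then show ?thesis
  proof cases
    case 1
    have "((\<lambda>t. 0) has_real_derivative 0) (at t)" by simp
    then have "(exp_step q has_real_derivative 0) (at t)"
      by (rule has_field_derivative_transform_within_open[of _ _ _ "{..<0}"])
         (use 1 in \<open>auto simp: exp_step_def\<close>)
    then show ?thesis using 1 by (simp add: exp_step_def)
  next
    case 2
    have "((\<lambda>y. exp_step q y / y) \<longlongrightarrow> 0) (at_left 0)"
    proof (rule tendsto_eventually)
      have "\<forall>\<^sub>F x in at_left 0. x \<in> {- 1<..<(0::real)}"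
        by (rule eventually_at_left_real) simp
      then show "\<forall>\<^sub>F x in at_left 0. exp_step q x / x = 0"
        by eventually_elim (simp add: exp_step_def)
    qed
    \<comment> \<open>Under \<open>y = 1 / x\<close> the difference quotient at 0 becomes
      \<open>x\<close> times \<open>poly q x * exp (- x)\<close>; the extra factor \<open>x\<close>
      is absorbed in \<open>pCons 0 q\<close>.\<close>
    moreover have "((\<lambda>y. exp_step q y / y) \<longlongrightarrow> 0) (at_right 0)"
      unfolding filterlim_at_right_to_top
    proof (rule Lim_transform_eventually[OF poly_times_exp_tendsto_0[of "pCons 0 q"]])
      show "\<forall>\<^sub>F x in at_top. poly (pCons 0 q) x * exp (- x) = exp_step q (inverse x) / inverse x"
        using eventually_gt_at_top[of 0] by eventually_elim (simp add: exp_step_def field_simps)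
    qed
    ultimately have "((\<lambda>y. exp_step q y / y) \<longlongrightarrow> 0) (at 0)"
      by (simp add: filterlim_at_split)
    then show ?thesis using 2 by (simp add: has_field_derivative_iff exp_step_def)
  next
    case 3
    have "((\<lambda>t. poly q (1 / t) * exp (- 1 / t)) has_real_derivative
        exp_step ([:0, 0, 1:] * (q - pderiv q)) t) (at t)"
      using 3 by (auto intro!: derivative_eq_intros simp: exp_step_def field_simps power2_eq_square)
    then show ?thesis
      by (rule has_field_derivative_transform_within_open[of _ _ _ "{0<..}"])
         (use 3 in \<open>auto simp: exp_step_def\<close>)
  qed
qed

lemma smooth_exp_step: "smooth_real (exp_step q)"
  unfolding smooth_real_def
  by (rule exI[of _ "\<lambda>n. exp_step (((\<lambda>q. [:0, 0, 1:] * (q - pderiv q)) ^^ n) q)"])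
     (simp add: exp_step_derivative del: mult_pCons_left)

lemma exp_step_bounds: "0 \<le> exp_step 1 t" "exp_step 1 t \<le> 1"
  by (auto simp: exp_step_def)

lemma exp_step_eq_0: "t \<le> 0 \<Longrightarrow> exp_step q t = 0"
  by (simp add: exp_step_def)

lemma exp_step_scaled_tendsto:
  assumes "s > 0"
  shows "(\<lambda>n. exp_step 1 (real n * s - 1)) \<longlonglongrightarrow> 1"
proof -
  have ev: "filterlim (\<lambda>n. real n * s - 1) at_top sequentially"
    unfolding filterlim_at_top
  proof
    fix Z :: real
    show "\<forall>\<^sub>F n in sequentially. Z \<le> real n * s - 1"
      using eventually_ge_at_top[of "nat \<lceil>(Z + 1) / s\<rceil>"]
    proof eventually_elim
      case (elim n)
      then have "(Z + 1) / s \<le> real n" by linarith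
      then show ?case using assms by (simp add: field_simps)
    qed
  qed
  have "(\<lambda>n. exp (- inverse (real n * s - 1))) \<longlonglongrightarrow> exp (- 0)"
    by (intro tendsto_exp tendsto_minus tendsto_inverse_0_at_top ev)
  then have "(\<lambda>n. exp (- inverse (real n * s - 1))) \<longlonglongrightarrow> 1" by simp
  then show ?thesis
  proof (rule Lim_transform_eventually)
    show "\<forall>\<^sub>F n in sequentially. exp (- inverse (real n * s - 1)) = exp_step 1 (real n * s - 1)"
      using filterlim_at_top_dense[THEN iffD1, OF ev, rule_format, of 0]
      by eventually_elim (simp add: exp_step_def inverse_eq_divide)
  qed
qed

text \<open>The shift by -1 makes each factor vanish up to distance \<open>1 / n\<close> from its
  face, which keeps the support compact inside the open box. At a point of the box the arguments
  tend to infinity with \<open>n\<close>, so the bump tends to 1.\<close>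

definition box_bump :: "'a::euclidean_space \<Rightarrow> 'a \<Rightarrow> nat \<Rightarrow> 'a \<Rightarrow> real" where
  "box_bump a b n x = (\<Prod>i\<in>Basis. exp_step 1 (real n * (x \<bullet> i - a \<bullet> i) - 1) * exp_step 1 (real n * (b \<bullet> i - x \<bullet> i) - 1))"

lemma smooth_box_bump: "smooth_ridge (box_bump a b n)"
proof -
  have "smooth_ridge (\<lambda>x. exp_step 1 (real n * (x \<bullet> i - a \<bullet> i) - 1))" for i
    using smooth_ridge.ridge[OF smooth_exp_step, of 1 "real n *\<^sub>R i" "- real n * (a \<bullet> i) - 1"]
    by (simp add: algebra_simps inner_commute)
  moreover have "smooth_ridge (\<lambda>x. exp_step 1 (real n * (b \<bullet> i - x \<bullet> i) - 1))" for i
    using smooth_ridge.ridge[OF smooth_exp_step, of 1 "- real n *\<^sub>R i" "real n * (b \<bullet> i) - 1"]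
    by (simp add: algebra_simps inner_commute)
  ultimately show ?thesis
    unfolding box_bump_def[abs_def] by (intro smooth_ridge_prod smooth_ridge.mult) auto
qed

lemma box_bump_bounds: "0 \<le> box_bump a b n x" "box_bump a b n x \<le> 1"
  unfolding box_bump_def
  by (auto intro!: prod_nonneg prod_le_1 mult_nonneg_nonneg mult_le_one exp_step_bounds)

lemma box_bump_support:
  obtains K where "compact K" "K \<subseteq> box a b" "\<And>x. x \<notin> K \<Longrightarrow> box_bump a b n x = 0"
proof
  \<comment> \<open>For \<open>n = 0\<close> the quotient \<open>1 / real n\<close> is 0 and the
    first factor would be the full closed box; the second factor makes \<open>?K\<close> empty, in
    accordance with \<open>box_bump a b 0\<close> being zero.\<close>
  let ?K = "cbox (a + (1 / real n) *\<^sub>R One) (b - (1 / real n) *\<^sub>R One) \<inter> {x. n \<noteq> 0}"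
  show "compact ?K" by (cases "n = 0") auto
  show "?K \<subseteq> box a b"
    by (auto simp: mem_box inner_simps) (smt (verit, best) divide_pos_pos of_nat_0_less_iff)+
  fix x assume x: "x \<notin> ?K"
  have "\<exists>i\<in>Basis. real n * (x \<bullet> i - a \<bullet> i) - 1 \<le> 0 \<or> real n * (b \<bullet> i - x \<bullet> i) - 1 \<le> 0"
  proof (cases "n = 0")
    case True
    then show ?thesis by (intro bexI[OF _ SOME_Basis]) simp
  next
    case False
    then obtain i where "i \<in> Basis" "\<not> (a \<bullet> i + 1 / real n \<le> x \<bullet> i \<and> x \<bullet> i \<le> b \<bullet> i - 1 / real n)"
      using x by (auto simp: mem_box inner_simps)
    then show ?thesis using False by (intro bexI[of _ i]) (auto simp: field_simps)
  qed
  then obtain i where i: "i \<in> Basis" "real n * (x \<bullet> i - a \<bullet> i) - 1 \<le> 0 \<or> real n * (b \<bullet> i - x \<bullet> i) - 1 \<le> 0" ..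
  then have "exp_step 1 (real n * (x \<bullet> i - a \<bullet> i) - 1) * exp_step 1 (real n * (b \<bullet> i - x \<bullet> i) - 1) = 0"
    using exp_step_eq_0 by (metis mult_zero_left mult_zero_right)
  then show "box_bump a b n x = 0"
    unfolding box_bump_def using i(1) by (intro prod_zero) auto
qed

lemma box_bump_tendsto:
  assumes "x \<in> box a b" shows "(\<lambda>n. box_bump a b n x) \<longlonglongrightarrow> 1"
proof -
  have "(\<lambda>n. box_bump a b n x) \<longlonglongrightarrow> (\<Prod>i\<in>(Basis::'a set). 1 * 1)"
    unfolding box_bump_def using assms
    by (intro tendsto_prod tendsto_mult exp_step_scaled_tendsto) (auto simp: mem_box)
  then show ?thesis by simp
qed

lemma test_function_subset: "test_function S \<psi> \<Longrightarrow> S \<subseteq> S' \<Longrightarrow> test_function S' \<psi>"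
  unfolding test_function_def by blast

text \<open>An open set is a countable union of boxes, and one minus the product of the complements
  of bumps is a smooth version of their union: it stays in the unit interval, dominates each bump
  that it involves, and at stage \<open>n\<close> involves only \<open>n\<close> boxes, so the
  support is compact.\<close>

lemma indicator_approx_test_functions:
  assumes "open V"
  obtains F where "\<And>n. test_function V (F n)" "\<And>n x. \<bar>F n x\<bar> \<le> 1"
    "\<And>x. (\<lambda>n. F n x) \<longlonglongrightarrow> indicator V x"
proof -
  obtain \<D> where D: "countable \<D>" "\<D> \<subseteq> Pow V" "\<And>X. X \<in> \<D> \<Longrightarrow> \<exists>a b. X = box a b" "\<Union>\<D> = V"
    by (rule open_countable_Union_open_box[OF assms]) blast
  define \<D>' where "\<D>' = insert {} \<D>"
  have D': "countable \<D>'" "\<D>' \<noteq> {}" "\<And>X. X \<in> \<D>' \<Longrightarrow> \<exists>a b. X = box a b" "\<Union>\<D>' = V"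
  proof -
    have "box 0 0 = ({} :: (real^2) set)" using box_eq_empty(1)[of "0 :: real^2" 0] SOME_Basis by auto
    then show "\<exists>a b. X = box a b" if "X \<in> \<D>'" for X
      using that D(3) unfolding \<D>'_def by (metis insertE)
  qed (use D in \<open>auto simp: \<D>'_def\<close>)
  define B where "B = from_nat_into \<D>'"
  have rB: "range B = \<D>'" using D'(1,2) by (simp add: B_def)
  then have "\<forall>k. \<exists>a b. B k = box a b" using D'(3) by blast
  then obtain a b where ab: "\<And>k. B k = box (a k) (b k)" by metis
  define F where "F n x = 1 - (\<Prod>k<n. 1 - box_bump (a k) (b k) n x)" for n x
  have P: "0 \<le> (\<Prod>k<n. 1 - box_bump (a k) (b k) n x)" "(\<Prod>k<n. 1 - box_bump (a k) (b k) n x) \<le> 1" for n x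
    using box_bump_bounds by (auto intro!: prod_nonneg prod_le_1 simp: diff_le_eq)
  show thesis
  proof
    fix n
    have "smooth_ridge (F n)"
      unfolding F_def[abs_def] by (intro smooth_ridge_one_minus smooth_ridge_prod smooth_box_bump) auto
    then have "Ck k (F n)" for k by (rule smooth_ridge_Ck)
    moreover have "\<forall>k. \<exists>K. compact K \<and> K \<subseteq> B k \<and> (\<forall>x. x \<notin> K \<longrightarrow> box_bump (a k) (b k) n x = 0)"
      unfolding ab using box_bump_support by metis
    then obtain K where K: "\<And>k. compact (K k)" "\<And>k. K k \<subseteq> B k" "\<And>k x. x \<notin> K k \<Longrightarrow> box_bump (a k) (b k) n x = 0"
      by metis
    have comp: "compact (\<Union>k<n. K k)" using K(1) by (intro compact_UN) auto
    have "{x. F n x \<noteq> 0} \<subseteq> (\<Union>k<n. K k)"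
    proof (rule subsetI, rule ccontr)
      fix x assume x: "x \<in> {x. F n x \<noteq> 0}" "x \<notin> (\<Union>k<n. K k)"
      then have "(\<Prod>k<n. 1 - box_bump (a k) (b k) n x) = (\<Prod>k<n. 1)"
        using K(3) by (intro prod.cong) auto
      then show False using x(1) by (simp add: F_def)
    qed
    then have sub: "closure {x. F n x \<noteq> 0} \<subseteq> (\<Union>k<n. K k)"
      using comp by (intro closure_minimal compact_imp_closed)
    moreover have "(\<Union>k<n. K k) \<subseteq> V" using K(2) rB D'(4) by blast
    moreover have "compact (closure {x. F n x \<noteq> 0})"
      using compact_Int_closed[OF comp closed_closure, of "{x. F n x \<noteq> 0}"] sub by (simp add: Int_absorb1)
    ultimately show "test_function V (F n)" unfolding test_function_def by blast
  next
    show "\<bar>F n x\<bar> \<le> 1" for n x using P[where n=n and x=x] by (simp add: F_def)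
  next
    fix x
    show "(\<lambda>n. F n x) \<longlonglongrightarrow> indicator V x"
    proof (cases "x \<in> V")
      case False
      then have "x \<notin> B k" for k using rB D'(4) by blast
      then have "box_bump (a k) (b k) n x = 0" for k n
        using box_bump_support[of "a k" "b k" n] unfolding ab by blast
      then show ?thesis using False by (simp add: F_def)
    next
      case True
      then obtain k where k: "x \<in> B k" using rB D'(4) by blast
      have lim: "(\<lambda>n. box_bump (a k) (b k) n x) \<longlonglongrightarrow> 1"
        using box_bump_tendsto k unfolding ab by blast
      have le: "box_bump (a k) (b k) n x \<le> F n x" if "k < n" for n
      proof -
        have "(\<Prod>k<n. 1 - box_bump (a k) (b k) n x) =
           (1 - box_bump (a k) (b k) n x) * (\<Prod>j\<in>{..<n} - {k}. 1 - box_bump (a j) (b j) n x)"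
          using that by (intro prod.remove) auto
        also have "\<dots> \<le> (1 - box_bump (a k) (b k) n x) * 1"
          using box_bump_bounds by (intro mult_left_mono prod_le_1) (auto simp: diff_le_eq)
        finally show ?thesis by (simp add: F_def)
      qed
      have "\<forall>\<^sub>F n in sequentially. box_bump (a k) (b k) n x \<le> F n x"
        using eventually_gt_at_top[of k] by eventually_elim (rule le)
      moreover have "\<forall>\<^sub>F n in sequentially. F n x \<le> 1"
        using P by (auto simp: F_def)
      ultimately have "(\<lambda>n. F n x) \<longlonglongrightarrow> 1"
        by (intro tendsto_sandwich[OF _ _ lim tendsto_const])
      then show ?thesis using True by simp
    qed
  qed
qed

section \<open>Weak gradients\<close>

lemma integral_lebesgue_on:
  fixes f :: "real^2 \<Rightarrow> 'b::euclidean_space"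
  assumes "S \<in> sets lebesgue"
  shows "(\<integral>x. f x \<partial>lebesgue_on S) = (\<integral>x. indicator S x *\<^sub>R f x \<partial>lebesgue)"
  using assms by (simp add: integral_restrict_space)

lemma integrable_lebesgue_on:
  fixes f :: "real^2 \<Rightarrow> 'b::euclidean_space"
  assumes "S \<in> sets lebesgue"
  shows "integrable (lebesgue_on S) f \<longleftrightarrow> integrable lebesgue (\<lambda>x. indicator S x *\<^sub>R f x)"
  using assms by (simp add: integrable_restrict_space)

lemma integrable_lebesgue_on_subset:
  fixes f :: "real^2 \<Rightarrow> real"
  assumes "integrable (lebesgue_on S) f" "S' \<subseteq> S" "S \<in> sets lebesgue" "S' \<in> sets lebesgue"
  shows "integrable (lebesgue_on S') f"
proof -
  have "integrable lebesgue (\<lambda>x. indicator S' x *\<^sub>R (indicator S x *\<^sub>R f x))"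
    by (rule integrable_mult_indicator[OF assms(4)]) (use assms in \<open>simp only: integrable_lebesgue_on\<close>)
  also have "(\<lambda>x. indicator S' x *\<^sub>R (indicator S x *\<^sub>R f x)) = (\<lambda>x. indicator S' x *\<^sub>R f x)"
    using assms(2) by (auto simp: fun_eq_iff indicator_def)
  finally show ?thesis by (simp only: integrable_lebesgue_on[OF assms(4)])
qed

text \<open>Dominated convergence carries the identity from test functions to indicators of open
  sets, and complements carry it to closed sets. A closed set on which \<open>h\<close> is positive
  and has zero integral is null; up to a null set, the set where \<open>h\<close> is positive is a
  countable union of such sets.\<close>

lemma positive_part_null:
  fixes h :: "real^2 \<Rightarrow> real"
  assumes S: "open S" and h: "integrable (lebesgue_on S) h"
    and test: "\<And>\<psi>. test_function S \<psi> \<Longrightarrow> (\<integral>x. h x * \<psi> x \<partial>lebesgue_on S) = 0"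
  shows "{x\<in>S. h x > 0} \<in> null_sets lebesgue"
proof -
  have Sm: "S \<in> sets lebesgue" using S by simp
  have hm: "h \<in> borel_measurable (lebesgue_on S)" using h by auto
  have open0: "(\<integral>x. h x * indicator V x \<partial>lebesgue_on S) = 0" if V: "open V" "V \<subseteq> S" for V
  proof -
    obtain F where F: "\<And>n. test_function V (F n)" "\<And>n x. \<bar>F n x\<bar> \<le> (1::real)"
      "\<And>x. (\<lambda>n. F n x) \<longlonglongrightarrow> indicator V x"
      using indicator_approx_test_functions[OF V(1)] by metis
    have "(\<lambda>n. \<integral>x. h x * F n x \<partial>lebesgue_on S) \<longlonglongrightarrow> (\<integral>x. h x * indicator V x \<partial>lebesgue_on S)"
    proof (rule integral_dominated_convergence[where w = "\<lambda>x. \<bar>h x\<bar>"])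
      show "(\<lambda>x. h x * indicator V x) \<in> borel_measurable (lebesgue_on S)"
      proof (intro borel_measurable_times hm borel_measurable_indicator)
        show "V \<in> sets (lebesgue_on S)" using V Sm by (simp add: sets_restrict_space_iff)
      qed
      show "(\<lambda>x. h x * F n x) \<in> borel_measurable (lebesgue_on S)" for n
      proof (intro borel_measurable_times hm)
        have "Ck 0 (F n)" using F(1) unfolding test_function_def by blast
        then have "continuous_on S (F n)" by (auto intro: continuous_on_subset)
        then show "F n \<in> borel_measurable (lebesgue_on S)"
          by (rule continuous_imp_measurable_on_sets_lebesgue[OF _ Sm])
      qed
      show "integrable (lebesgue_on S) (\<lambda>x. \<bar>h x\<bar>)" using h by simp
      show "AE x in lebesgue_on S. (\<lambda>n. h x * F n x) \<longlonglongrightarrow> h x * indicator V x"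
        by (intro AE_I2 tendsto_mult_left F(3))
      show "AE x in lebesgue_on S. norm (h x * F n x) \<le> \<bar>h x\<bar>" for n
        using F(2) by (intro AE_I2) (simp add: abs_mult mult_left_le)
    qed
    moreover have "(\<integral>x. h x * F n x \<partial>lebesgue_on S) = 0" for n
      by (rule test[OF test_function_subset[OF F(1) V(2)]])
    ultimately show ?thesis by (simp add: LIMSEQ_const_iff)
  qed
  have closed_null: "C \<in> null_sets lebesgue" if C: "closed C" "C \<subseteq> {x\<in>S. h x > 0}" for C
  proof -
    have Cm: "C \<in> sets (lebesgue_on S)" using C Sm by (auto simp: sets_restrict_space_iff)
    have ind: "integrable (lebesgue_on S) (\<lambda>x. h x * indicator C x)"
      using integrable_mult_indicator[OF Cm h] by (simp add: mult.commute)
    have "(\<integral>x. h x * indicator C x \<partial>lebesgue_on S) =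
        (\<integral>x. h x * indicator S x - h x * indicator (S - C) x \<partial>lebesgue_on S)"
      using C by (intro Bochner_Integration.integral_cong) (auto simp: indicator_def)
    also have "\<dots> = (\<integral>x. h x * indicator S x \<partial>lebesgue_on S) - (\<integral>x. h x * indicator (S - C) x \<partial>lebesgue_on S)"
    proof (rule Bochner_Integration.integral_diff)
      have "S \<in> sets (lebesgue_on S)" "S - C \<in> sets (lebesgue_on S)"
        using Cm Sm by (auto simp: sets_restrict_space_iff)
      then show "integrable (lebesgue_on S) (\<lambda>x. h x * indicator S x)"
        "integrable (lebesgue_on S) (\<lambda>x. h x * indicator (S - C) x)"
        using integrable_mult_indicator[OF _ h] by (simp_all add: mult.commute)
    qed
    also have "\<dots> = 0" using open0[of S] open0[of "S - C"] S C(1) by (simp add: open_Diff)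
    finally have "(\<integral>x. h x * indicator C x \<partial>lebesgue_on S) = 0" .
    then have "AE x in lebesgue_on S. h x * indicator C x = 0"
      using C by (subst (asm) integral_nonneg_eq_0_iff_AE[OF ind]) (auto simp: indicator_def intro!: AE_I2)
    then have "AE x in lebesgue. x \<in> S \<longrightarrow> h x * indicator C x = 0"
      using Sm by (simp add: AE_restrict_space_iff)
    then have "AE x in lebesgue. x \<notin> C"
      by (rule AE_mp) (use C in \<open>auto intro!: AE_I2\<close>)
    then show ?thesis
      using AE_iff_null[of lebesgue "\<lambda>x. x \<notin> C"] C(1) by simp
  qed
  have "{x\<in>S. h x > 0} = h -` {0<..} \<inter> space (lebesgue_on S)" by auto
  also have "\<dots> \<in> sets (lebesgue_on S)" by (intro measurable_sets[OF hm]) auto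
  finally have "{x\<in>S. h x > 0} \<in> sets lebesgue" using Sm by (simp add: sets_restrict_space_iff)
  then obtain C N where CN: "fsigma C" "N \<in> null_sets lebesgue" "C \<union> N = {x\<in>S. h x > 0}"
    by (rule lebesgue_set_almost_fsigma)
  from CN(1) obtain F :: "nat \<Rightarrow> (real^2) set" where F: "\<And>n. closed (F n)" "C = (\<Union>n. F n)"
    by (cases rule: fsigma.cases) blast
  have "C \<in> null_sets lebesgue"
    unfolding F(2) using F CN(3) by (intro null_sets_UN closed_null) auto
  then show ?thesis using CN by (metis null_sets.Un)
qed

text \<open>The fundamental lemma of the calculus of variations: a weak gradient is known only
  through testing, and this turns it into a function determined almost everywhere.\<close>

lemma fundamental_lemma:
  fixes h :: "real^2 \<Rightarrow> real"
  assumes S: "open S" and h: "integrable (lebesgue_on S) h"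
    and test: "\<And>\<psi>. test_function S \<psi> \<Longrightarrow> (\<integral>x. h x * \<psi> x \<partial>lebesgue_on S) = 0"
  shows "AE x in lebesgue_on S. h x = 0"
proof -
  have "{x\<in>S. - h x > 0} \<in> null_sets lebesgue"
    by (rule positive_part_null[OF S]) (use h test in auto)
  moreover have "{x\<in>S. h x > 0} \<in> null_sets lebesgue"
    by (rule positive_part_null[OF S h test])
  ultimately have "{x\<in>S. - h x > 0} \<union> {x\<in>S. h x > 0} \<in> null_sets lebesgue" by (rule null_sets.Un)
  then have "AE x in lebesgue. x \<notin> {x\<in>S. - h x > 0} \<union> {x\<in>S. h x > 0}" by (rule AE_not_in)
  then have "AE x in lebesgue. x \<in> S \<longrightarrow> h x = 0" by (rule AE_mp) (auto intro!: AE_I2)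
  then show ?thesis using S by (simp add: AE_restrict_space_iff)
qed

section \<open>Square integrable functions and test functions\<close>

lemma square_integrable_measurable: "square_integrable S f \<Longrightarrow> f \<in> borel_measurable (lebesgue_on S)"
  by (simp add: square_integrable_def)

lemma integrable_inner_square_integrable:
  assumes "square_integrable S f" "square_integrable S g"
  shows "integrable (lebesgue_on S) (\<lambda>x. f x \<bullet> g x)"
proof (rule Bochner_Integration.integrable_bound)
  show "integrable (lebesgue_on S) (\<lambda>x. (norm (f x))\<^sup>2 + (norm (g x))\<^sup>2)"
    using assms by (simp add: square_integrable_def)
  show "(\<lambda>x. f x \<bullet> g x) \<in> borel_measurable (lebesgue_on S)"
    using assms by (intro borel_measurable_inner) (auto simp: square_integrable_def)
  show "AE x in lebesgue_on S. norm (f x \<bullet> g x) \<le> norm ((norm (f x))\<^sup>2 + (norm (g x))\<^sup>2)"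
  proof (intro AE_I2)
    fix x
    have "norm (f x \<bullet> g x) \<le> norm (f x) * norm (g x)" by (simp add: Cauchy_Schwarz_ineq2)
    also have "\<dots> \<le> (norm (f x))\<^sup>2 + (norm (g x))\<^sup>2"
      using sum_squares_bound[of "norm (f x)" "norm (g x)"] mult_nonneg_nonneg[of "norm (f x)" "norm (g x)"]
        norm_ge_zero[of "f x"] norm_ge_zero[of "g x"] by linarith
    finally show "norm (f x \<bullet> g x) \<le> norm ((norm (f x))\<^sup>2 + (norm (g x))\<^sup>2)" by simp
  qed
qed

lemma integrable_mult_square_integrable:
  fixes f g :: "real^2 \<Rightarrow> real"
  assumes "square_integrable S f" "square_integrable S g"
  shows "integrable (lebesgue_on S) (\<lambda>x. f x * g x)"
  using integrable_inner_square_integrable[OF assms] by (simp add: inner_real_def)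

lemma square_integrable_lincomb:
  assumes f: "square_integrable S f" and g: "square_integrable S g"
  shows "square_integrable S (\<lambda>x. a *\<^sub>R f x + g x)"
  unfolding square_integrable_def
proof
  show "(\<lambda>x. a *\<^sub>R f x + g x) \<in> borel_measurable (lebesgue_on S)"
    using f g by (intro borel_measurable_add borel_measurable_scaleR) (auto simp: square_integrable_def)
  have "(norm (a *\<^sub>R f x + g x))\<^sup>2 = a\<^sup>2 * (norm (f x))\<^sup>2 + 2 * a * (f x \<bullet> g x) + (norm (g x))\<^sup>2" for x
    unfolding power2_norm_eq_inner
    by (simp add: inner_add_left inner_add_right inner_commute power2_eq_square algebra_simps)
  moreover have "integrable (lebesgue_on S) (\<lambda>x. a\<^sup>2 * (norm (f x))\<^sup>2 + 2 * a * (f x \<bullet> g x) + (norm (g x))\<^sup>2)"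
    using f g integrable_inner_square_integrable[OF f g]
    by (intro Bochner_Integration.integrable_add Bochner_Integration.integrable_mult_right) (auto simp: square_integrable_def)
  ultimately show "integrable (lebesgue_on S) (\<lambda>x. (norm (a *\<^sub>R f x + g x))\<^sup>2)" by simp
qed

lemma square_integrable_zero: "square_integrable S (\<lambda>x. 0)"
  by (simp add: square_integrable_def)

lemma square_integrable_component:
  fixes G :: "real^2 \<Rightarrow> 'b::euclidean_space"
  assumes "square_integrable S G" "b \<in> Basis"
  shows "square_integrable S (\<lambda>x. G x \<bullet> b)"
  unfolding square_integrable_def
proof
  show m: "(\<lambda>x. G x \<bullet> b) \<in> borel_measurable (lebesgue_on S)"
    using assms by (intro borel_measurable_inner) (auto simp: square_integrable_def)
  show "integrable (lebesgue_on S) (\<lambda>x. (norm (G x \<bullet> b))\<^sup>2)"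
  proof (rule Bochner_Integration.integrable_bound)
    show "integrable (lebesgue_on S) (\<lambda>x. (norm (G x))\<^sup>2)"
      using assms by (simp add: square_integrable_def)
    show "AE x in lebesgue_on S. norm ((norm (G x \<bullet> b))\<^sup>2) \<le> norm ((norm (G x))\<^sup>2)"
      using Basis_le_norm[OF assms(2)] by (intro AE_I2) (simp add: abs_le_square_iff[symmetric])
  qed (use m in simp)
qed

lemma square_integrable_continuous:
  fixes f :: "real^2 \<Rightarrow> real"
  assumes "open S" "bounded S" "continuous_on UNIV f"
  shows "square_integrable S f"
  unfolding square_integrable_def
proof
  have Sm: "S \<in> lmeasurable" using assms by (simp add: lmeasurable_open)
  then have Ss: "S \<in> sets lebesgue" by blast
  show m: "f \<in> borel_measurable (lebesgue_on S)"
    using continuous_on_subset[OF assms(3)] by (intro continuous_imp_measurable_on_sets_lebesgue Ss) auto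
  have "compact (f ` closure S)"
    using assms by (intro compact_continuous_image) (auto intro: continuous_on_subset)
  then obtain B where B: "\<And>x. x \<in> S \<Longrightarrow> norm (f x) \<le> B"
    using closure_subset[of S] by (force dest!: compact_imp_bounded simp: bounded_iff)
  show "integrable (lebesgue_on S) (\<lambda>x. (norm (f x))\<^sup>2)"
  proof (rule finite_measure.integrable_const_bound[where B = "B\<^sup>2"])
    show "finite_measure (lebesgue_on S)" using Sm by (rule finite_measure_lebesgue_on)
    show "AE x in lebesgue_on S. norm ((norm (f x))\<^sup>2) \<le> B\<^sup>2"
    proof (intro AE_I2)
      fix x assume "x \<in> space (lebesgue_on S)"
      then show "norm ((norm (f x))\<^sup>2) \<le> B\<^sup>2"
        using power_mono[OF B[of x] norm_ge_zero, of 2] by simp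
    qed
  qed (use m in simp)
qed

lemma square_integrable_integrable:
  fixes f :: "real^2 \<Rightarrow> real"
  assumes "open S" "bounded S" "square_integrable S f"
  shows "integrable (lebesgue_on S) f"
proof -
  have "square_integrable S (\<lambda>x. 1::real)" using assms by (intro square_integrable_continuous) auto
  from integrable_mult_square_integrable[OF assms(3) this] show ?thesis by simp
qed

lemma test_function_continuous:
  assumes "test_function S \<psi>"
  shows "continuous_on UNIV \<psi>"
    and "b \<in> Basis \<Longrightarrow> continuous_on UNIV (\<lambda>x. frechet_derivative \<psi> (at x) b)"
proof -
  have "Ck 0 \<psi>" "Ck (Suc 0) \<psi>" using assms unfolding test_function_def by blast+
  then show "continuous_on UNIV \<psi>"
    "b \<in> Basis \<Longrightarrow> continuous_on UNIV (\<lambda>x. frechet_derivative \<psi> (at x) b)" by auto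
qed

lemma test_function_zero_outside:
  assumes "test_function S \<psi>" "x \<notin> S"
  shows "\<psi> x = 0" "frechet_derivative \<psi> (at x) b = 0"
proof -
  have x: "x \<in> - closure {x. \<psi> x \<noteq> 0}" using assms unfolding test_function_def by blast
  then show "\<psi> x = 0" using closure_subset[of "{x. \<psi> x \<noteq> 0}"] by blast
  have "((\<lambda>x. 0) has_derivative (\<lambda>b. 0)) (at x)" by simp
  then have "(\<psi> has_derivative (\<lambda>b. 0)) (at x)"
  proof (rule has_derivative_transform_within_open[OF _ _ x])
    show "0 = \<psi> y" if "y \<in> - closure {x. \<psi> x \<noteq> 0}" for y
      using that closure_subset[of "{x. \<psi> x \<noteq> 0}"] by auto
  qed auto
  then show "frechet_derivative \<psi> (at x) b = 0"
    using frechet_derivative_at by metis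
qed

text \<open>Each component of the difference annihilates all test functions; on a bounded set square
  integrability makes it integrable, so the fundamental lemma applies.\<close>

lemma weak_gradient_unique:
  assumes S: "open S" "bounded S"
    and G: "square_integrable S G" "is_weak_gradient S f G"
    and H: "square_integrable S H" "is_weak_gradient S f H"
  shows "AE x in lebesgue_on S. G x = H x"
proof -
  have "AE x in lebesgue_on S. (G x - H x) \<bullet> b = 0" if b: "b \<in> Basis" for b
  proof (rule fundamental_lemma[OF S(1)])
    have "square_integrable S (\<lambda>x. (-1) *\<^sub>R (H x) + G x)"
      by (rule square_integrable_lincomb[OF H(1) G(1)])
    from square_integrable_component[OF this b] have "square_integrable S (\<lambda>x. (G x - H x) \<bullet> b)" by simp
    then show "integrable (lebesgue_on S) (\<lambda>x. (G x - H x) \<bullet> b)"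
      by (rule square_integrable_integrable[OF S])
    fix \<psi> assume \<psi>: "test_function S \<psi>"
    have sq: "square_integrable S \<psi>"
      by (rule square_integrable_continuous[OF S test_function_continuous(1)[OF \<psi>]])
    have "(\<integral>x. ((G x - H x) \<bullet> b) * \<psi> x \<partial>lebesgue_on S) =
        (\<integral>x. (G x \<bullet> b) * \<psi> x - (H x \<bullet> b) * \<psi> x \<partial>lebesgue_on S)"
      by (simp add: inner_diff_left left_diff_distrib)
    also have "\<dots> = (\<integral>x. (G x \<bullet> b) * \<psi> x \<partial>lebesgue_on S) - (\<integral>x. (H x \<bullet> b) * \<psi> x \<partial>lebesgue_on S)"
      using b G(1) H(1)
      by (intro Bochner_Integration.integral_diff integrable_mult_square_integrable square_integrable_component sq)
    also have "\<dots> = 0"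
    proof -
      have "(\<integral>x. f x * frechet_derivative \<psi> (at x) b \<partial>lebesgue_on S) = - (\<integral>x. (G x \<bullet> b) * \<psi> x \<partial>lebesgue_on S)"
        "(\<integral>x. f x * frechet_derivative \<psi> (at x) b \<partial>lebesgue_on S) = - (\<integral>x. (H x \<bullet> b) * \<psi> x \<partial>lebesgue_on S)"
        using G(2) H(2) \<psi> b unfolding is_weak_gradient_def by blast+
      then show ?thesis by simp
    qed
    finally show "(\<integral>x. ((G x - H x) \<bullet> b) * \<psi> x \<partial>lebesgue_on S) = 0" .
  qed
  then have "AE x in lebesgue_on S. \<forall>b\<in>Basis. (G x - H x) \<bullet> b = 0"
    by (intro AE_finite_allI) auto
  then show ?thesis
  proof eventually_elim
    case (elim x)
    show ?case by (rule euclidean_eqI) (use elim in \<open>simp add: inner_diff_left\<close>)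
  qed
qed

lemma weak_gradient_lincomb:
  assumes S: "open S" "bounded S"
    and f: "square_integrable S f" and F: "square_integrable S F" "is_weak_gradient S f F"
    and g: "square_integrable S g" and G: "square_integrable S G" "is_weak_gradient S g G"
  shows "is_weak_gradient S (\<lambda>x. a * f x + g x) (\<lambda>x. a *\<^sub>R F x + G x)"
  unfolding is_weak_gradient_def
proof (intro allI impI ballI)
  fix \<psi> :: "real^2 \<Rightarrow> real" and b :: "real^2"
  assume \<psi>: "test_function S \<psi>" and b: "b \<in> Basis"
  let ?d = "\<lambda>x. frechet_derivative \<psi> (at x) b"
  have sq: "square_integrable S \<psi>" "square_integrable S ?d"
    using test_function_continuous[OF \<psi>] b by (auto intro: square_integrable_continuous[OF S])
  note int = integrable_mult_square_integrable[OF _ sq(1)] integrable_mult_square_integrable[OF _ sq(2)]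
  have "(\<integral>x. (a * f x + g x) * ?d x \<partial>lebesgue_on S) = (\<integral>x. a * (f x * ?d x) + g x * ?d x \<partial>lebesgue_on S)"
    by (simp add: algebra_simps)
  also have "\<dots> = a * (\<integral>x. f x * ?d x \<partial>lebesgue_on S) + (\<integral>x. g x * ?d x \<partial>lebesgue_on S)"
    using int(2)[OF f] int(2)[OF g] by simp
  also have "\<dots> = - (a * (\<integral>x. (F x \<bullet> b) * \<psi> x \<partial>lebesgue_on S) + (\<integral>x. (G x \<bullet> b) * \<psi> x \<partial>lebesgue_on S))"
    using F(2) G(2) \<psi> b unfolding is_weak_gradient_def by simp
  also have "a * (\<integral>x. (F x \<bullet> b) * \<psi> x \<partial>lebesgue_on S) + (\<integral>x. (G x \<bullet> b) * \<psi> x \<partial>lebesgue_on S)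
      = (\<integral>x. a * ((F x \<bullet> b) * \<psi> x) + (G x \<bullet> b) * \<psi> x \<partial>lebesgue_on S)"
    using int(1)[OF square_integrable_component[OF F(1) b]] int(1)[OF square_integrable_component[OF G(1) b]] by simp
  also have "\<dots> = (\<integral>x. ((a *\<^sub>R F x + G x) \<bullet> b) * \<psi> x \<partial>lebesgue_on S)"
    by (simp add: inner_add_left algebra_simps)
  finally show "(\<integral>x. (a * f x + g x) * ?d x \<partial>lebesgue_on S) = - (\<integral>x. ((a *\<^sub>R F x + G x) \<bullet> b) * \<psi> x \<partial>lebesgue_on S)" .
qed

section \<open>The space \<open>H1\<close> and the bilinear form\<close>

lemma H1_square_integrable: "f \<in> H1 S \<Longrightarrow> square_integrable S f"
  by (simp add: H1_def)

lemma
  assumes "f \<in> H1 S"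
  shows wgrad_square_integrable: "square_integrable S (wgrad S f)"
    and wgrad_weak_gradient: "is_weak_gradient S f (wgrad S f)"
proof -
  have "\<exists>G. square_integrable S G \<and> is_weak_gradient S f G" using assms by (simp add: H1_def)
  then have "square_integrable S (wgrad S f) \<and> is_weak_gradient S f (wgrad S f)"
    unfolding wgrad_def by (rule someI_ex)
  then show "square_integrable S (wgrad S f)" "is_weak_gradient S f (wgrad S f)" by auto
qed

text \<open>As \<open>wgrad\<close> is an arbitrary choice, its identities are obtained by
  exhibiting a weak gradient and comparing the two almost everywhere.\<close>

lemma wgrad_AE_eq:
  assumes "open S" "bounded S" "square_integrable S f" "square_integrable S G" "is_weak_gradient S f G"
  shows "AE x in lebesgue_on S. wgrad S f x = G x"
proof -
  have "f \<in> H1 S" using assms by (auto simp: H1_def)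
  then show ?thesis
    using assms by (intro weak_gradient_unique[of S _ f] wgrad_square_integrable wgrad_weak_gradient)
qed

lemma
  assumes S: "open S" "bounded S" and f: "f \<in> H1 S" and g: "g \<in> H1 S"
  shows H1_lincomb: "(\<lambda>x. a * f x + g x) \<in> H1 S"
    and wgrad_lincomb: "AE x in lebesgue_on S. wgrad S (\<lambda>x. a * f x + g x) x = a *\<^sub>R wgrad S f x + wgrad S g x"
proof -
  have 1: "square_integrable S (\<lambda>x. a * f x + g x)"
    using square_integrable_lincomb[OF H1_square_integrable[OF f] H1_square_integrable[OF g], of a] by simp
  have 2: "square_integrable S (\<lambda>x. a *\<^sub>R wgrad S f x + wgrad S g x)"
    by (intro square_integrable_lincomb wgrad_square_integrable f g)
  have 3: "is_weak_gradient S (\<lambda>x. a * f x + g x) (\<lambda>x. a *\<^sub>R wgrad S f x + wgrad S g x)"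
    by (intro weak_gradient_lincomb S wgrad_square_integrable wgrad_weak_gradient H1_square_integrable f g)
  show "(\<lambda>x. a * f x + g x) \<in> H1 S" using 1 2 3 by (auto simp: H1_def)
  show "AE x in lebesgue_on S. wgrad S (\<lambda>x. a * f x + g x) x = a *\<^sub>R wgrad S f x + wgrad S g x"
    by (rule wgrad_AE_eq[OF S 1 2 3])
qed

lemma bilinear_form_commute: "bilinear_form \<eta> S v w = bilinear_form \<eta> S w v"
  by (simp add: bilinear_form_def mult.commute inner_commute)

lemma bilinear_form_lincomb:
  assumes S: "open S" "bounded S" and f: "f \<in> H1 S" and g: "g \<in> H1 S" and w: "w \<in> H1 S"
  shows "bilinear_form \<eta> S (\<lambda>x. a * f x + g x) w = a * bilinear_form \<eta> S f w + bilinear_form \<eta> S g w"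
proof -
  have m: "wgrad S v \<in> borel_measurable (lebesgue_on S)" if "v \<in> H1 S" for v
    using wgrad_square_integrable[OF that] by (rule square_integrable_measurable)
  have "(\<integral>x. wgrad S (\<lambda>x. a * f x + g x) x \<bullet> wgrad S w x \<partial>lebesgue_on S) =
      (\<integral>x. a * (wgrad S f x \<bullet> wgrad S w x) + wgrad S g x \<bullet> wgrad S w x \<partial>lebesgue_on S)"
  proof (rule Bochner_Integration.integral_cong_AE)
    show "AE x in lebesgue_on S. wgrad S (\<lambda>x. a * f x + g x) x \<bullet> wgrad S w x =
       a * (wgrad S f x \<bullet> wgrad S w x) + wgrad S g x \<bullet> wgrad S w x"
      using wgrad_lincomb[OF S f g, of a] by eventually_elim (simp add: inner_add_left)
    show "(\<lambda>x. wgrad S (\<lambda>x. a * f x + g x) x \<bullet> wgrad S w x) \<in> borel_measurable (lebesgue_on S)"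
      by (intro borel_measurable_inner m H1_lincomb S f g w)
    show "(\<lambda>x. a * (wgrad S f x \<bullet> wgrad S w x) + wgrad S g x \<bullet> wgrad S w x) \<in> borel_measurable (lebesgue_on S)"
      by (intro borel_measurable_add borel_measurable_times borel_measurable_const borel_measurable_inner m f g w)
  qed
  also have "\<dots> = a * (\<integral>x. wgrad S f x \<bullet> wgrad S w x \<partial>lebesgue_on S) + (\<integral>x. wgrad S g x \<bullet> wgrad S w x \<partial>lebesgue_on S)"
    using integrable_inner_square_integrable[OF wgrad_square_integrable[OF f] wgrad_square_integrable[OF w]]
      integrable_inner_square_integrable[OF wgrad_square_integrable[OF g] wgrad_square_integrable[OF w]] by simp
  finally have grad: "(\<integral>x. wgrad S (\<lambda>x. a * f x + g x) x \<bullet> wgrad S w x \<partial>lebesgue_on S) =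
    a * (\<integral>x. wgrad S f x \<bullet> wgrad S w x \<partial>lebesgue_on S) + (\<integral>x. wgrad S g x \<bullet> wgrad S w x \<partial>lebesgue_on S)" .
  have "(\<integral>x. (a * f x + g x) * w x \<partial>lebesgue_on S) = (\<integral>x. a * (f x * w x) + g x * w x \<partial>lebesgue_on S)"
    by (simp add: algebra_simps)
  also have "\<dots> = a * (\<integral>x. f x * w x \<partial>lebesgue_on S) + (\<integral>x. g x * w x \<partial>lebesgue_on S)"
    using integrable_mult_square_integrable[OF H1_square_integrable[OF f] H1_square_integrable[OF w]]
      integrable_mult_square_integrable[OF H1_square_integrable[OF g] H1_square_integrable[OF w]] by simp
  finally show ?thesis unfolding bilinear_form_def grad by (simp add: algebra_simps)
qed

text \<open>The zero field is a weak gradient of \<open>v\<close> on \<open>S\<close>. The case of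
  interest is a hat function seen from a subdomain whose closure misses its node.\<close>

lemma bilinear_form_zero_on:
  assumes S: "open S" "bounded S" and w: "w \<in> H1 S" and v: "\<And>x. x \<in> S \<Longrightarrow> v x = 0"
  shows "bilinear_form \<eta> S v w = 0"
proof -
  have sq: "square_integrable S v"
    unfolding square_integrable_def
  proof
    show "v \<in> borel_measurable (lebesgue_on S)"
      using v by (subst measurable_cong[of _ _ "\<lambda>x. 0"]) auto
    show "integrable (lebesgue_on S) (\<lambda>x. (norm (v x))\<^sup>2)"
      using v by (subst Bochner_Integration.integrable_cong[of _ _ _ "\<lambda>x. 0"]) auto
  qed
  have "(\<integral>x. v x * g x \<partial>lebesgue_on S) = 0" for g
    using v by (subst Bochner_Integration.integral_cong[of _ _ _ "\<lambda>x. 0"]) auto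
  moreover from this have "is_weak_gradient S v (\<lambda>x. 0)" by (simp add: is_weak_gradient_def)
  then have "AE x in lebesgue_on S. wgrad S v x = 0"
    by (rule wgrad_AE_eq[OF S sq square_integrable_zero])
  then have "AE x in lebesgue_on S. wgrad S v x \<bullet> wgrad S w x = 0" by eventually_elim simp
  then have "(\<integral>x. wgrad S v x \<bullet> wgrad S w x \<partial>lebesgue_on S) = 0" by (rule integral_eq_zero_AE)
  ultimately show ?thesis by (simp add: bilinear_form_def)
qed

lemma bilinear_form_sum:
  assumes S: "open S" "bounded S" and "finite A" and v: "\<And>a. a \<in> A \<Longrightarrow> v a \<in> H1 S" and w: "w \<in> H1 S"
  shows "(\<lambda>x. \<Sum>a\<in>A. c a * v a x) \<in> H1 S \<and>
    bilinear_form \<eta> S (\<lambda>x. \<Sum>a\<in>A. c a * v a x) w = (\<Sum>a\<in>A. c a * bilinear_form \<eta> S (v a) w)"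
  using \<open>finite A\<close> v
proof (induction A rule: finite_induct)
  case empty
  have "(\<lambda>x. 0) \<in> H1 S"
    unfolding H1_def is_weak_gradient_def by (auto intro!: square_integrable_zero exI[of _ "\<lambda>x. 0"])
  then show ?case using bilinear_form_zero_on[OF S w, of "\<lambda>x. 0"] by simp
next
  case (insert a A)
  then show ?case
    using H1_lincomb[OF S, of "v a" "\<lambda>x. \<Sum>a\<in>A. c a * v a x" "c a"]
      bilinear_form_lincomb[OF S, of "v a" "\<lambda>x. \<Sum>a\<in>A. c a * v a x" w \<eta> "c a"] w by simp
qed

section \<open>Restriction to subdomains and additivity of the form\<close>

lemma square_integrable_subset:
  assumes "square_integrable S f" "S' \<subseteq> S" "S \<in> sets lebesgue" "S' \<in> sets lebesgue"
  shows "square_integrable S' f"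
  unfolding square_integrable_def
proof
  show "f \<in> borel_measurable (lebesgue_on S')"
    using assms measurable_restrict_mono unfolding square_integrable_def by blast
  show "integrable (lebesgue_on S') (\<lambda>x. (norm (f x))\<^sup>2)"
    using assms unfolding square_integrable_def by (blast intro: integrable_lebesgue_on_subset)
qed

lemma integral_lebesgue_on_subset:
  fixes g :: "real^2 \<Rightarrow> real"
  assumes "S' \<subseteq> S" "S \<in> sets lebesgue" "S' \<in> sets lebesgue" "\<And>x. x \<notin> S' \<Longrightarrow> g x = 0"
  shows "(\<integral>x. g x \<partial>lebesgue_on S') = (\<integral>x. g x \<partial>lebesgue_on S)"
proof -
  have "(\<lambda>x. indicator S' x *\<^sub>R g x) = (\<lambda>x. indicator S x *\<^sub>R g x)"
  proof
    show "indicator S' x *\<^sub>R g x = indicator S x *\<^sub>R g x" for x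
      using assms(1) assms(4)[of x] by (cases "x \<in> S'") (auto simp: indicator_def)
  qed
  then show ?thesis unfolding integral_lebesgue_on[OF assms(2)] integral_lebesgue_on[OF assms(3)] by (simp only:)
qed

text \<open>A test function on \<open>S'\<close> is one on \<open>S\<close> and vanishes outside
  \<open>S'\<close>, so the gradient on \<open>S\<close> is also a weak gradient on
  \<open>S'\<close>.\<close>

lemma
  assumes S: "open S" "open S'" "bounded S'" "S' \<subseteq> S" and f: "f \<in> H1 S"
  shows H1_subset: "f \<in> H1 S'"
    and wgrad_subset: "AE x in lebesgue_on S'. wgrad S' f x = wgrad S f x"
proof -
  have m: "S \<in> sets lebesgue" "S' \<in> sets lebesgue" using S by auto
  have 1: "square_integrable S' f" "square_integrable S' (wgrad S f)"
    using square_integrable_subset[OF _ S(4) m] H1_square_integrable[OF f] wgrad_square_integrable[OF f] by auto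
  have 2: "is_weak_gradient S' f (wgrad S f)"
    unfolding is_weak_gradient_def
  proof (intro allI impI ballI)
    fix \<psi> :: "real^2 \<Rightarrow> real" and b :: "real^2"
    assume \<psi>: "test_function S' \<psi>" and b: "b \<in> Basis"
    have "(\<integral>x. f x * frechet_derivative \<psi> (at x) b \<partial>lebesgue_on S') = (\<integral>x. f x * frechet_derivative \<psi> (at x) b \<partial>lebesgue_on S)"
      using test_function_zero_outside[OF \<psi>] by (intro integral_lebesgue_on_subset S m) auto
    also have "\<dots> = - (\<integral>x. (wgrad S f x \<bullet> b) * \<psi> x \<partial>lebesgue_on S)"
      using wgrad_weak_gradient[OF f] test_function_subset[OF \<psi> S(4)] b unfolding is_weak_gradient_def by blast
    also have "(\<integral>x. (wgrad S f x \<bullet> b) * \<psi> x \<partial>lebesgue_on S) = (\<integral>x. (wgrad S f x \<bullet> b) * \<psi> x \<partial>lebesgue_on S')"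
      using test_function_zero_outside[OF \<psi>] by (intro integral_lebesgue_on_subset[symmetric] S m) auto
    finally show "(\<integral>x. f x * frechet_derivative \<psi> (at x) b \<partial>lebesgue_on S') = - (\<integral>x. (wgrad S f x \<bullet> b) * \<psi> x \<partial>lebesgue_on S')" .
  qed
  show "f \<in> H1 S'" using 1 2 by (auto simp: H1_def)
  show "AE x in lebesgue_on S'. wgrad S' f x = wgrad S f x"
    by (rule wgrad_AE_eq[OF S(2,3) 1 2])
qed

lemma integral_decompose:
  fixes k :: "real^2 \<Rightarrow> real"
  assumes "finite K" "open S" "\<And>i. i \<in> K \<Longrightarrow> open (Ss i) \<and> Ss i \<subseteq> S" "disjoint_family_on Ss K"
    and "negligible (S - (\<Union>i\<in>K. Ss i))" and k: "integrable (lebesgue_on S) k"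
  shows "(\<integral>x. k x \<partial>lebesgue_on S) = (\<Sum>i\<in>K. \<integral>x. k x \<partial>lebesgue_on (Ss i))"
proof -
  have m: "S \<in> sets lebesgue" "\<And>i. i \<in> K \<Longrightarrow> Ss i \<in> sets lebesgue" using assms by auto
  have ki: "integrable lebesgue (\<lambda>x. indicator S x *\<^sub>R k x)" using k m(1) by (simp add: integrable_lebesgue_on)
  have kis: "integrable lebesgue (\<lambda>x. indicator (Ss i) x *\<^sub>R k x)" if i: "i \<in> K" for i
    using integrable_lebesgue_on_subset[OF k _ m(1) m(2)[OF i]] assms(3)[OF i] integrable_lebesgue_on[OF m(2)[OF i]]
    by blast
  have "(\<integral>x. k x \<partial>lebesgue_on S) = (\<integral>x. indicator S x *\<^sub>R k x \<partial>lebesgue)"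
    by (rule integral_lebesgue_on[OF m(1)])
  also have "\<dots> = (\<integral>x. (\<Sum>i\<in>K. indicator (Ss i) x *\<^sub>R k x) \<partial>lebesgue)"
  proof (rule Bochner_Integration.integral_cong_AE)
    show "(\<lambda>x. indicator S x *\<^sub>R k x) \<in> borel_measurable lebesgue" using ki by auto
    show "(\<lambda>x. \<Sum>i\<in>K. indicator (Ss i) x *\<^sub>R k x) \<in> borel_measurable lebesgue"
      using kis by (intro borel_measurable_sum) auto
    have "AE x in lebesgue. x \<notin> S - (\<Union>i\<in>K. Ss i)"
      using assms(5) by (intro AE_not_in) (simp add: negligible_iff_null_sets)
    then show "AE x in lebesgue. indicator S x *\<^sub>R k x = (\<Sum>i\<in>K. indicator (Ss i) x *\<^sub>R k x)"
    proof eventually_elim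
      case (elim x)
      have "(\<Sum>i\<in>K. indicator (Ss i) x *\<^sub>R k x) = (\<Sum>i\<in>K. indicator (Ss i) x) *\<^sub>R k x"
        by (simp add: sum_distrib_right)
      also have "(\<Sum>i\<in>K. indicator (Ss i) x) = (indicator (\<Union>i\<in>K. Ss i) x :: real)"
        using assms(1,4) by (simp add: indicator_UN_disjoint)
      also have "\<dots> = indicator S x" using elim assms(3) by (auto simp: indicator_def)
      finally show ?case by simp
    qed
  qed
  also have "\<dots> = (\<Sum>i\<in>K. \<integral>x. indicator (Ss i) x *\<^sub>R k x \<partial>lebesgue)"
    using kis by (intro Bochner_Integration.integral_sum) auto
  also have "\<dots> = (\<Sum>i\<in>K. \<integral>x. k x \<partial>lebesgue_on (Ss i))"
    using integral_lebesgue_on[OF m(2), of _ k] by (intro sum.cong) auto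
  finally show ?thesis .
qed

text \<open>The integrals split because the pieces fill \<open>S\<close> up to a null set. What
  remains is to exchange the gradient chosen on \<open>S\<close> for the one chosen on each piece;
  they agree there almost everywhere.\<close>

lemma bilinear_form_decompose:
  assumes "finite K" "open S" "bounded S" "\<And>i. i \<in> K \<Longrightarrow> open (Ss i) \<and> Ss i \<subseteq> S" "disjoint_family_on Ss K"
    and "negligible (S - (\<Union>i\<in>K. Ss i))" and v: "v \<in> H1 S" and w: "w \<in> H1 S"
  shows "bilinear_form \<eta> S v w = (\<Sum>i\<in>K. bilinear_form \<eta> (Ss i) v w)"
proof -
  have "(\<integral>x. wgrad S v x \<bullet> wgrad S w x \<partial>lebesgue_on (Ss i)) = (\<integral>x. wgrad (Ss i) v x \<bullet> wgrad (Ss i) w x \<partial>lebesgue_on (Ss i))"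
    if i: "i \<in> K" for i
  proof -
    have Si: "open (Ss i)" "bounded (Ss i)" "Ss i \<subseteq> S" using assms(4)[OF i] bounded_subset[OF assms(3)] by auto
    have sq: "square_integrable (Ss i) (wgrad (Ss i) f)" "square_integrable (Ss i) (wgrad S f)" if f: "f \<in> H1 S" for f
      using wgrad_square_integrable[OF H1_subset[OF assms(2) Si f]]
        square_integrable_subset[OF wgrad_square_integrable[OF f] Si(3)] assms(2) Si(1) by auto
    have m: "(\<lambda>x. wgrad U v x \<bullet> wgrad U w x) \<in> borel_measurable (lebesgue_on (Ss i))" if "U \<in> {S, Ss i}" for U
      using that sq[OF v] sq[OF w] square_integrable_measurable by (auto intro!: borel_measurable_inner)
    show ?thesis
    proof (rule Bochner_Integration.integral_cong_AE)
      show "AE x in lebesgue_on (Ss i). wgrad S v x \<bullet> wgrad S w x = wgrad (Ss i) v x \<bullet> wgrad (Ss i) w x"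
        using wgrad_subset[OF assms(2) Si v] wgrad_subset[OF assms(2) Si w] by eventually_elim simp
    qed (use m in auto)
  qed
  then show ?thesis
    unfolding bilinear_form_def
    using integral_decompose[OF assms(1,2,4,5,6) integrable_inner_square_integrable[OF wgrad_square_integrable[OF v] wgrad_square_integrable[OF w]]]
      integral_decompose[OF assms(1,2,4,5,6) integrable_mult_square_integrable[OF H1_square_integrable[OF v] H1_square_integrable[OF w]]]
    by (simp add: sum.distrib sum_distrib_left)
qed

lemma H1_norm_eq: "H1_norm S f = sqrt (bilinear_form 1 S f f)"
  unfolding H1_norm_def bilinear_form_def power2_norm_eq_inner by (simp add: power2_eq_square)

text \<open>The mass term alone is strictly positive: by continuity a nonzero value in the closure
  forces nonzero values on a nonempty open part of \<open>S\<close>, which is not null. The closure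
  matters because nodes may lie on the frontier of a subdomain.\<close>

lemma bilinear_form_pos:
  assumes S: "open S" and \<eta>: "\<eta> > 0" and v: "v \<in> H1 S" "continuous_on UNIV v" and x: "x \<in> closure S" "v x \<noteq> 0"
  shows "bilinear_form \<eta> S v v > 0"
proof -
  have grad: "(\<integral>x. wgrad S v x \<bullet> wgrad S v x \<partial>lebesgue_on S) \<ge> 0"
    by (rule Bochner_Integration.integral_nonneg) simp
  have int: "integrable (lebesgue_on S) (\<lambda>x. v x * v x)"
    using H1_square_integrable[OF v(1)] by (rule integrable_mult_square_integrable) (rule H1_square_integrable[OF v(1)])
  have nn: "(\<integral>x. v x * v x \<partial>lebesgue_on S) \<ge> 0" by (rule Bochner_Integration.integral_nonneg) simp
  moreover have "(\<integral>x. v x * v x \<partial>lebesgue_on S) \<noteq> 0"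
  proof
    assume "(\<integral>x. v x * v x \<partial>lebesgue_on S) = 0"
    then have "AE x in lebesgue_on S. v x * v x = 0"
      using integral_nonneg_eq_0_iff_AE[OF int] by simp
    then have "AE x in lebesgue. x \<in> S \<longrightarrow> v x = 0" using S by (simp add: AE_restrict_space_iff)
    then have "AE x in lebesgue. x \<notin> S \<inter> {x. v x \<noteq> 0}" by (rule AE_mp) (auto intro!: AE_I2)
    moreover have op: "open (S \<inter> {x. v x \<noteq> 0})"
      using S open_Collect_neq[OF v(2) continuous_on_const, of 0] by (rule open_Int)
    ultimately have "S \<inter> {x. v x \<noteq> 0} \<in> null_sets lebesgue"
      by (subst AE_iff_null_sets) auto
    then have "S \<inter> {x. v x \<noteq> 0} = {}"
      using open_not_negligible[OF op] by (auto simp: negligible_iff_null_sets)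
    then have "S \<subseteq> {x. v x = 0}" by blast
    moreover have "closed {x. v x = 0}" by (rule closed_Collect_eq[OF v(2) continuous_on_const])
    ultimately have "closure S \<subseteq> {x. v x = 0}" by (rule closure_minimal)
    then show False using x by blast
  qed
  ultimately have "(\<integral>x. v x * v x \<partial>lebesgue_on S) > 0" by linarith
  from mult_pos_pos[OF \<eta> this] grad show ?thesis unfolding bilinear_form_def by linarith
qed

section \<open>Polygons\<close>

definition poly_boundary :: "(real^2) list \<Rightarrow> (real^2) set" where
  "poly_boundary vs = (\<Union>e\<in>poly_edges vs. convex hull e)"

lemma cell_eq_inside: "cell vs = inside (poly_boundary vs)"
  by (simp add: cell_def poly_boundary_def)

text \<open>The chain through the list without its closing edge: this part is an arc, and the
  closing segment then completes it to a loop. Lists with fewer than two points get a dummy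
  path.\<close>

fun poly_path :: "(real^2) list \<Rightarrow> real \<Rightarrow> real^2" where
  "poly_path (a # b # c # xs) = linepath a b +++ poly_path (b # c # xs)"
| "poly_path [a, b] = linepath a b"
| "poly_path _ = linepath 0 0"

lemma pathstart_poly_path: "2 \<le> length xs \<Longrightarrow> pathstart (poly_path xs) = hd xs"
  by (induction xs rule: poly_path.induct) auto

lemma pathfinish_poly_path: "2 \<le> length xs \<Longrightarrow> pathfinish (poly_path xs) = last xs"
  by (induction xs rule: poly_path.induct) auto

lemma path_image_poly_path:
  "2 \<le> length xs \<Longrightarrow> path_image (poly_path xs) = (\<Union>k\<in>{k. Suc k < length xs}. closed_segment (xs ! k) (xs ! Suc k))"
proof (induction xs rule: poly_path.induct)
  case (1 a b c xs)
  let ?ys = "b # c # xs"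
  have "{k. Suc k < length (a # ?ys)} = insert 0 (Suc ` {k. Suc k < length ?ys})"
    by (auto simp: image_iff) (metis Suc_less_eq gr0_conv_Suc length_Cons not_gr_zero)
  then have "(\<Union>k\<in>{k. Suc k < length (a # ?ys)}. closed_segment ((a # ?ys) ! k) ((a # ?ys) ! Suc k))
      = closed_segment a b \<union> (\<Union>k\<in>{k. Suc k < length ?ys}. closed_segment (?ys ! k) (?ys ! Suc k))"
    by simp
  then show ?case
    using 1 by (simp add: path_image_join pathstart_poly_path)
next
  case (2 a b)
  have "{k. Suc k < length [a, b]} = {0}" by auto
  then show ?case by simp
qed auto

lemma arc_poly_path:
  assumes "2 \<le> length xs" "distinct xs"
    and "\<And>j k. j < k \<Longrightarrow> Suc k < length xs \<Longrightarrow>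
      closed_segment (xs ! j) (xs ! Suc j) \<inter> closed_segment (xs ! k) (xs ! Suc k)
        \<subseteq> {xs ! j, xs ! Suc j} \<inter> {xs ! k, xs ! Suc k}"
  shows "arc (poly_path xs)"
  using assms
proof (induction xs rule: poly_path.induct)
  case (1 a b c xs)
  let ?ys = "b # c # xs"
  have sub: "path_image (linepath a b) \<inter> path_image (poly_path ?ys) \<subseteq> {b}"
  proof
    fix z assume z: "z \<in> path_image (linepath a b) \<inter> path_image (poly_path ?ys)"
    then obtain k where k: "Suc k < length ?ys" "z \<in> closed_segment (?ys ! k) (?ys ! Suc k)"
      by (auto simp: path_image_poly_path)
    have "z \<in> {a, b} \<inter> {?ys ! k, ?ys ! Suc k}"
      using "1.prems"(3)[of 0 "Suc k"] z k by auto
    moreover have "?ys ! k \<in> set ?ys" "?ys ! Suc k \<in> set ?ys"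
      using k(1) by (metis Suc_lessD nth_mem)+
    ultimately show "z \<in> {b}" using "1.prems"(2) by auto
  qed
  have "arc (poly_path ?ys)"
  proof (rule "1.IH")
    fix j k :: nat assume "j < k" "Suc k < length ?ys"
    then show "closed_segment (?ys ! j) (?ys ! Suc j) \<inter> closed_segment (?ys ! k) (?ys ! Suc k)
        \<subseteq> {?ys ! j, ?ys ! Suc j} \<inter> {?ys ! k, ?ys ! Suc k}"
      using "1.prems"(3)[of "Suc j" "Suc k"] by simp
  qed (use "1.prems" in auto)
  moreover have "arc (linepath a b)" using "1.prems"(2) by (auto intro: arc_linepath)
  ultimately show ?case
    using sub by (auto intro!: arc_join simp: pathstart_poly_path)
qed auto

lemma poly_edges_nth: "Suc k < length vs \<Longrightarrow> {vs ! k, vs ! Suc k} \<in> poly_edges vs"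
  unfolding poly_edges_def by (force intro: exI[of _ k])

lemma poly_edges_closing:
  assumes "vs \<noteq> []" shows "{last vs, hd vs} \<in> poly_edges vs"
proof -
  have "{vs ! (length vs - 1), vs ! (Suc (length vs - 1) mod length vs)} \<in> poly_edges vs"
    unfolding poly_edges_def using assms by (auto intro!: exI[of _ "length vs - 1"])
  then show ?thesis using assms by (simp add: last_conv_nth hd_conv_nth)
qed

lemma poly_edges_cases:
  assumes "e \<in> poly_edges vs"
  obtains k where "Suc k < length vs" "e = {vs ! k, vs ! Suc k}" | "vs \<noteq> []" "e = {last vs, hd vs}"
proof -
  from assms obtain k where k: "k < length vs" "e = {vs ! k, vs ! (Suc k mod length vs)}"
    by (auto simp: poly_edges_def)
  show thesis
  proof (cases "Suc k < length vs")
    case True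
    then show thesis using that(1) k by simp
  next
    case False
    then have "Suc k = length vs" using k by simp
    then have "k = length vs - 1" "vs \<noteq> []" by auto
    then show thesis using that(2) k \<open>Suc k = length vs\<close> by (simp add: last_conv_nth hd_conv_nth)
  qed
qed

lemma simple_polygon_loop:
  assumes "simple_polygon vs"
  obtains g where "simple_path g" "pathfinish g = pathstart g" "path_image g = poly_boundary vs"
proof -
  have len: "3 \<le> length vs" and dist: "distinct vs"
    and int: "\<And>e e'. e \<in> poly_edges vs \<Longrightarrow> e' \<in> poly_edges vs \<Longrightarrow> e \<noteq> e' \<Longrightarrow> convex hull e \<inter> convex hull e' \<subseteq> e \<inter> e'"
    using assms by (auto simp: simple_polygon_def)
  have ne: "vs \<noteq> []" using len by auto
  have arc1: "arc (poly_path vs)"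
  proof (rule arc_poly_path)
    fix j k assume jk: "j < k" "Suc k < length vs"
    have "vs ! j \<noteq> vs ! k" "vs ! j \<noteq> vs ! Suc k"
      using jk dist by (simp_all add: nth_eq_iff_index_eq)
    then have "{vs ! j, vs ! Suc j} \<noteq> {vs ! k, vs ! Suc k}" by auto
    then show "closed_segment (vs ! j) (vs ! Suc j) \<inter> closed_segment (vs ! k) (vs ! Suc k)
        \<subseteq> {vs ! j, vs ! Suc j} \<inter> {vs ! k, vs ! Suc k}"
      using int[OF poly_edges_nth poly_edges_nth] jk by (simp add: segment_convex_hull)
  qed (use len dist in auto)
  have lh: "last vs \<noteq> hd vs"
    using len dist ne by (simp add: last_conv_nth hd_conv_nth nth_eq_iff_index_eq)
  have sub: "path_image (poly_path vs) \<inter> path_image (linepath (last vs) (hd vs)) \<subseteq> {hd vs, last vs}"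
  proof
    fix z assume z: "z \<in> path_image (poly_path vs) \<inter> path_image (linepath (last vs) (hd vs))"
    then obtain k where k: "Suc k < length vs" "z \<in> closed_segment (vs ! k) (vs ! Suc k)"
      using len by (auto simp: path_image_poly_path)
    \<comment> \<open>A chain edge equal to the closing edge would lead from the first vertex
      directly to the last, and the polygon would have only two vertices.\<close>
    have "{vs ! k, vs ! Suc k} \<noteq> {last vs, hd vs}"
    proof
      assume eq: "{vs ! k, vs ! Suc k} = {last vs, hd vs}"
      have "vs ! Suc k \<noteq> vs ! 0" using k len dist ne by (subst nth_eq_iff_index_eq) auto
      then have "vs ! k = vs ! 0" "vs ! Suc k = vs ! (length vs - 1)"
        using eq ne by (auto simp: doubleton_eq_iff last_conv_nth hd_conv_nth)
      then have "k = 0 \<and> Suc k = length vs - 1"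
        using k dist ne by (simp add: nth_eq_iff_index_eq)
      then show False using len by arith
    qed
    then show "z \<in> {hd vs, last vs}"
      using int[OF poly_edges_nth[OF k(1)] poly_edges_closing[OF ne]] z k(2)
      by (auto simp: segment_convex_hull)
  qed
  have "simple_path (poly_path vs +++ linepath (last vs) (hd vs))"
    using len sub lh by (intro simple_path_join_loop arc1 arc_linepath)
       (auto simp: pathstart_poly_path pathfinish_poly_path)
  moreover have "path_image (poly_path vs +++ linepath (last vs) (hd vs)) = poly_boundary vs"
  proof -
    have "path_image (poly_path vs +++ linepath (last vs) (hd vs)) =
        (\<Union>k\<in>{k. Suc k < length vs}. convex hull {vs ! k, vs ! Suc k}) \<union> convex hull {last vs, hd vs}"
      using len by (simp add: path_image_join pathfinish_poly_path path_image_poly_path segment_convex_hull)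
    also have "\<dots> = poly_boundary vs" (is "?R = _")
    proof
      show "?R \<subseteq> poly_boundary vs"
        using poly_edges_nth[of _ vs] poly_edges_closing[OF ne] unfolding poly_boundary_def by blast
      show "poly_boundary vs \<subseteq> ?R"
        unfolding poly_boundary_def by (auto elim!: poly_edges_cases)
    qed
    finally show ?thesis .
  qed
  ultimately show thesis
    using that[of "poly_path vs +++ linepath (last vs) (hd vs)"] len by (simp add: pathstart_poly_path)
qed

text \<open>The library states the Jordan curve theorem for \<^typ>\<open>complex\<close> only.\<close>

lemma Jordan_loop_inside:
  fixes g :: "real \<Rightarrow> 'a::euclidean_space"
  assumes "simple_path g" "pathfinish g = pathstart g" "DIM('a) = 2"
  shows "inside (path_image g) \<noteq> {}" "path_image g \<subseteq> closure (inside (path_image g))"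
proof -
  let ?S = "path_image g"
  \<comment> \<open>The loop is carried to the complex unit circle and from there to the unit sphere
    of \<open>'a\<close>, so that the Jordan-Brouwer theorems apply.\<close>
  have "?S homeomorphic sphere (0::complex) 1"
    by (rule homeomorphic_simple_path_image_circle) (use assms in auto)
  also have "\<dots> homeomorphic sphere (0::'a) 1"
    by (rule homeomorphic_spheres_gen) (use assms in auto)
  finally have hom: "?S homeomorphic sphere (0::'a) 1" .
  have nc: "\<not> connected (- ?S)"
    by (rule Jordan_Brouwer_separation[OF hom]) simp
  have bdd: "bounded ?S" using assms(1) by (rule bounded_simple_path_image)
  show ne: "inside ?S \<noteq> {}"
  proof
    assume "inside ?S = {}"
    then have "- ?S = outside ?S" using inside_Un_outside[of ?S] by simp
    then show False using nc connected_outside[OF bdd] assms(3) by simp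
  qed
  then obtain x where x: "x \<in> inside ?S" by blast
  \<comment> \<open>One component suffices, since its frontier is already the whole loop.\<close>
  define C where "C = connected_component_set (- ?S) x"
  have "C \<in> components (- ?S)"
    using x unfolding C_def components_def by (auto simp: inside_def)
  then have fr: "frontier C = ?S"
    using Jordan_Brouwer_frontier[OF hom] assms(3) by simp
  have "C \<subseteq> inside ?S"
  proof
    fix y assume y: "y \<in> C"
    then have "connected_component_set (- ?S) y = connected_component_set (- ?S) x"
      unfolding C_def by (metis connected_component_eq)
    moreover have "y \<notin> ?S" using y connected_component_subset[of "- ?S" x] unfolding C_def by blast
    ultimately show "y \<in> inside ?S" using x by (simp add: inside_def)
  qed
  then have "frontier C \<subseteq> closure (inside ?S)"
    unfolding frontier_def by (blast dest: closure_mono)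
  then show "?S \<subseteq> closure (inside ?S)" by (simp only: fr)
qed

section \<open>Edges and boundaries of cells\<close>

lemma finite_poly_edges: "finite (poly_edges vs)"
  unfolding poly_edges_def by simp

lemma poly_edges_finite_edge: "e \<in> poly_edges vs \<Longrightarrow> finite e"
  unfolding poly_edges_def by auto

lemma compact_poly_boundary: "compact (poly_boundary vs)"
  unfolding poly_boundary_def
  by (intro compact_UN finite_poly_edges compact_convex_hull finite_imp_compact poly_edges_finite_edge)

lemma poly_edges_subset_set: "e \<in> poly_edges vs \<Longrightarrow> e \<subseteq> set vs"
  unfolding poly_edges_def by (auto intro!: nth_mem mod_less_divisor)

lemma poly_edges_distinct_pair:
  assumes "simple_polygon vs" "e \<in> poly_edges vs"
  obtains a b where "e = {a, b}" "a \<noteq> b" "a \<in> set vs" "b \<in> set vs"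
proof -
  obtain k where k: "k < length vs" "e = {vs ! k, vs ! (Suc k mod length vs)}"
    using assms by (auto simp: poly_edges_def)
  have len: "3 \<le> length vs" "distinct vs" using assms by (auto simp: simple_polygon_def)
  have "Suc k mod length vs \<noteq> k"
    using k len by (cases "Suc k = length vs") auto
  moreover have "Suc k mod length vs < length vs" using len by (intro mod_less_divisor) auto
  ultimately show thesis
    using that[OF k(2)] k len by (simp add: nth_eq_iff_index_eq)
qed

lemma set_subset_poly_boundary:
  assumes "simple_polygon vs"
  shows "set vs \<subseteq> poly_boundary vs"
proof
  fix x assume "x \<in> set vs"
  then obtain k where "k < length vs" "x = vs ! k" by (auto simp: in_set_conv_nth)
  then have "{x, vs ! (Suc k mod length vs)} \<in> poly_edges vs"
    by (auto simp: poly_edges_def)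
  then show "x \<in> poly_boundary vs"
    unfolding poly_boundary_def by (blast intro: hull_inc)
qed

lemma open_cell: "open (cell vs)"
  unfolding cell_eq_inside by (intro open_inside compact_imp_closed compact_poly_boundary)

lemma frontier_cell_subset: "frontier (cell vs) \<subseteq> poly_boundary vs"
  unfolding cell_eq_inside by (intro frontier_inside_subset compact_imp_closed compact_poly_boundary)

text \<open>The two facts that come from the Jordan curve theorem. Through the second, mesh edges
  and vertices belong to closed cells, to which conformity applies.\<close>

lemma
  assumes "simple_polygon vs"
  shows cell_nonempty: "cell vs \<noteq> {}"
    and poly_boundary_subset_closure_cell: "poly_boundary vs \<subseteq> closure (cell vs)"
proof -
  obtain g where g: "simple_path g" "pathfinish g = pathstart g" "path_image g = poly_boundary vs"
    by (rule simple_polygon_loop[OF assms])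
  show "cell vs \<noteq> {}" "poly_boundary vs \<subseteq> closure (cell vs)"
    using Jordan_loop_inside[OF g(1,2)] unfolding g(3) cell_eq_inside by simp_all
qed

lemma closed_segment_in_line:
  fixes x y :: "real^2"
  obtains n c where "n \<noteq> 0" "closed_segment x y \<subseteq> {p. n \<bullet> p = c}"
proof (cases "x = y")
  case True
  show thesis
    by (rule that[of "axis 1 1" "axis 1 1 \<bullet> x"]) (use True in \<open>auto simp: axis_eq_0_iff\<close>)
next
  case False
  \<comment> \<open>The direction of the segment turned by a right angle.\<close>
  define n :: "real^2" where "n = vector [- (y - x) $ 2, (y - x) $ 1]"
  have "n \<noteq> 0"
  proof
    assume "n = 0"
    then have "n $ 1 = 0" "n $ 2 = 0" by auto
    then have "x = y" unfolding vec_eq_iff forall_2 by (simp add: n_def)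
    then show False using False by simp
  qed
  moreover have "n \<bullet> y = n \<bullet> x"
    by (simp add: n_def inner_vec_def sum_2 algebra_simps)
  then have "closed_segment x y \<subseteq> {p. n \<bullet> p = n \<bullet> x}"
    by (intro closed_segment_subset convex_hyperplane) auto
  ultimately show thesis using that by blast
qed

lemma negligible_closed_segment_plane: "negligible (closed_segment x (y :: real^2))"
proof -
  obtain n c where "n \<noteq> 0" "closed_segment x y \<subseteq> {p. n \<bullet> p = c}"
    by (rule closed_segment_in_line)
  then show ?thesis using negligible_hyperplane negligible_subset by blast
qed

section \<open>Meshes and decompositions\<close>

locale decomposed_mesh =
  fixes \<Omega> :: "(real^2) set" and T :: "(real^2) list set" and I :: nat and \<Omega>s :: "nat \<Rightarrow> (real^2) set"
  assumes domain: "polygonal_domain \<Omega>"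
    and mesh: "conforming_mesh \<Omega> T"
    and decomposition: "nonoverlapping_decomposition \<Omega> T I \<Omega>s"
begin

lemma open_domain: "open \<Omega>"
  using domain by (simp add: polygonal_domain_def)

lemma sub_domain: "i \<in> {1..I} \<Longrightarrow> polygonal_domain (\<Omega>s i)"
  and sub_subset: "i \<in> {1..I} \<Longrightarrow> \<Omega>s i \<subseteq> \<Omega>"
  using decomposition unfolding nonoverlapping_decomposition_def by simp_all

lemma open_sub: "i \<in> {1..I} \<Longrightarrow> open (\<Omega>s i)"
  and sub_regular: "i \<in> {1..I} \<Longrightarrow> interior (closure (\<Omega>s i)) = \<Omega>s i"
  using sub_domain unfolding polygonal_domain_def by simp_all

lemma sub_disjoint: "i \<in> {1..I} \<Longrightarrow> j \<in> {1..I} \<Longrightarrow> i \<noteq> j \<Longrightarrow> \<Omega>s i \<inter> \<Omega>s j = {}"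
  using decomposition unfolding nonoverlapping_decomposition_def by simp

lemma sub_closure_disjoint: "i \<in> {1..I} \<Longrightarrow> j \<in> {1..I} \<Longrightarrow> i \<noteq> j \<Longrightarrow> \<Omega>s i \<inter> closure (\<Omega>s j) = {}"
  using sub_disjoint open_sub by (simp add: open_Int_closure_eq_empty)

lemma domain_covered: "\<Omega> \<subseteq> (\<Union>i\<in>{1..I}. closure (\<Omega>s i))"
  using decomposition closure_subset[of \<Omega>] unfolding nonoverlapping_decomposition_def by simp

lemma finite_mesh: "finite T"
  and mesh_simple: "vs \<in> T \<Longrightarrow> simple_polygon vs"
  and domain_cells: "closure \<Omega> = (\<Union>vs\<in>T. closure (cell vs))"
  using mesh unfolding conforming_mesh_def by simp_all

lemma cell_in_sub:
  assumes "vs \<in> T" obtains i where "i \<in> {1..I}" "cell vs \<subseteq> \<Omega>s i"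
proof -
  have "\<forall>vs\<in>T. \<exists>!i. i \<in> {1..I} \<and> cell vs \<subseteq> \<Omega>s i"
    using decomposition unfolding nonoverlapping_decomposition_def by (elim conjE)
  then show thesis using assms that by (meson ex1_implies_ex)
qed

lemma mesh_conforming:
  assumes "vs \<in> T" "ws \<in> T" "vs \<noteq> ws" "z \<in> closure (cell vs)" "z \<in> closure (cell ws)"
  obtains "z \<in> set vs" "z \<in> set ws" | e where "e \<in> poly_edges vs" "e \<in> poly_edges ws" "z \<in> convex hull e"
proof -
  have "\<forall>vs\<in>T. \<forall>ws\<in>T. vs \<noteq> ws \<longrightarrow> closure (cell vs) \<inter> closure (cell ws)
      \<subseteq> (set vs \<inter> set ws) \<union> (\<Union>e\<in>poly_edges vs \<inter> poly_edges ws. convex hull e)"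
    using mesh unfolding conforming_mesh_def by simp
  then have "z \<in> (set vs \<inter> set ws) \<union> (\<Union>e\<in>poly_edges vs \<inter> poly_edges ws. convex hull e)"
    using assms by blast
  then show thesis using that by blast
qed

lemma finite_mesh_vertices: "finite (mesh_vertices T)"
  using finite_mesh by (simp add: mesh_vertices_def)

lemma finite_mesh_edges: "finite (mesh_edges T)"
  using finite_mesh by (simp add: mesh_edges_def finite_poly_edges)

lemma finite_nodes: "finite (nodes \<Omega> T)"
  using finite_mesh_vertices by (simp add: nodes_def)

section \<open>How mesh edges and vertices meet\<close>

lemma edge_closure_cell:
  assumes "vs \<in> T" "e \<in> poly_edges vs" shows "convex hull e \<subseteq> closure (cell vs)"
  using poly_boundary_subset_closure_cell[OF mesh_simple[OF assms(1)]] assms(2)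
  unfolding poly_boundary_def by blast

lemma vertex_closure_cell: "vs \<in> T \<Longrightarrow> x \<in> set vs \<Longrightarrow> x \<in> closure (cell vs)"
  using poly_boundary_subset_closure_cell set_subset_poly_boundary mesh_simple by blast

lemma same_cell_edges:
  assumes "vs \<in> T" "e \<in> poly_edges vs" "e' \<in> poly_edges vs" "e \<noteq> e'" "z \<in> convex hull e" "z \<in> convex hull e'"
  shows "z \<in> e" "z \<in> e'"
proof -
  have "convex hull e \<inter> convex hull e' \<subseteq> e \<inter> e'"
    using mesh_simple[OF assms(1)] assms unfolding simple_polygon_def by blast
  then show "z \<in> e" "z \<in> e'" using assms by blast+
qed

lemma mesh_edge_pair:
  assumes "e \<in> mesh_edges T"
  obtains a b where "e = {a, b}" "a \<noteq> b" "a \<in> mesh_vertices T" "b \<in> mesh_vertices T"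
proof -
  obtain vs where vs: "vs \<in> T" "e \<in> poly_edges vs"
    using assms by (auto simp: mesh_edges_def)
  obtain a b where "e = {a, b}" "a \<noteq> b" "a \<in> set vs" "b \<in> set vs"
    by (rule poly_edges_distinct_pair[OF mesh_simple[OF vs(1)] vs(2)])
  then show thesis using that vs(1) by (auto simp: mesh_vertices_def)
qed

lemma closed_mesh_edge: "e \<in> mesh_edges T \<Longrightarrow> closed (convex hull e)"
  by (metis compact_imp_closed finite_imp_compact_convex_hull finite.emptyI finite_insert mesh_edge_pair)

lemma own_vertex_in_edge:
  assumes "vs \<in> T" "e \<in> poly_edges vs" "x \<in> set vs" "x \<in> convex hull e"
  shows "x \<in> e"
proof -
  obtain k where k: "k < length vs" "x = vs ! k" using assms(3) by (auto simp: in_set_conv_nth)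
  let ?e = "{vs ! k, vs ! (Suc k mod length vs)}"
  have e: "?e \<in> poly_edges vs" "x \<in> ?e" using k by (auto simp: poly_edges_def)
  show ?thesis
  proof (cases "e = ?e")
    case False
    then show ?thesis
      using same_cell_edges(1)[OF assms(1,2) e(1) False assms(4)] e(2) hull_inc[of x ?e convex] by simp
  qed (use e in simp)
qed

text \<open>There are no hanging nodes. A vertex of \<open>ws\<close> in the closed cell of
  \<open>vs\<close> is a common vertex or lies on a common edge; in the latter case it is an
  endpoint of that edge, as \<open>ws\<close> is simple, and so again a vertex of
  \<open>vs\<close>.\<close>

lemma vertex_in_edge:
  assumes "e \<in> mesh_edges T" "x \<in> mesh_vertices T" "x \<in> convex hull e"
  shows "x \<in> e"
proof -
  obtain vs where vs: "vs \<in> T" "e \<in> poly_edges vs" using assms(1) by (auto simp: mesh_edges_def)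
  obtain ws where ws: "ws \<in> T" "x \<in> set ws" using assms(2) by (auto simp: mesh_vertices_def)
  show ?thesis
  proof (cases "vs = ws")
    case True
    then show ?thesis using own_vertex_in_edge vs ws assms(3) by blast
  next
    case False
    have "x \<in> closure (cell vs)" using edge_closure_cell vs assms(3) by blast
    moreover have "x \<in> closure (cell ws)" using vertex_closure_cell ws by blast
    ultimately have "x \<in> set vs"
    proof (rule mesh_conforming[OF vs(1) ws(1) False])
      fix e' assume e': "e' \<in> poly_edges vs" "e' \<in> poly_edges ws" "x \<in> convex hull e'"
      then show "x \<in> set vs"
        using own_vertex_in_edge[OF ws(1) e'(2) ws(2) e'(3)] poly_edges_subset_set by blast
    qed
    then show ?thesis using own_vertex_in_edge vs assms(3) by blast
  qed
qed

text \<open>For edges of different cells, conformity gives a common vertex or a common edge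
  \<open>d\<close> through \<open>z\<close>. Since \<open>d\<close> differs from \<open>e\<close> or
  from \<open>e'\<close>, the polygon containing both of the distinct edges forces \<open>z\<close>
  to be an endpoint.\<close>

lemma edges_meet_in_vertices:
  assumes "e \<in> mesh_edges T" "e' \<in> mesh_edges T" "e \<noteq> e'" "z \<in> convex hull e" "z \<in> convex hull e'"
  shows "z \<in> mesh_vertices T"
proof -
  obtain vs where vs: "vs \<in> T" "e \<in> poly_edges vs" using assms(1) by (auto simp: mesh_edges_def)
  obtain ws where ws: "ws \<in> T" "e' \<in> poly_edges ws" using assms(2) by (auto simp: mesh_edges_def)
  have vert: "z \<in> mesh_vertices T" if "us \<in> T" "d \<in> poly_edges us" "z \<in> d" for us d
    using that poly_edges_subset_set by (force simp: mesh_vertices_def)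
  show ?thesis
  proof (cases "vs = ws")
    case True
    then show ?thesis using same_cell_edges(1)[OF vs _ assms(3-5)] ws vert[OF vs] by simp
  next
    case False
    have "z \<in> closure (cell vs)" "z \<in> closure (cell ws)"
      using edge_closure_cell vs ws assms by blast+
    then show ?thesis
    proof (rule mesh_conforming[OF vs(1) ws(1) False])
      assume "z \<in> set vs"
      then show ?thesis using vs by (auto simp: mesh_vertices_def)
    next
      fix d assume d: "d \<in> poly_edges vs" "d \<in> poly_edges ws" "z \<in> convex hull d"
      show ?thesis
      proof (cases "d = e")
        case True
        then show ?thesis using same_cell_edges(1)[OF ws(1) _ ws(2) assms(3-5)] d vert[OF vs] by simp
      next
        case False
        then show ?thesis using same_cell_edges(2)[OF vs(1) d(1) vs(2) False d(3) assms(4)] vert[OF vs] by simp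
      qed
    qed
  qed
qed

section \<open>Subdomains, their cells and their interfaces\<close>

lemma cell_meets_sub:
  assumes "i \<in> {1..I}" "vs \<in> T" "z \<in> \<Omega>s i" "z \<in> closure (cell vs)"
  shows "cell vs \<subseteq> \<Omega>s i"
proof -
  obtain j where j: "j \<in> {1..I}" "cell vs \<subseteq> \<Omega>s j" by (rule cell_in_sub[OF assms(2)])
  have "\<Omega>s i \<inter> cell vs \<noteq> {}"
    using assms open_Int_closure_eq_empty[OF open_sub[OF assms(1)], of "cell vs"] by blast
  then have "j = i" using sub_disjoint[OF j(1) assms(1)] j(2) by blast
  then show ?thesis using j by simp
qed

text \<open>The cells inside a subdomain are finitely many and their closures cover it, hence also
  its closure. A frontier point is thereby traced to a cell on the given side.\<close>

lemma sub_closure_cells: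
  assumes "i \<in> {1..I}" "z \<in> closure (\<Omega>s i)"
  obtains vs where "vs \<in> T" "cell vs \<subseteq> \<Omega>s i" "z \<in> closure (cell vs)"
proof -
  let ?U = "\<Union>vs\<in>{vs\<in>T. cell vs \<subseteq> \<Omega>s i}. closure (cell vs)"
  have "\<Omega>s i \<subseteq> ?U"
  proof
    fix w assume w: "w \<in> \<Omega>s i"
    then have "w \<in> closure \<Omega>" using sub_subset[OF assms(1)] closure_subset by blast
    then obtain vs where "vs \<in> T" "w \<in> closure (cell vs)" using domain_cells by blast
    then show "w \<in> ?U" using cell_meets_sub[OF assms(1) _ w] by blast
  qed
  moreover have "closed ?U" using finite_mesh by (intro closed_UN) auto
  ultimately have "closure (\<Omega>s i) \<subseteq> ?U" by (rule closure_minimal)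
  then show thesis using that assms by blast
qed

lemma frontier_sub_edge:
  assumes "i \<in> {1..I}" "z \<in> frontier (\<Omega>s i)"
  obtains e where "e \<in> mesh_edges T" "z \<in> convex hull e"
proof -
  have z: "z \<in> closure (\<Omega>s i)" "z \<notin> \<Omega>s i"
    using assms open_sub by (auto simp: frontier_def interior_open)
  obtain vs where vs: "vs \<in> T" "cell vs \<subseteq> \<Omega>s i" "z \<in> closure (cell vs)"
    by (rule sub_closure_cells[OF assms(1) z(1)])
  then have "z \<in> frontier (cell vs)" using z open_cell by (auto simp: frontier_def interior_open)
  then have "z \<in> poly_boundary vs" using frontier_cell_subset by blast
  then show thesis using that vs(1) unfolding poly_boundary_def mesh_edges_def by blast
qed

text \<open>Cells taken on the two sides are distinct, so conformity puts the non-vertex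
  \<open>z\<close> on a common edge. This edge lies in both closures, and disjointness of the open
  subdomains confines it to both frontiers.\<close>

lemma interface_edge:
  assumes "i \<in> {1..I}" "j \<in> {1..I}" "i \<noteq> j" "z \<in> closure (\<Omega>s i)" "z \<in> closure (\<Omega>s j)"
    and "z \<notin> mesh_vertices T"
  obtains e where "e \<in> mesh_edges T" "z \<in> convex hull e"
    "convex hull e \<subseteq> frontier (\<Omega>s i)" "convex hull e \<subseteq> frontier (\<Omega>s j)"
proof -
  obtain vs where vs: "vs \<in> T" "cell vs \<subseteq> \<Omega>s i" "z \<in> closure (cell vs)"
    by (rule sub_closure_cells[OF assms(1,4)])
  obtain ws where ws: "ws \<in> T" "cell ws \<subseteq> \<Omega>s j" "z \<in> closure (cell ws)"
    by (rule sub_closure_cells[OF assms(2,5)])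
  have "vs \<noteq> ws"
    using sub_disjoint[OF assms(1-3)] vs ws cell_nonempty[OF mesh_simple[OF vs(1)]] by blast
  from vs(1) ws(1) this vs(3) ws(3) show thesis
  proof (rule mesh_conforming)
    assume "z \<in> set vs"
    then show thesis using assms(6) vs(1) by (auto simp: mesh_vertices_def)
  next
    fix e assume e: "e \<in> poly_edges vs" "e \<in> poly_edges ws" "z \<in> convex hull e"
    have "convex hull e \<subseteq> closure (\<Omega>s i)"
      using edge_closure_cell[OF vs(1) e(1)] closure_mono[OF vs(2)] by blast
    moreover have "convex hull e \<subseteq> closure (\<Omega>s j)"
      using edge_closure_cell[OF ws(1) e(2)] closure_mono[OF ws(2)] by blast
    moreover have "\<Omega>s i \<inter> closure (\<Omega>s j) = {}" "\<Omega>s j \<inter> closure (\<Omega>s i) = {}"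
      using sub_closure_disjoint assms(1-3) by auto
    ultimately have "convex hull e \<subseteq> frontier (\<Omega>s i)" "convex hull e \<subseteq> frontier (\<Omega>s j)"
      using open_sub assms(1,2) unfolding frontier_def by (auto simp: interior_open)
    then show thesis using that[of e] e vs(1) by (auto simp: mesh_edges_def)
  qed
qed

text \<open>Otherwise a neighbourhood of \<open>z\<close> would lie in the closure of
  \<open>\<Omega>s i\<close>, and \<open>z\<close> in the interior of this closure, which is
  \<open>\<Omega>s i\<close>. Regularity of the subdomain rules out slits with the same subdomain on
  both sides.\<close>

lemma frontier_sub_other:
  assumes i: "i \<in> {1..I}" and z: "z \<in> \<Omega>" "z \<in> frontier (\<Omega>s i)"
  obtains j where "j \<in> {1..I}" "j \<noteq> i" "z \<in> closure (\<Omega>s j)"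
proof (rule ccontr)
  assume neg: "\<not> thesis"
  let ?C = "\<Union>j\<in>{1..I} - {i}. closure (\<Omega>s j)"
  have "z \<notin> ?C" using neg that by blast
  moreover have "closed ?C" by (intro closed_UN) auto
  moreover have "\<Omega> - ?C \<subseteq> closure (\<Omega>s i)" using domain_covered by blast
  ultimately have "z \<in> interior (closure (\<Omega>s i))"
    using z(1) open_domain by (intro interiorI[of "\<Omega> - ?C"]) auto
  then have "z \<in> \<Omega>s i" using sub_regular[OF i] by simp
  then show False using z(2) open_sub[OF i] by (simp add: frontier_def interior_open)
qed

lemma nodes_subset: "x \<in> nodes \<Omega> T \<Longrightarrow> x \<in> \<Omega>"
proof -
  assume "x \<in> nodes \<Omega> T"
  then obtain vs where "vs \<in> T" "x \<in> set vs" "x \<notin> frontier \<Omega>"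
    by (auto simp: nodes_def mesh_vertices_def)
  then have "x \<in> closure \<Omega>" using vertex_closure_cell domain_cells by blast
  then show ?thesis using \<open>x \<notin> frontier \<Omega>\<close> open_domain by (simp add: frontier_def interior_open)
qed

lemma node_vertex: "x \<in> nodes \<Omega> T \<Longrightarrow> x \<in> mesh_vertices T"
  by (simp add: nodes_def)

section \<open>Boundary edges at an interior node\<close>

lemma boundary_nbrs_iff:
  "y \<in> boundary_nbrs T S x \<longleftrightarrow> {x, y} \<in> mesh_edges T \<and> convex hull {x, y} \<subseteq> frontier S"
  by (simp add: boundary_nbrs_def segment_convex_hull)

lemma mesh_edge_vertices: "e \<in> mesh_edges T \<Longrightarrow> e \<subseteq> mesh_vertices T"
  by (elim mesh_edge_pair) simp

lemma mesh_edge_neq: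
  assumes "{x, y} \<in> mesh_edges T" shows "x \<noteq> y"
proof -
  obtain a b where "{x, y} = {a, b}" "a \<noteq> b" by (rule mesh_edge_pair[OF assms])
  then show ?thesis by (auto simp: doubleton_eq_iff)
qed

lemma finite_boundary_nbrs: "finite (boundary_nbrs T S x)"
  by (rule finite_subset[OF _ finite_mesh_vertices])
     (use mesh_edge_vertices in \<open>auto simp: boundary_nbrs_def\<close>)

lemma boundary_nbr_neq: "y \<in> boundary_nbrs T S x \<Longrightarrow> x \<noteq> y"
  using mesh_edge_neq by (simp add: boundary_nbrs_def)

text \<open>The far end \<open>y\<close> may lie on the boundary of the domain, but close to the
  node \<open>x\<close> the edge runs inside it. Avoiding vertices makes the local picture at
  \<open>z\<close> that of a single edge.\<close>

lemma interior_edge_point: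
  assumes "x \<in> nodes \<Omega> T" "{x, y} \<in> mesh_edges T"
  obtains z where "z \<in> \<Omega>" "z \<in> convex hull {x, y}" "z \<notin> mesh_vertices T"
proof -
  have xy: "x \<noteq> y" using assms(2) by (rule mesh_edge_neq)
  obtain r where r: "r > 0" "ball x r \<subseteq> \<Omega>"
    using nodes_subset[OF assms(1)] open_domain openE by blast
  \<comment> \<open>The bound 1/2 keeps the point away from \<open>y\<close>; the other bound puts
    it within \<open>r / 2\<close> of \<open>x\<close>.\<close>
  define t where "t = min (1/2) (r / (2 * dist x y))"
  have t: "0 < t" "t < 1" "t * dist x y < r"
    using r xy by (auto simp: t_def min_mult_distrib_right min_def field_simps)
  define z where "z = (1 - t) *\<^sub>R x + t *\<^sub>R y"
  have "z \<in> open_segment x y" using t xy by (auto simp: z_def in_segment)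
  then have zs: "z \<in> convex hull {x, y}" "z \<notin> {x, y}"
    by (auto simp: open_segment_def segment_convex_hull)
  have "dist x z = t * dist x y"
  proof -
    have "x - z = t *\<^sub>R (x - y)" by (simp add: z_def algebra_simps)
    then show ?thesis using t by (simp add: dist_norm)
  qed
  then have "z \<in> \<Omega>" using t r by auto
  moreover have "z \<notin> mesh_vertices T" using vertex_in_edge[OF assms(2) _ zs(1)] zs(2) by blast
  ultimately show thesis using that zs by blast
qed

text \<open>At a non-vertex point of the edge inside \<open>\<Omega>\<close> some other subdomain is
  adherent, and the two share an edge through that point. It must be the given edge, because
  distinct edges meet only in vertices.\<close>

lemma boundary_edge_shared:
  assumes i: "i \<in> {1..I}" and x: "x \<in> nodes \<Omega> T" and y: "y \<in> boundary_nbrs T (\<Omega>s i) x"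
  obtains j where "j \<in> {1..I}" "j \<noteq> i" "y \<in> boundary_nbrs T (\<Omega>s j) x"
proof -
  have e: "{x, y} \<in> mesh_edges T" "convex hull {x, y} \<subseteq> frontier (\<Omega>s i)"
    using y by (auto simp: boundary_nbrs_iff)
  obtain z where z: "z \<in> \<Omega>" "z \<in> convex hull {x, y}" "z \<notin> mesh_vertices T"
    by (rule interior_edge_point[OF x e(1)])
  have zf: "z \<in> frontier (\<Omega>s i)" using z e by blast
  obtain j where j: "j \<in> {1..I}" "j \<noteq> i" "z \<in> closure (\<Omega>s j)"
    by (rule frontier_sub_other[OF i z(1) zf])
  have zc: "z \<in> closure (\<Omega>s i)" using zf by (simp add: frontier_def)
  obtain e' where e': "e' \<in> mesh_edges T" "z \<in> convex hull e'" "convex hull e' \<subseteq> frontier (\<Omega>s j)"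
    by (rule interface_edge[OF i j(1) j(2)[symmetric] zc j(3) z(3)])
  have "e' = {x, y}" using edges_meet_in_vertices[OF e'(1) e(1) _ e'(2) z(2)] z(3) by blast
  then show thesis using that[OF j(1,2)] e' by (simp add: boundary_nbrs_iff)
qed

text \<open>Near an inner point of the edge, the plane minus the edge consists of two half discs, each of
  which lies in a single subdomain.\<close>

lemma boundary_edge_shared_unique:
  assumes x: "x \<in> nodes \<Omega> T" and m: "\<And>m. m \<in> M \<Longrightarrow> m \<in> {1..I} \<and> y \<in> boundary_nbrs T (\<Omega>s m) x"
  shows "card M \<le> 2"
proof (cases "M = {}")
  case False
  then have e: "{x, y} \<in> mesh_edges T" using m by (auto simp: boundary_nbrs_iff)
  obtain z where z: "z \<in> \<Omega>" "z \<in> convex hull {x, y}" "z \<notin> mesh_vertices T"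
    by (rule interior_edge_point[OF x e])
  \<comment> \<open>A ball that avoids all other edges contains no frontier point of a subdomain off
    the line that carries the given edge.\<close>
  let ?C = "\<Union>e'\<in>mesh_edges T - {{x, y}}. convex hull e'"
  have "closed ?C" using finite_mesh_edges closed_mesh_edge by (intro closed_UN) auto
  moreover have "z \<notin> ?C" using edges_meet_in_vertices[OF e _ _ z(2)] z(3) by blast
  ultimately obtain r where r: "r > 0" "ball z r \<subseteq> - ?C"
    by (metis ComplI open_Compl openE)
  obtain n c where n: "n \<noteq> 0" "convex hull {x, y} \<subseteq> {p. n \<bullet> p = c}"
    by (metis closed_segment_in_line segment_convex_hull)
  define H where "H b = (if b then ball z r \<inter> {p. n \<bullet> p > c} else ball z r \<inter> {p. n \<bullet> p < c})" for b
  have half: "\<exists>b. H b \<subseteq> \<Omega>s m \<and> H b \<noteq> {}" if mM: "m \<in> M" for m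
  proof -
    have mI: "m \<in> {1..I}" using m[OF mM] by blast
    have "z \<in> closure (\<Omega>s m)" using m[OF mM] z(2) by (auto simp: boundary_nbrs_iff frontier_def)
    then have ne: "ball z r \<inter> \<Omega>s m \<noteq> {}"
      using centre_in_ball[of z r] r(1) open_Int_closure_eq_empty[of "ball z r" "\<Omega>s m"] by blast
    have op: "open (ball z r \<inter> \<Omega>s m)" using open_sub[OF mI] by auto
    \<comment> \<open>A nonempty open set does not fit into a line, so \<open>\<Omega>s m\<close>
      has a point in one of the half discs.\<close>
    have "\<not> ball z r \<inter> \<Omega>s m \<subseteq> {p. n \<bullet> p = c}"
    proof
      assume "ball z r \<inter> \<Omega>s m \<subseteq> {p. n \<bullet> p = c}"
      then have "ball z r \<inter> \<Omega>s m \<subseteq> interior {p. n \<bullet> p = c}" using op by (rule interior_maximal)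
      then show False using n(1) ne by simp
    qed
    then obtain q where "q \<in> ball z r" "q \<in> \<Omega>s m" "n \<bullet> q \<noteq> c" by blast
    then have "q \<in> H (n \<bullet> q > c)" "q \<in> \<Omega>s m" by (auto simp: H_def)
    then obtain b where b: "q \<in> H b" by blast
    have "connected (H b)"
      unfolding H_def by (auto intro!: convex_connected convex_Int convex_halfspace_gt convex_halfspace_lt)
    moreover have "H b \<inter> frontier (\<Omega>s m) = {}"
    proof (rule ccontr)
      assume "H b \<inter> frontier (\<Omega>s m) \<noteq> {}"
      then obtain p where p: "p \<in> H b" "p \<in> frontier (\<Omega>s m)" by blast
      obtain e' where e': "e' \<in> mesh_edges T" "p \<in> convex hull e'"
        by (rule frontier_sub_edge[OF mI p(2)])
      have "p \<in> ball z r" "n \<bullet> p \<noteq> c" using p(1) by (auto simp: H_def split: if_splits)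
      then have "e' = {x, y}" using r(2) e' by blast
      then show False using e'(2) n(2) \<open>n \<bullet> p \<noteq> c\<close> by blast
    qed
    ultimately have "H b \<subseteq> \<Omega>s m"
      using connected_Int_frontier[of "H b" "\<Omega>s m"] b \<open>q \<in> \<Omega>s m\<close> by blast
    then show ?thesis using b by blast
  qed
  then obtain b where b: "\<And>m. m \<in> M \<Longrightarrow> H (b m) \<subseteq> \<Omega>s m \<and> H (b m) \<noteq> {}" by metis
  \<comment> \<open>Two subdomains containing the same nonempty half disc would overlap; hence there
    are no more of them than sides.\<close>
  have "inj_on b M"
  proof (rule inj_onI, rule ccontr)
    fix k l assume kl: "k \<in> M" "l \<in> M" "b k = b l" "k \<noteq> l"
    then have "\<Omega>s k \<inter> \<Omega>s l = {}" using m sub_disjoint by blast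
    then show False using b[OF kl(1)] b[OF kl(2)] kl(3) by auto
  qed
  then have "card M \<le> card (UNIV :: bool set)" by (intro card_inj_on_le) auto
  then show ?thesis by simp
qed simp

section \<open>The graph of coupled subdomains at a node\<close>

text \<open>The pairs that exchange Robin data at \<open>x\<close>. The relation is empty unless
  \<open>x\<close> is a node, so that facts about coupled pairs carry no side condition on
  \<open>x\<close>.\<close>

definition coupled :: "real^2 \<Rightarrow> (nat \<times> nat) set" where
  "coupled x = {(i, j). i \<in> {1..I} \<and> j \<in> {1..I} \<and> i \<noteq> j \<and> x \<in> nodes \<Omega> T \<and>
     shared_nbrs T (\<Omega>s i) (\<Omega>s j) x \<noteq> {}}"

text \<open>Every boundary edge at \<open>x\<close> is shared with some other subdomain, which gives
  the cover, and with at most one, which makes the shared sets disjoint. For lengths, this equates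
  the weight in \<open>B_lump\<close> with the sum of the weights in the update.\<close>

lemma boundary_nbrs_sum:
  assumes i: "i \<in> {1..I}" and x: "x \<in> nodes \<Omega> T"
  shows "(\<Sum>y\<in>boundary_nbrs T (\<Omega>s i) x. g y) =
    (\<Sum>j\<in>{j. (i, j) \<in> coupled x}. \<Sum>y\<in>shared_nbrs T (\<Omega>s i) (\<Omega>s j) x. (g y :: real))"
proof -
  have "boundary_nbrs T (\<Omega>s i) x = (\<Union>j\<in>{j. (i, j) \<in> coupled x}. shared_nbrs T (\<Omega>s i) (\<Omega>s j) x)"
  proof (intro equalityI subsetI)
    fix y assume y: "y \<in> boundary_nbrs T (\<Omega>s i) x"
    obtain j where "j \<in> {1..I}" "j \<noteq> i" "y \<in> boundary_nbrs T (\<Omega>s j) x"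
      by (rule boundary_edge_shared[OF i x y])
    then show "y \<in> (\<Union>j\<in>{j. (i, j) \<in> coupled x}. shared_nbrs T (\<Omega>s i) (\<Omega>s j) x)"
      using i x y by (auto simp: coupled_def shared_nbrs_def intro!: exI[of _ j])
  qed (auto simp: shared_nbrs_def)
  moreover have "shared_nbrs T (\<Omega>s i) (\<Omega>s j) x \<inter> shared_nbrs T (\<Omega>s i) (\<Omega>s k) x = {}"
    if "(i, j) \<in> coupled x" "(i, k) \<in> coupled x" "j \<noteq> k" for j k
  proof (rule ccontr)
    assume "shared_nbrs T (\<Omega>s i) (\<Omega>s j) x \<inter> shared_nbrs T (\<Omega>s i) (\<Omega>s k) x \<noteq> {}"
    then obtain y where "y \<in> boundary_nbrs T (\<Omega>s i) x" "y \<in> boundary_nbrs T (\<Omega>s j) x" "y \<in> boundary_nbrs T (\<Omega>s k) x"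
      by (auto simp: shared_nbrs_def)
    then have "card {i, j, k} \<le> 2"
      using that by (intro boundary_edge_shared_unique[OF x, of _ y]) (auto simp: coupled_def)
    then show False using that by (auto simp: coupled_def)
  qed
  moreover have "finite {j. (i, j) \<in> coupled x}"
    by (rule finite_subset[of _ "{1..I}"]) (auto simp: coupled_def)
  ultimately show ?thesis
    by (simp only:) (intro sum.UNION_disjoint, auto simp: shared_nbrs_def finite_boundary_nbrs)
qed

text \<open>A partition of the subdomains at \<open>x\<close> into two uncoupled classes would disconnect a punctured
  disc around \<open>x\<close>.\<close>

lemma coupled_connected:
  assumes x: "x \<in> nodes \<Omega> T"
    and i: "i \<in> {1..I}" "x \<in> closure (\<Omega>s i)" and j: "j \<in> {1..I}" "x \<in> closure (\<Omega>s j)"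
  shows "(i, j) \<in> (coupled x)\<^sup>*"
proof (rule ccontr)
  assume nij: "(i, j) \<notin> (coupled x)\<^sup>*"
  define V where "V = {i \<in> {1..I}. x \<in> closure (\<Omega>s i)}"
  define C where "C = {k \<in> V. (i, k) \<in> (coupled x)\<^sup>*}"
  have fin: "finite V" "finite C" by (auto simp: V_def C_def)
  \<comment> \<open>Everything to be kept away from \<open>x\<close>: foreign subdomains, other
    vertices, edges not through \<open>x\<close>, and the outside of the domain. A mesh edge that
    still meets the disc has \<open>x\<close> as an endpoint, by
    \<open>vertex_in_edge\<close>.\<close>
  define F where "F = (\<Union>k\<in>{1..I} - V. closure (\<Omega>s k)) \<union> (mesh_vertices T - {x}) \<union>
     (\<Union>e\<in>{e \<in> mesh_edges T. x \<notin> convex hull e}. convex hull e) \<union> - \<Omega>"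
  have "closed F"
    unfolding F_def using finite_mesh_edges closed_mesh_edge finite_mesh_vertices open_domain
    by (intro closed_Un closed_UN closed_Compl) (auto intro: finite_imp_closed)
  moreover have "x \<notin> F" using nodes_subset[OF x] by (auto simp: F_def V_def)
  ultimately obtain r where r: "r > 0" "ball x r \<subseteq> - F"
    by (metis ComplI open_Compl openE)
  let ?B = "ball x r - {x}"
  let ?U = "\<Union>k\<in>C. closure (\<Omega>s k)" and ?W = "\<Union>k\<in>V - C. closure (\<Omega>s k)"
  have "connected ?B" by (rule connected_punctured_ball) simp
  moreover have "closed ?U" "closed ?W" using fin by (auto intro!: closed_UN)
  moreover have "?B \<subseteq> ?U \<union> ?W"
  proof
    fix z assume z: "z \<in> ?B"
    then have zF: "z \<notin> F" using r(2) by blast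
    then obtain k where "k \<in> {1..I}" "z \<in> closure (\<Omega>s k)"
      using domain_covered unfolding F_def by blast
    then show "z \<in> ?U \<union> ?W" using zF unfolding F_def by blast
  qed
  \<comment> \<open>A common point lies on an edge at \<open>x\<close> shared by a subdomain
    reachable from \<open>i\<close> and an unreachable one, which would couple the two.\<close>
  moreover have "?U \<inter> ?W \<inter> ?B = {}"
  proof (rule ccontr)
    assume "?U \<inter> ?W \<inter> ?B \<noteq> {}"
    then obtain z k l where z: "z \<in> ?B" "k \<in> C" "z \<in> closure (\<Omega>s k)" "l \<in> V - C" "z \<in> closure (\<Omega>s l)" by blast
    have zF: "z \<notin> F" "z \<noteq> x" using z(1) r(2) by auto
    have kl: "k \<in> {1..I}" "l \<in> {1..I}" "k \<noteq> l" using z by (auto simp: C_def V_def)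
    have "z \<notin> mesh_vertices T" using zF unfolding F_def by blast
    then obtain e where e: "e \<in> mesh_edges T" "z \<in> convex hull e"
      "convex hull e \<subseteq> frontier (\<Omega>s k)" "convex hull e \<subseteq> frontier (\<Omega>s l)"
      using interface_edge[OF kl z(3,5)] by blast
    have "x \<in> convex hull e" using zF(1) e unfolding F_def by blast
    then have "x \<in> e" using vertex_in_edge[OF e(1) node_vertex[OF x]] by blast
    then obtain y where "e = {x, y}" using mesh_edge_pair[OF e(1)] by (metis insert_commute insertE singletonD)
    then have "y \<in> shared_nbrs T (\<Omega>s k) (\<Omega>s l) x"
      using e by (simp add: shared_nbrs_def boundary_nbrs_iff)
    then have "(k, l) \<in> coupled x" using kl x by (auto simp: coupled_def)
    then have "l \<in> C" using z(2,4) unfolding C_def by (auto intro: rtrancl_into_rtrancl)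
    then show False using z(4) by blast
  qed
  ultimately have "?U \<inter> ?B = {} \<or> ?W \<inter> ?B = {}"
    using connected_closedD[of ?B ?U ?W] by blast
  \<comment> \<open>Puncturing at \<open>x\<close> does not empty the intersection, because no
    singleton is open.\<close>
  moreover have "closure (\<Omega>s k) \<inter> ?B \<noteq> {}" if "k \<in> V" for k
  proof -
    have k: "k \<in> {1..I}" "x \<in> closure (\<Omega>s k)" using that by (auto simp: V_def)
    have "ball x r \<inter> \<Omega>s k \<noteq> {}"
      using k(2) centre_in_ball[of x r] r(1) open_Int_closure_eq_empty[of "ball x r" "\<Omega>s k"] by blast
    moreover have "open (ball x r \<inter> \<Omega>s k)" using open_sub[OF k(1)] by auto
    ultimately have "ball x r \<inter> \<Omega>s k \<noteq> {x}" using not_open_singleton by metis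
    then show ?thesis using \<open>ball x r \<inter> \<Omega>s k \<noteq> {}\<close> closure_subset[of "\<Omega>s k"] by blast
  qed
  moreover have "i \<in> C" "j \<in> V - C" using i j nij by (auto simp: C_def V_def)
  ultimately show False using C_def by blast
qed

lemma coupled_subset: "coupled x \<subseteq> {1..I} \<times> {1..I}"
  and coupled_irrefl: "irrefl (coupled x)"
  and coupled_sym: "sym (coupled x)"
  by (auto simp: coupled_def irrefl_def sym_def shared_nbrs_def Int_commute)

lemma coupled_local_node: "(i, j) \<in> coupled x \<Longrightarrow> x \<in> local_nodes \<Omega> T (\<Omega>s i)"
  by (auto simp: coupled_def local_nodes_def shared_nbrs_def boundary_nbrs_def frontier_def)

lemma shared_length_pos:
  assumes "(i, j) \<in> coupled x"
  shows "(\<Sum>y\<in>shared_nbrs T (\<Omega>s i) (\<Omega>s j) x. dist x y) > 0"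
proof (rule sum_pos)
  show "finite (shared_nbrs T (\<Omega>s i) (\<Omega>s j) x)"
    unfolding shared_nbrs_def by (intro finite_Int disjI1 finite_boundary_nbrs)
  show "shared_nbrs T (\<Omega>s i) (\<Omega>s j) x \<noteq> {}" using assms by (simp add: coupled_def)
  show "0 < dist x y" if "y \<in> shared_nbrs T (\<Omega>s i) (\<Omega>s j) x" for y
    using that boundary_nbr_neq[of y "\<Omega>s i" x] by (simp add: shared_nbrs_def)
qed

lemma negligible_skeleton: "negligible (\<Omega> - (\<Union>i\<in>{1..I}. \<Omega>s i))"
proof (rule negligible_subset)
  have "negligible (convex hull e)" if e: "e \<in> mesh_edges T" for e
  proof -
    obtain a b where "e = {a, b}" by (rule mesh_edge_pair[OF e])
    then show ?thesis using negligible_closed_segment_plane[of a b] by (simp add: segment_convex_hull)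
  qed
  then show "negligible (\<Union>e\<in>mesh_edges T. convex hull e)"
    using finite_mesh_edges by (intro negligible_Union) auto
  show "\<Omega> - (\<Union>i\<in>{1..I}. \<Omega>s i) \<subseteq> (\<Union>e\<in>mesh_edges T. convex hull e)"
  proof
    fix z assume z: "z \<in> \<Omega> - (\<Union>i\<in>{1..I}. \<Omega>s i)"
    then obtain i where i: "i \<in> {1..I}" "z \<in> closure (\<Omega>s i)" using domain_covered by blast
    then have "z \<in> frontier (\<Omega>s i)" using z open_sub by (auto simp: frontier_def interior_open)
    then show "z \<in> (\<Union>e\<in>mesh_edges T. convex hull e)" using frontier_sub_edge[OF i(1)] by blast
  qed
qed

lemma cell_vertex_closure_sub:
  assumes "i \<in> {1..I}" "z \<in> \<Omega>s i" "vs \<in> T" "x \<in> set vs" "z \<in> closure (cell vs)"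
  shows "x \<in> closure (\<Omega>s i)"
  using cell_meets_sub[OF assms(1,3,2,5)] vertex_closure_cell[OF assms(3,4)] closure_mono by blast

end

section \<open>Convergence of the Schwarz method\<close>

locale fe_decomposition = decomposed_mesh +
  fixes P :: "(real^2 \<Rightarrow> real) set"
  assumes bounded_domain: "bounded \<Omega>"
    and fe_space: "nodal_fe_space \<Omega> T P"
begin

abbreviation "N i \<equiv> local_nodes \<Omega> T (\<Omega>s i)"
abbreviation "\<phi> \<equiv> hat \<Omega> T P"
abbreviation "shared_length i j x \<equiv> \<Sum>y\<in>shared_nbrs T (\<Omega>s i) (\<Omega>s j) x. dist x y"

lemma sub_bounded: "i \<in> {1..I} \<Longrightarrow> bounded (\<Omega>s i)"
  using bounded_subset[OF bounded_domain sub_subset] .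

lemma fe_zero: "(\<lambda>x. 0) \<in> P"
  and fe_add: "v \<in> P \<Longrightarrow> w \<in> P \<Longrightarrow> (\<lambda>x. v x + w x) \<in> P"
  and fe_scale: "v \<in> P \<Longrightarrow> (\<lambda>x. c * v x) \<in> P"
  and fe_H10: "P \<subseteq> H10 \<Omega>"
  and fe_continuous: "v \<in> P \<Longrightarrow> continuous_on UNIV v"
  and fe_interpolation: "\<exists>!v. v \<in> P \<and> (\<forall>x\<in>nodes \<Omega> T. v x = d x)"
  and fe_support: "x \<in> nodes \<Omega> T \<Longrightarrow> \<phi> x z \<noteq> 0 \<Longrightarrow> \<exists>vs\<in>T. x \<in> set vs \<and> z \<in> closure (cell vs)"
  using fe_space unfolding nodal_fe_space_def by simp_all

lemma fe_H1: "v \<in> P \<Longrightarrow> v \<in> H1 \<Omega>"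
  using fe_H10 by (auto simp: H10_def)

lemma fe_H1_sub: "i \<in> {1..I} \<Longrightarrow> v \<in> P \<Longrightarrow> v \<in> H1 (\<Omega>s i)"
  by (rule H1_subset[OF open_domain open_sub sub_bounded sub_subset fe_H1])

lemma fe_sum: "finite A \<Longrightarrow> (\<And>a. a \<in> A \<Longrightarrow> v a \<in> P) \<Longrightarrow> (\<lambda>z. \<Sum>a\<in>A. c a * v a z) \<in> P"
proof (induction A rule: finite_induct)
  case (insert a A)
  then have "(\<lambda>z. c a * v a z + (\<Sum>a\<in>A. c a * v a z)) \<in> P"
    by (intro fe_add fe_scale) auto
  then show ?case using insert.hyps by simp
qed (simp add: fe_zero)

lemma
  assumes "x \<in> nodes \<Omega> T"
  shows hat_fe: "\<phi> x \<in> P" and hat_node: "y \<in> nodes \<Omega> T \<Longrightarrow> \<phi> x y = (if y = x then 1 else 0)"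
proof -
  have "\<phi> x \<in> P \<and> (\<forall>y\<in>nodes \<Omega> T. \<phi> x y = (if y = x then 1 else 0))"
    unfolding hat_def
    by (rule theI'[OF fe_interpolation[of "\<lambda>y. if y = x then 1 else 0"]])
  then show "\<phi> x \<in> P" "y \<in> nodes \<Omega> T \<Longrightarrow> \<phi> x y = (if y = x then 1 else 0)" by auto
qed

lemma hat_sum_node:
  assumes "M \<subseteq> nodes \<Omega> T" "x \<in> M"
  shows "(\<Sum>y\<in>M. c y * \<phi> y x) = c x"
proof -
  have "(\<Sum>y\<in>M. c y * \<phi> y x) = (\<Sum>y\<in>M. c y * (if y = x then 1 else 0))"
    using assms by (intro sum.cong refl) (simp add: hat_node subset_iff eq_commute)
  then show ?thesis using sum_kronecker(2)[OF finite_subset[OF assms(1) finite_nodes] assms(2), of c] by simp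
qed

lemma fe_expand:
  assumes v: "v \<in> P"
  shows "v = (\<lambda>z. \<Sum>x\<in>nodes \<Omega> T. v x * \<phi> x z)"
proof -
  have "(\<lambda>z. \<Sum>x\<in>nodes \<Omega> T. v x * \<phi> x z) \<in> P"
    by (rule fe_sum[OF finite_nodes hat_fe])
  moreover have "(\<Sum>y\<in>nodes \<Omega> T. v y * \<phi> y x) = v x" if "x \<in> nodes \<Omega> T" for x
    by (rule hat_sum_node[OF order_refl that])
  ultimately show ?thesis using v fe_interpolation[of v] by blast
qed

lemma local_nodes_subset: "N i \<subseteq> nodes \<Omega> T"
  by (auto simp: local_nodes_def)

lemma finite_local_nodes: "finite (N i)"
  using local_nodes_subset finite_nodes by (rule finite_subset)

text \<open>If the hat were nonzero at a point of the subdomain, some cell with vertex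
  \<open>x\<close> would reach into the subdomain, hence lie in it, and \<open>x\<close> would be in
  its closure.\<close>

lemma hat_zero_sub:
  assumes "i \<in> {1..I}" "x \<in> nodes \<Omega> T" "x \<notin> N i" "z \<in> \<Omega>s i"
  shows "\<phi> x z = 0"
  using fe_support[OF assms(2), of z] cell_vertex_closure_sub[OF assms(1,4)] assms(2,3)
  by (auto simp: local_nodes_def)

lemma form_hat_zero:
  assumes "i \<in> {1..I}" "x \<in> nodes \<Omega> T" "x \<notin> N i" "v \<in> P"
  shows "bilinear_form \<eta> (\<Omega>s i) (\<phi> x) v = 0" "bilinear_form \<eta> (\<Omega>s i) v (\<phi> x) = 0"
  using bilinear_form_zero_on[OF open_sub sub_bounded fe_H1_sub hat_zero_sub] assms
  by (auto simp: bilinear_form_commute[of _ _ v])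

lemma form_sum:
  assumes "i \<in> {1..I}" "finite A" "\<And>a. a \<in> A \<Longrightarrow> v a \<in> P" "w \<in> P"
  shows "bilinear_form \<eta> (\<Omega>s i) (\<lambda>z. \<Sum>a\<in>A. c a * v a z) w = (\<Sum>a\<in>A. c a * bilinear_form \<eta> (\<Omega>s i) (v a) w)"
proof -
  have "\<And>a. a \<in> A \<Longrightarrow> v a \<in> H1 (\<Omega>s i)" "w \<in> H1 (\<Omega>s i)"
    using assms by (auto intro: fe_H1_sub)
  then show ?thesis
    using bilinear_form_sum[OF open_sub[OF assms(1)] sub_bounded[OF assms(1)] assms(2), where v = v and w = w] by blast
qed

lemma form_sum_sum:
  fixes c :: "real^2 \<Rightarrow> real"
  assumes i: "i \<in> {1..I}" and A: "A \<subseteq> nodes \<Omega> T"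
  defines "v \<equiv> \<lambda>z. \<Sum>x\<in>A. c x * \<phi> x z"
  shows "bilinear_form \<eta> (\<Omega>s i) v v = (\<Sum>x\<in>A. c x * (\<Sum>y\<in>A. bilinear_form \<eta> (\<Omega>s i) (\<phi> x) (\<phi> y) * c y))"
proof -
  have fin: "finite A" using A finite_nodes by (rule finite_subset)
  have h: "\<phi> x \<in> P" if "x \<in> A" for x using that A hat_fe by blast
  have v: "v \<in> P" unfolding v_def by (rule fe_sum[OF fin h])
  have expand: "bilinear_form \<eta> (\<Omega>s i) v w = (\<Sum>x\<in>A. c x * bilinear_form \<eta> (\<Omega>s i) (\<phi> x) w)" if "w \<in> P" for w
    unfolding v_def by (rule form_sum[OF i fin h that])
  have "bilinear_form \<eta> (\<Omega>s i) v v = (\<Sum>x\<in>A. c x * bilinear_form \<eta> (\<Omega>s i) (\<phi> x) v)"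
    by (rule expand[OF v])
  also have "\<dots> = (\<Sum>x\<in>A. c x * (\<Sum>y\<in>A. bilinear_form \<eta> (\<Omega>s i) (\<phi> x) (\<phi> y) * c y))"
  proof (intro sum.cong refl)
    fix x assume x: "x \<in> A"
    have "bilinear_form \<eta> (\<Omega>s i) (\<phi> x) v = bilinear_form \<eta> (\<Omega>s i) v (\<phi> x)" by (rule bilinear_form_commute)
    also have "\<dots> = (\<Sum>y\<in>A. c y * bilinear_form \<eta> (\<Omega>s i) (\<phi> y) (\<phi> x))"
      by (rule expand[OF h[OF x]])
    also have "\<dots> = (\<Sum>y\<in>A. bilinear_form \<eta> (\<Omega>s i) (\<phi> x) (\<phi> y) * c y)"
      by (intro sum.cong refl) (subst bilinear_form_commute, simp)
    finally show "c x * bilinear_form \<eta> (\<Omega>s i) (\<phi> x) v = c x * (\<Sum>y\<in>A. bilinear_form \<eta> (\<Omega>s i) (\<phi> x) (\<phi> y) * c y)"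
      by simp
  qed
  finally show ?thesis .
qed

section \<open>Local matrices and local solves\<close>

lemma A_matrix_commute: "A_matrix \<eta> \<Omega> T P S x y = A_matrix \<eta> \<Omega> T P S y x"
  unfolding A_matrix_def by (rule bilinear_form_commute)

text \<open>The quadratic form at \<open>c\<close> is the energy on \<open>\<Omega>s i\<close> of
  the finite element function with nodal values \<open>c\<close> on \<open>N i\<close>, which is
  nonzero at some node in the closure.\<close>

lemma A_matrix_pos_def:
  assumes i: "i \<in> {1..I}" and \<eta>: "\<eta> > 0"
  shows "pos_def_on (N i) (A_matrix \<eta> \<Omega> T P (\<Omega>s i))"
  unfolding pos_def_on_def
proof (intro allI impI)
  fix c :: "real^2 \<Rightarrow> real" assume "\<exists>x\<in>N i. c x \<noteq> 0"
  then obtain x where x: "x \<in> N i" "c x \<noteq> 0" by blast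
  define v where "v = (\<lambda>z. \<Sum>x\<in>N i. c x * \<phi> x z)"
  have v: "v \<in> P" unfolding v_def
    by (rule fe_sum[OF finite_local_nodes]) (use local_nodes_subset hat_fe in blast)
  have "v x = c x" unfolding v_def by (rule hat_sum_node[OF local_nodes_subset x(1)])
  then have "bilinear_form \<eta> (\<Omega>s i) v v > 0"
    using x by (intro bilinear_form_pos[OF open_sub[OF i] \<eta> fe_H1_sub[OF i v] fe_continuous[OF v], of x])
      (auto simp: local_nodes_def)
  also have "bilinear_form \<eta> (\<Omega>s i) v v = quad (N i) (A_matrix \<eta> \<Omega> T P (\<Omega>s i)) c"
    unfolding v_def form_sum_sum[OF i local_nodes_subset] quad_def A_matrix_def ..
  finally show "quad (N i) (A_matrix \<eta> \<Omega> T P (\<Omega>s i)) c > 0" .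
qed

lemma B_lump_row:
  assumes "x \<in> N i"
  shows "(\<Sum>y\<in>N i. B_lump p T S x y * w y) = p / 2 * (\<Sum>z\<in>boundary_nbrs T S x. dist x z) * w x"
proof -
  have "(\<Sum>y\<in>N i. B_lump p T S x y * w y) =
      (\<Sum>y\<in>N i. (if y = x then 1 else 0) * (p / 2 * (\<Sum>z\<in>boundary_nbrs T S x. dist x z) * w y))"
    by (intro sum.cong refl) (simp add: B_lump_def)
  also have "\<dots> = p / 2 * (\<Sum>z\<in>boundary_nbrs T S x. dist x z) * w x"
    by (rule sum_kronecker(1)[OF finite_local_nodes assms])
  finally show ?thesis .
qed

lemma system_pos_def:
  assumes i: "i \<in> {1..I}" and \<eta>: "\<eta> > 0" and p: "p > 0"
  shows "pos_def_on (N i) (\<lambda>x y. A_matrix \<eta> \<Omega> T P (\<Omega>s i) x y + B_lump p T (\<Omega>s i) x y)"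
  unfolding pos_def_on_def
proof (intro allI impI)
  fix c :: "real^2 \<Rightarrow> real" assume c: "\<exists>x\<in>N i. c x \<noteq> 0"
  have "quad (N i) (\<lambda>x y. A_matrix \<eta> \<Omega> T P (\<Omega>s i) x y + B_lump p T (\<Omega>s i) x y) c =
     quad (N i) (A_matrix \<eta> \<Omega> T P (\<Omega>s i)) c + (\<Sum>x\<in>N i. c x * (\<Sum>y\<in>N i. B_lump p T (\<Omega>s i) x y * c y))"
    by (simp add: quad_def distrib_left distrib_right sum.distrib)
  also have "(\<Sum>x\<in>N i. c x * (\<Sum>y\<in>N i. B_lump p T (\<Omega>s i) x y * c y)) =
     (\<Sum>x\<in>N i. p / 2 * (\<Sum>z\<in>boundary_nbrs T (\<Omega>s i) x. dist x z) * (c x)\<^sup>2)"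
    by (intro sum.cong refl) (simp add: B_lump_row power2_eq_square)
  finally have "quad (N i) (\<lambda>x y. A_matrix \<eta> \<Omega> T P (\<Omega>s i) x y + B_lump p T (\<Omega>s i) x y) c =
     quad (N i) (A_matrix \<eta> \<Omega> T P (\<Omega>s i)) c
     + (\<Sum>x\<in>N i. p / 2 * (\<Sum>z\<in>boundary_nbrs T (\<Omega>s i) x. dist x z) * (c x)\<^sup>2)" .
  moreover have "0 \<le> (\<Sum>x\<in>N i. p / 2 * (\<Sum>z\<in>boundary_nbrs T (\<Omega>s i) x. dist x z) * (c x)\<^sup>2)"
    using p by (intro sum_nonneg mult_nonneg_nonneg) auto
  moreover have "quad (N i) (A_matrix \<eta> \<Omega> T P (\<Omega>s i)) c > 0"
    using A_matrix_pos_def[OF i \<eta>] c unfolding pos_def_on_def by blast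
  ultimately show "quad (N i) (\<lambda>x y. A_matrix \<eta> \<Omega> T P (\<Omega>s i) x y + B_lump p T (\<Omega>s i) x y) c > 0"
    by linarith
qed

text \<open>Discharges the \<open>THE\<close> in \<open>local_solve\<close>: positive definiteness
  settles the values on \<open>N i\<close>, and the prescribed zeros settle the rest.\<close>

lemma local_solve_row:
  assumes i: "i \<in> {1..I}" and \<eta>: "\<eta> > 0" and p: "p > 0" and x: "x \<in> N i"
  shows "(\<Sum>y\<in>N i. (A_matrix \<eta> \<Omega> T P (\<Omega>s i) x y + B_lump p T (\<Omega>s i) x y) * local_solve \<eta> p \<Omega> T P (\<Omega>s i) r y) = r x"
proof -
  let ?M = "\<lambda>x y. A_matrix \<eta> \<Omega> T P (\<Omega>s i) x y + B_lump p T (\<Omega>s i) x y"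
  let ?Q = "\<lambda>w. (\<forall>x\<in>N i. (\<Sum>y\<in>N i. ?M x y * w y) = r x) \<and> (\<forall>x. x \<notin> N i \<longrightarrow> w x = 0)"
  note pd = system_pos_def[OF i \<eta> p]
  obtain w where w: "\<forall>x\<in>N i. (\<Sum>y\<in>N i. ?M x y * w y) = r x"
    using pos_def_on_solvable[OF finite_local_nodes pd, of r] by blast
  have "\<exists>!w. ?Q w"
  proof (rule ex1I)
    show "?Q (\<lambda>x. if x \<in> N i then w x else 0)" using w by simp
    show "v = (\<lambda>x. if x \<in> N i then w x else 0)" if v: "?Q v" for v
    proof
      fix x show "v x = (if x \<in> N i then w x else 0)"
        using pos_def_on_unique[OF pd conjunct1[OF v] w, of x] v by simp
    qed
  qed
  then have "?Q (local_solve \<eta> p \<Omega> T P (\<Omega>s i) r)" unfolding local_solve_def by (rule theI')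
  then show ?thesis using x by blast
qed

text \<open>The expansion of \<open>u\<close> runs over all nodes of the domain, but the hats of
  foreign nodes vanish on the subdomain.\<close>

lemma A_matrix_row:
  assumes i: "i \<in> {1..I}" and x: "x \<in> nodes \<Omega> T" and u: "u \<in> P"
  shows "(\<Sum>y\<in>N i. A_matrix \<eta> \<Omega> T P (\<Omega>s i) x y * u y) = bilinear_form \<eta> (\<Omega>s i) u (\<phi> x)"
proof -
  have "bilinear_form \<eta> (\<Omega>s i) u (\<phi> x) = bilinear_form \<eta> (\<Omega>s i) (\<lambda>z. \<Sum>y\<in>nodes \<Omega> T. u y * \<phi> y z) (\<phi> x)"
    using fe_expand[OF u] by (rule arg_cong)
  also have "\<dots> = (\<Sum>y\<in>nodes \<Omega> T. u y * bilinear_form \<eta> (\<Omega>s i) (\<phi> y) (\<phi> x))"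
    by (rule form_sum[OF i finite_nodes hat_fe hat_fe[OF x]])
  also have "\<dots> = (\<Sum>y\<in>N i. u y * bilinear_form \<eta> (\<Omega>s i) (\<phi> y) (\<phi> x))"
    using form_hat_zero(1)[OF i _ _ hat_fe[OF x]]
    by (intro sum.mono_neutral_right finite_nodes local_nodes_subset) auto
  also have "\<dots> = (\<Sum>y\<in>N i. A_matrix \<eta> \<Omega> T P (\<Omega>s i) x y * u y)"
    unfolding A_matrix_def by (intro sum.cong refl) (subst bilinear_form_commute, simp)
  finally show ?thesis ..
qed

section \<open>Fixed point and convergence\<close>

text \<open>Summing the local forms recovers the global equation for \<open>u\<close>, while the
  local loads add up to \<open>f x\<close>. This is the solvability condition for the flow at
  \<open>x\<close>.\<close>

lemma residual_sum:
  assumes x: "x \<in> nodes \<Omega> T" and u: "mono_domain_solution \<eta> \<Omega> T P f u"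
    and fs: "(\<Sum>i | i \<in> {1..I} \<and> x \<in> N i. fs i x) = f x"
  shows "(\<Sum>i\<in>{i \<in> {1..I}. x \<in> N i}. (\<Sum>y\<in>N i. A_matrix \<eta> \<Omega> T P (\<Omega>s i) x y * u y) - fs i x) = 0"
proof -
  have uP: "u \<in> P" and ux: "bilinear_form \<eta> \<Omega> u (\<phi> x) = f x"
    using u x by (auto simp: mono_domain_solution_def)
  have "f x = (\<Sum>i\<in>{1..I}. bilinear_form \<eta> (\<Omega>s i) u (\<phi> x))"
    unfolding ux[symmetric] using open_sub sub_subset sub_disjoint
    by (intro bilinear_form_decompose open_domain bounded_domain negligible_skeleton fe_H1 uP hat_fe x)
       (auto simp: disjoint_family_on_def)
  also have "\<dots> = (\<Sum>i\<in>{i \<in> {1..I}. x \<in> N i}. bilinear_form \<eta> (\<Omega>s i) u (\<phi> x))"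
    using form_hat_zero(2)[OF _ x _ uP] by (intro sum.mono_neutral_right) auto
  also have "\<dots> = (\<Sum>i\<in>{i \<in> {1..I}. x \<in> N i}. \<Sum>y\<in>N i. A_matrix \<eta> \<Omega> T P (\<Omega>s i) x y * u y)"
    by (intro sum.cong refl) (simp add: A_matrix_row[OF _ x uP])
  finally show ?thesis using fs by (simp add: sum_subtractf)
qed

text \<open>The limit of the auxiliary variables splits into the symmetric part \<open>p / 2 * u\<close> per edge length
  and an antisymmetric part, a flow which balances the residuals of \<open>u\<close> around each node.\<close>

lemma fixed_point_exists:
  assumes u: "mono_domain_solution \<eta> \<Omega> T P f u"
    and fs: "\<forall>x\<in>nodes \<Omega> T. (\<Sum>i | i \<in> {1..I} \<and> x \<in> N i. fs i x) = f x"
  obtains g where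
    "\<And>i x. i \<in> {1..I} \<Longrightarrow> x \<in> N i \<Longrightarrow>
       (\<Sum>y\<in>N i. (A_matrix \<eta> \<Omega> T P (\<Omega>s i) x y + B_lump p T (\<Omega>s i) x y) * u y)
         = fs i x + (\<Sum>j\<in>{j. (i, j) \<in> coupled x}. g i j x)"
    "\<And>i j x. (i, j) \<in> coupled x \<Longrightarrow> g j i x = - g i j x + p * u x * shared_length i j x"
proof -
  define r where "r i x = (\<Sum>y\<in>N i. A_matrix \<eta> \<Omega> T P (\<Omega>s i) x y * u y) - fs i x" for i x
  define Q where "Q x h \<longleftrightarrow> (\<forall>i j. h j i = - h i j) \<and> (\<forall>i j. (i, j) \<notin> coupled x \<longrightarrow> h i j = 0) \<and>
      (\<forall>i\<in>{i \<in> {1..I}. x \<in> N i}. (\<Sum>j\<in>{1..I}. h i j) = r i x)" for x and h :: "nat \<Rightarrow> nat \<Rightarrow> real"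
  have "\<exists>h. Q x h" if x: "x \<in> nodes \<Omega> T" for x
    unfolding Q_def
  proof (rule zero_sum_flow)
    show "(\<Sum>i\<in>{i \<in> {1..I}. x \<in> N i}. r i x) = 0"
      unfolding r_def using residual_sum[OF x u] fs x by blast
    show "(i, j) \<in> (coupled x)\<^sup>*" if "i \<in> {i \<in> {1..I}. x \<in> N i}" "j \<in> {i \<in> {1..I}. x \<in> N i}" for i j
      using that by (intro coupled_connected x) (auto simp: local_nodes_def)
  qed (use coupled_subset coupled_irrefl coupled_sym in auto)
  then obtain h where "\<And>x. x \<in> nodes \<Omega> T \<Longrightarrow> Q x (h x)" by metis
  then have h: "\<And>x i j. x \<in> nodes \<Omega> T \<Longrightarrow> h x j i = - h x i j"
    "\<And>x i j. x \<in> nodes \<Omega> T \<Longrightarrow> (i, j) \<notin> coupled x \<Longrightarrow> h x i j = 0"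
    "\<And>x i. x \<in> nodes \<Omega> T \<Longrightarrow> i \<in> {1..I} \<Longrightarrow> x \<in> N i \<Longrightarrow> (\<Sum>j\<in>{1..I}. h x i j) = r i x"
    unfolding Q_def by blast+
  \<comment> \<open>A fixed point of the update prescribes only \<open>g i j x + g j i x\<close>,
    that is, the symmetric part. Summed over \<open>j\<close>, this part equals the
    \<open>B_lump\<close> term, by \<open>boundary_nbrs_sum\<close>; the residual is left to the
    antisymmetric part.\<close>
  define g where "g i j x = p / 2 * u x * shared_length i j x + h x i j" for i j x
  show thesis
  proof
    fix i x assume i: "i \<in> {1..I}" and x: "x \<in> N i"
    have xn: "x \<in> nodes \<Omega> T" using x local_nodes_subset by blast
    have "(\<Sum>j\<in>{j. (i, j) \<in> coupled x}. h x i j) = (\<Sum>j\<in>{1..I}. h x i j)"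
      using coupled_subset h(2)[OF xn] by (intro sum.mono_neutral_left) auto
    then have "(\<Sum>j\<in>{j. (i, j) \<in> coupled x}. g i j x) =
        p / 2 * u x * (\<Sum>j\<in>{j. (i, j) \<in> coupled x}. shared_length i j x) + r i x"
      unfolding g_def sum.distrib h(3)[OF xn i x, symmetric] by (simp add: sum_distrib_left)
    then show "(\<Sum>y\<in>N i. (A_matrix \<eta> \<Omega> T P (\<Omega>s i) x y + B_lump p T (\<Omega>s i) x y) * u y)
         = fs i x + (\<Sum>j\<in>{j. (i, j) \<in> coupled x}. g i j x)"
      unfolding distrib_right sum.distrib B_lump_row[OF x] boundary_nbrs_sum[OF i xn] r_def by simp
  next
    fix i j x assume ij: "(i, j) \<in> coupled x"
    then have xn: "x \<in> nodes \<Omega> T" by (simp add: coupled_def)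
    have "shared_length j i x = shared_length i j x" by (simp add: shared_nbrs_def Int_commute)
    then show "g j i x = - g i j x + p * u x * shared_length i j x"
      using h(1)[OF xn, of j i] by (simp add: g_def)
  qed
qed

text \<open>The method is affine, so subtracting the fixed point leaves the homogeneous recursion of
  \<open>robin_error_tendsto_0\<close>.\<close>

lemma schwarz_coeff_tendsto:
  assumes \<eta>: "\<eta> > 0" and p: "p > 0"
    and fs: "\<forall>x\<in>nodes \<Omega> T. (\<Sum>i | i \<in> {1..I} \<and> x \<in> N i. fs i x) = f x"
    and u: "mono_domain_solution \<eta> \<Omega> T P f u"
    and i: "i \<in> {1..I}" and x: "x \<in> N i"
  shows "(\<lambda>n. schwarz_coeff \<eta> p \<Omega> T P I \<Omega>s fs g0 n i x) \<longlonglongrightarrow> u x"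
proof -
  let ?A = "\<lambda>i. A_matrix \<eta> \<Omega> T P (\<Omega>s i)" and ?B = "\<lambda>i. B_lump p T (\<Omega>s i)"
  let ?aux = "schwarz_aux \<eta> p \<Omega> T P I \<Omega>s fs g0"
  let ?c = "schwarz_coeff \<eta> p \<Omega> T P I \<Omega>s fs g0"
  obtain g where g: "\<And>i x. i \<in> {1..I} \<Longrightarrow> x \<in> N i \<Longrightarrow> (\<Sum>y\<in>N i. (?A i x y + ?B i x y) * u y)
         = fs i x + (\<Sum>j\<in>{j. (i, j) \<in> coupled x}. g i j x)"
    "\<And>i j x. (i, j) \<in> coupled x \<Longrightarrow> g j i x = - g i j x + p * u x * shared_length i j x"
    by (rule fixed_point_exists[OF u fs, of p]) blast
  define d where "d n i j x = ?aux n i j x - g i j x" for n i j x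
  define w where "w n i x = ?c n i x - u x" for n i x
  have "(\<lambda>n. w n i x) \<longlonglongrightarrow> 0"
  proof (rule robin_error_tendsto_0[where K = "{1..I}" and N = N and A = ?A and E = coupled
        and s = shared_length and d = d])
    fix n i x assume i: "i \<in> {1..I}" and x: "x \<in> N i"
    have xn: "x \<in> nodes \<Omega> T" using x local_nodes_subset by blast
    have "{j. j \<in> {1..I} \<and> j \<noteq> i \<and> shared_nbrs T (\<Omega>s i) (\<Omega>s j) x \<noteq> {}} = {j. (i, j) \<in> coupled x}"
      using i xn by (auto simp: coupled_def)
    then have "gather T I \<Omega>s (?aux n) i x = (\<Sum>j\<in>{j. (i, j) \<in> coupled x}. ?aux n i j x)"
      unfolding gather_def by simp
    then have "(\<Sum>y\<in>N i. (?A i x y + ?B i x y) * ?c n i y) = fs i x + (\<Sum>j\<in>{j. (i, j) \<in> coupled x}. ?aux n i j x)"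
      unfolding schwarz_coeff_def schwarz_solve_def using local_solve_row[OF i \<eta> p x] by simp
    then have "(\<Sum>y\<in>N i. (?A i x y + ?B i x y) * w n i y) = (\<Sum>j\<in>{j. (i, j) \<in> coupled x}. d n i j x)"
      using g(1)[OF i x] unfolding w_def d_def right_diff_distrib sum_subtractf by simp
    then show "(\<Sum>y\<in>N i. ?A i x y * w n i y)
        + p / 2 * (\<Sum>j\<in>{j. (i, j) \<in> coupled x}. shared_length i j x) * w n i x
        = (\<Sum>j\<in>{j. (i, j) \<in> coupled x}. d n i j x)"
      unfolding distrib_right sum.distrib B_lump_row[OF x] boundary_nbrs_sum[OF i xn] .
  next
    fix n i j x assume ij: "(i, j) \<in> coupled x"
    \<comment> \<open>The coefficients with index \<open>n\<close> are computed from the auxiliary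
      values with index \<open>n\<close>; they are the ones that enter the step to
      \<open>Suc n\<close>.\<close>
    have "?aux (Suc n) j i x = - ?aux n i j x + p * ?c n i x * shared_length i j x"
      by (simp add: schwarz_coeff_def Let_def)
    then show "d (Suc n) j i x = - d n i j x + p * w n i x * shared_length i j x"
      using g(2)[OF ij] unfolding d_def w_def by (simp add: algebra_simps)
  next
    show "shared_length i j x = shared_length j i x" for i j x
      by (simp add: shared_nbrs_def Int_commute)
  qed (use p i x coupled_subset coupled_sym coupled_local_node shared_length_pos A_matrix_pos_def[OF _ \<eta>]
      A_matrix_commute finite_local_nodes in auto)
  then show ?thesis unfolding w_def by (rule LIM_zero_cancel)
qed

text \<open>The squared norm of the error is the form with parameter 1, hence a finite quadratic
  expression in the nodal errors.\<close>

lemma schwarz_iterate_tendsto: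
  assumes u: "u \<in> P" and i: "i \<in> {1..I}"
    and lim: "\<And>x. x \<in> N i \<Longrightarrow> (\<lambda>n. schwarz_coeff \<eta> p \<Omega> T P I \<Omega>s fs g0 n i x) \<longlonglongrightarrow> u x"
  shows "(\<lambda>n. H1_norm (\<Omega>s i) (\<lambda>z. schwarz_iterate \<eta> p \<Omega> T P I \<Omega>s fs g0 n i z - u z)) \<longlonglongrightarrow> 0"
proof -
  \<comment> \<open>Since \<open>u\<close> expands over all nodes, the iterate is extended by zero.
    At foreign nodes \<open>c\<close> need not tend to 0, but the matrix entries vanish
    there.\<close>
  define c where "c n x = (if x \<in> N i then schwarz_coeff \<eta> p \<Omega> T P I \<Omega>s fs g0 n i x else 0) - u x" for n x
  have eq: "schwarz_iterate \<eta> p \<Omega> T P I \<Omega>s fs g0 n i z - u z = (\<Sum>x\<in>nodes \<Omega> T. c n x * \<phi> x z)" for n z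
  proof -
    have "schwarz_iterate \<eta> p \<Omega> T P I \<Omega>s fs g0 n i z =
        (\<Sum>x\<in>nodes \<Omega> T. (if x \<in> N i then schwarz_coeff \<eta> p \<Omega> T P I \<Omega>s fs g0 n i x else 0) * \<phi> x z)"
      unfolding schwarz_iterate_def
      by (intro sum.mono_neutral_cong_left finite_nodes local_nodes_subset) auto
    then show ?thesis using fun_cong[OF fe_expand[OF u], of z]
      by (simp add: c_def left_diff_distrib sum_subtractf)
  qed
  let ?M = "\<lambda>x y. bilinear_form 1 (\<Omega>s i) (\<phi> x) (\<phi> y)"
  have "(\<lambda>n. c n x * (?M x y * c n y)) \<longlonglongrightarrow> 0" if xy: "x \<in> nodes \<Omega> T" "y \<in> nodes \<Omega> T" for x y
  proof (cases "x \<in> N i \<and> y \<in> N i")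
    case True
    have "(\<lambda>n. c n z) \<longlonglongrightarrow> 0" if "z \<in> N i" for z
      using lim[OF that] that by (simp add: c_def LIM_zero)
    then have "(\<lambda>n. c n x * (?M x y * c n y)) \<longlonglongrightarrow> 0 * (?M x y * 0)"
      using True by (intro tendsto_mult tendsto_const) auto
    then show ?thesis by simp
  next
    case False
    then have "?M x y = 0" using form_hat_zero[OF i] xy hat_fe by blast
    then show ?thesis by simp
  qed
  then have "(\<lambda>n. \<Sum>x\<in>nodes \<Omega> T. \<Sum>y\<in>nodes \<Omega> T. c n x * (?M x y * c n y)) \<longlonglongrightarrow> (\<Sum>x\<in>nodes \<Omega> T. \<Sum>y\<in>nodes \<Omega> T. 0)"
    by (intro tendsto_sum) auto
  then have "(\<lambda>n. sqrt (\<Sum>x\<in>nodes \<Omega> T. c n x * (\<Sum>y\<in>nodes \<Omega> T. ?M x y * c n y))) \<longlonglongrightarrow> sqrt 0"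
    by (intro tendsto_real_sqrt) (simp add: sum_distrib_left)
  then show ?thesis
    unfolding H1_norm_eq eq form_sum_sum[OF i order_refl] by simp
qed

end

theorem theorem3p2:
  fixes \<Omega> :: "(real^2) set" and T :: "(real^2) list set"
    and I :: nat and \<Omega>s :: "nat \<Rightarrow> (real^2) set"
    and P :: "(real^2 \<Rightarrow> real) set"
    and \<eta> p :: real
    and f :: "real^2 \<Rightarrow> real" and fs :: "nat \<Rightarrow> real^2 \<Rightarrow> real"
    and u :: "real^2 \<Rightarrow> real"
    and g0 :: "nat \<Rightarrow> nat \<Rightarrow> real^2 \<Rightarrow> real"
  assumes "polygonal_domain \<Omega>" and "bounded \<Omega>"
    and "conforming_mesh \<Omega> T"
    and "nonoverlapping_decomposition \<Omega> T I \<Omega>s"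
    and "nodal_fe_space \<Omega> T P"
    and "\<eta> > 0" and "p > 0"
    and "\<forall>x\<in>nodes \<Omega> T. (\<Sum>i | i \<in> {1..I} \<and> x \<in> local_nodes \<Omega> T (\<Omega>s i). fs i x) = f x"
    and "mono_domain_solution \<eta> \<Omega> T P f u"
  shows "\<forall>i\<in>{1..I}.
      (\<lambda>n. H1_norm (\<Omega>s i) (\<lambda>z. schwarz_iterate \<eta> p \<Omega> T P I \<Omega>s fs g0 n i z - u z)) \<longlonglongrightarrow> 0 \<and>
      (\<forall>x\<in>local_nodes \<Omega> T (\<Omega>s i). (\<lambda>n. schwarz_coeff \<eta> p \<Omega> T P I \<Omega>s fs g0 n i x) \<longlonglongrightarrow> u x)"
proof -
  interpret fe_decomposition \<Omega> T I \<Omega>s P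
    using assms by unfold_locales
  have "u \<in> P" using assms(9) by (simp add: mono_domain_solution_def)
  then show ?thesis
    using schwarz_coeff_tendsto[OF assms(6-9)] schwarz_iterate_tendsto by blast
qed

end
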